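(* Let $\beta=(\pi_\ell)_{\ell=1}^L$ be a non-redundant chainable architecture of depth $L\ge 2$, let $\mathbf{A}\in\mathbb{C}^{m\times n}$ with $m=a_1b_1d_1$, $n=a_Lc_Ld_L$, and let $\sigma$ be either the identity permutation $(1,\dots,L-1)$ or the permutation $(L-1,\dots,1)$. Then the butterfly algorithm with inputs $(\mathbf{A},\beta,\sigma)$ returns $(\mathbf{X}_\ell)_{\ell=1}^L\in\Sigma^\beta$ such that $$\|\mathbf{A}-\mathbf{X}_1\cdots\mathbf{X}_L\|_F^2\le\sum_{k=1}^{L-1}\big[E^{\beta_k}(\mathbf{A})\big]^2.$$
   Context: A pattern is a tuple $\pi=(a,b,c,d)$ of positive integers; $\mathbf{S}_\pi:=\mathbf{I}_a\otimes\mathbf{1}_{b\times c}\otimes\mathbf{I}_d\in\{0,1\}^{abd\times acd}$. A $\pi$-factor is a complex $abd\times acd$ matrix with support contained in that of $\mathbf{S}_\pi$; $\Sigma^\pi$ is the set of $\pi$-factors. Patterns $\pi_1=(a_1,b_1,c_1,d_1),\pi_2=(a_2,b_2,c_2,d_2)$ are chainable if $a_1c_1/a_2=b_2d_2/d_1=:r(\pi_1,\pi_2)$ is an integer, $a_1\mid a_2$, $d_2\mid d_1$; then $\pi_1*\pi_2:=(a_1,b_1d_1/d_2,a_2c_2/a_1,d_2)$; such a pair is redundant if $r(\pi_1,\pi_2)\ge\min(b_1,c_2)$. An architecture $\beta=(\pi_\ell)_{\ell=1}^L$ is a sequence of patterns with $a_\ell c_\ell d_\ell=a_{\ell+1}b_{\ell+1}d_{\ell+1}$;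 it is chainable if consecutive pairs are chainable and redundant if some consecutive pair is redundant. $\pi_{[p,q]}:=\pi_p*\cdots*\pi_q$ (iterated product, well defined for chainable $\beta$). $\Sigma^\beta:=\Sigma^{\pi_1}\times\cdots\times\Sigma^{\pi_L}$. For $s\in\{1,\dots,L-1\}$, $\beta_s:=(\pi_{[1,s]},\pi_{[s+1,L]})$ and $E^{\beta_s}(\mathbf{A}):=\min_{\mathbf{X}\in\Sigma^{\pi_{[1,s]}},\mathbf{Y}\in\Sigma^{\pi_{[s+1,L]}}}\|\mathbf{A}-\mathbf{X}\mathbf{Y}\|_F$. For binary $\mathbf{L},\mathbf{R}$ with $\mathbf{U}_i:=\mathbf{L}[:,i]\mathbf{R}[i,:]$, $\mathcal{P}(\mathbf{L},\mathbf{R})$ is the partition of column indices of $\mathbf{L}$ into classes of the relation $\mathbf{U}_i=\mathbf{U}_j$, and $R_P\times C_P$ is the support of $\mathbf{U}_i$ for $i\in P$. TwoFactor$(\mathbf{M},\pi,\pi')$: zero $\mathbf{X},\mathbf{Y}$ of $\pi$-, $\pi'$-factor sizes; for each $P\in\mathcal{P}(\mathbf{S}_\pi,\mathbf{S}_{\pi'})$ set $(\mathbf{X}[R_P,P],\mathbf{Y}[P,C_P])$ to any minimizer $(\mathbf{H},\mathbf{K})$ of $\|\mathbf{M}[R_P,C_P]-\mathbf{H}\mathbf{K}\|_F$ over $\mathbf{H}\in\mathbb{C}^{|R_P|\times|P|},\mathbf{K}\in\mathbb{C}^{|P|\times|C_P|}$. Ortho$(\pi,\pi',\mathbf{X},\mathbf{Y},u)$: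 zero $\tilde{\mathbf{X}},\tilde{\mathbf{Y}}$; for each $P\in\mathcal{P}(\mathbf{S}_\pi,\mathbf{S}_{\pi'})$: if $u=$ column, QR-decompose $\mathbf{X}[R_P,P]=\mathbf{Q}\mathbf{R}$ and set $\tilde{\mathbf{X}}[R_P,P]=\mathbf{Q}$, $\tilde{\mathbf{Y}}[P,C_P]=\mathbf{R}\mathbf{Y}[P,C_P]$; if $u=$ row, QR-decompose $\mathbf{Y}[P,C_P]^\top=\mathbf{Q}\mathbf{R}$ and set $\tilde{\mathbf{X}}[R_P,P]=\mathbf{X}[R_P,P]\mathbf{R}^\top$, $\tilde{\mathbf{Y}}[P,C_P]=\mathbf{Q}^\top$. Butterfly algorithm: keep consecutive intervals $I_1,\dots,I_J$ partitioning $\{1,\dots,L\}$ with factors $\mathbf{X}_{I_k}$, initially $I_1=[1,L]$, $\mathbf{X}_{I_1}=\mathbf{A}$. For $J=1,\dots,L-1$: $s=\sigma_J$, $j$ with $s\in I_j=[q,t]$; for $k=1,\dots,j-1$: $(\mathbf{X}_{I_k},\mathbf{X}_{I_{k+1}})\leftarrow$ Ortho$(\pi_{I_k},\pi_{I_{k+1}},\mathbf{X}_{I_k},\mathbf{X}_{I_{k+1}},\text{column})$; for $k=J,\dots,j+1$ (decreasing): $(\mathbf{X}_{I_{k-1}},\mathbf{X}_{I_k})\leftarrow$ Ortho$(\pi_{I_{k-1}},\pi_{I_k},\mathbf{X}_{I_{k-1}},\mathbf{X}_{I_k},\text{row})$; then $(\mathbf{X}_{[q,s]},\mathbf{X}_{[s+1,t]})\leftarrow$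 TwoFactor$(\mathbf{X}_{I_j},\pi_{[q,s]},\pi_{[s+1,t]})$ and $I_j$ is replaced by $[q,s],[s+1,t]$. Output $(\mathbf{X}_{[\ell,\ell]})_{\ell=1}^L$. *)

theory Defs
  imports Complex_Main "Jordan_Normal_Form.Matrix"
begin

definition frob :: "complex mat \<Rightarrow> real" where
  "frob A = sqrt (\<Sum>i<dim_row A. \<Sum>j<dim_col A. (cmod (A $$ (i,j)))^2)"

definition kron :: "'a::times mat \<Rightarrow> 'a mat \<Rightarrow> 'a mat" where
  "kron A B = mat (dim_row A * dim_row B) (dim_col A * dim_col B)
     (\<lambda>(i,j). A $$ (i div dim_row B, j div dim_col B) * B $$ (i mod dim_row B, j mod dim_col B))"

definition ones_mat :: "nat \<Rightarrow> nat \<Rightarrow> nat mat" where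
  "ones_mat b c = mat b c (\<lambda>_. 1)"

definition cadj :: "complex mat \<Rightarrow> complex mat" where
  "cadj Q = mat (dim_col Q) (dim_row Q) (\<lambda>(i,j). cnj (Q $$ (j,i)))"

definition pos :: "nat set \<Rightarrow> nat \<Rightarrow> nat" where
  "pos S i = card {x\<in>S. x < i}"

definition subm :: "'a mat \<Rightarrow> nat set \<Rightarrow> nat set \<Rightarrow> 'a mat" where
  "subm X I J = mat (card I) (card J)
     (\<lambda>(i,j). X $$ (sorted_list_of_set I ! i, sorted_list_of_set J ! j))"

text \<open>Matrix of size \<open>m \<times> n\<close> which is zero except on the (disjoint) blocks
  \<open>RI P \<times> CI P\<close>, \<open>P \<in> Ps\<close>, where it equals the block \<open>B P\<close>.\<close>
definition assemble :: "nat \<Rightarrow> nat \<Rightarrow> 'p set \<Rightarrow> ('p \<Rightarrow> nat set) \<Rightarrow> ('p \<Rightarrow> nat set)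
    \<Rightarrow> ('p \<Rightarrow> complex mat) \<Rightarrow> complex mat" where
  "assemble m n Ps RI CI B = mat m n (\<lambda>(i,j).
     if \<exists>P\<in>Ps. i \<in> RI P \<and> j \<in> CI P
     then (let P = (SOME P. P \<in> Ps \<and> i \<in> RI P \<and> j \<in> CI P)
           in B P $$ (pos (RI P) i, pos (CI P) j))
     else 0)"

type_synonym pattern = "nat \<times> nat \<times> nat \<times> nat"

definition pa :: "pattern \<Rightarrow> nat" where "pa \<pi> = (case \<pi> of (a,b,c,d) \<Rightarrow> a)"
definition pb :: "pattern \<Rightarrow> nat" where "pb \<pi> = (case \<pi> of (a,b,c,d) \<Rightarrow> b)"
definition pc :: "pattern \<Rightarrow> nat" where "pc \<pi> = (case \<pi> of (a,b,c,d) \<Rightarrow> c)"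
definition pd :: "pattern \<Rightarrow> nat" where "pd \<pi> = (case \<pi> of (a,b,c,d) \<Rightarrow> d)"

definition is_pattern :: "pattern \<Rightarrow> bool" where
  "is_pattern \<pi> \<longleftrightarrow> pa \<pi> > 0 \<and> pb \<pi> > 0 \<and> pc \<pi> > 0 \<and> pd \<pi> > 0"

definition nrows :: "pattern \<Rightarrow> nat" where "nrows \<pi> = pa \<pi> * pb \<pi> * pd \<pi>"
definition ncols :: "pattern \<Rightarrow> nat" where "ncols \<pi> = pa \<pi> * pc \<pi> * pd \<pi>"

definition S_pat :: "pattern \<Rightarrow> nat mat" where
  "S_pat \<pi> = kron (kron (1\<^sub>m (pa \<pi>)) (ones_mat (pb \<pi>) (pc \<pi>))) (1\<^sub>m (pd \<pi>))"

definition Sigma_pat :: "pattern \<Rightarrow> complex mat set" where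
  "Sigma_pat \<pi> = {X. X \<in> carrier_mat (nrows \<pi>) (ncols \<pi>) \<and>
     (\<forall>i<nrows \<pi>. \<forall>j<ncols \<pi>. S_pat \<pi> $$ (i,j) = 0 \<longrightarrow> X $$ (i,j) = 0)}"

definition r_pat :: "pattern \<Rightarrow> pattern \<Rightarrow> nat" where
  "r_pat \<pi>1 \<pi>2 = pa \<pi>1 * pc \<pi>1 div pa \<pi>2"

definition chainable :: "pattern \<Rightarrow> pattern \<Rightarrow> bool" where
  "chainable \<pi>1 \<pi>2 \<longleftrightarrow>
     pa \<pi>2 dvd pa \<pi>1 * pc \<pi>1 \<and> pd \<pi>1 dvd pb \<pi>2 * pd \<pi>2 \<and>
     pa \<pi>1 * pc \<pi>1 div pa \<pi>2 = pb \<pi>2 * pd \<pi>2 div pd \<pi>1 \<and>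
     pa \<pi>1 dvd pa \<pi>2 \<and> pd \<pi>2 dvd pd \<pi>1"

definition pstar :: "pattern \<Rightarrow> pattern \<Rightarrow> pattern" where
  "pstar \<pi>1 \<pi>2 = (pa \<pi>1, pb \<pi>1 * pd \<pi>1 div pd \<pi>2, pa \<pi>2 * pc \<pi>2 div pa \<pi>1, pd \<pi>2)"

definition redundant_pair :: "pattern \<Rightarrow> pattern \<Rightarrow> bool" where
  "redundant_pair \<pi>1 \<pi>2 \<longleftrightarrow> r_pat \<pi>1 \<pi>2 \<ge> min (pb \<pi>1) (pc \<pi>2)"

definition pat :: "pattern list \<Rightarrow> nat \<Rightarrow> pattern" where
  "pat \<beta> l = \<beta> ! (l - 1)"

definition architecture :: "pattern list \<Rightarrow> bool" where
  "architecture \<beta> \<longleftrightarrow> (\<forall>\<pi>\<in>set \<beta>. is_pattern \<pi>) \<and>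
     (\<forall>l. 1 \<le> l \<and> l < length \<beta> \<longrightarrow> ncols (pat \<beta> l) = nrows (pat \<beta> (l+1)))"

definition chainable_arch :: "pattern list \<Rightarrow> bool" where
  "chainable_arch \<beta> \<longleftrightarrow>
     (\<forall>l. 1 \<le> l \<and> l < length \<beta> \<longrightarrow> chainable (pat \<beta> l) (pat \<beta> (l+1)))"

definition redundant_arch :: "pattern list \<Rightarrow> bool" where
  "redundant_arch \<beta> \<longleftrightarrow>
     (\<exists>l. 1 \<le> l \<and> l < length \<beta> \<and> redundant_pair (pat \<beta> l) (pat \<beta> (l+1)))"

definition pint :: "pattern list \<Rightarrow> nat \<Rightarrow> nat \<Rightarrow> pattern" where
  "pint \<beta> p q = foldl pstar (pat \<beta> p) (map (pat \<beta>) [Suc p..<Suc q])"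

definition E_err :: "pattern list \<Rightarrow> nat \<Rightarrow> complex mat \<Rightarrow> real" where
  "E_err \<beta> s A = Inf {frob (A - X * Y) | X Y.
      X \<in> Sigma_pat (pint \<beta> 1 s) \<and> Y \<in> Sigma_pat (pint \<beta> (s+1) (length \<beta>))}"

definition Umat :: "'a::semiring_0 mat \<Rightarrow> 'a mat \<Rightarrow> nat \<Rightarrow> 'a mat" where
  "Umat L R i = mat (dim_row L) (dim_col R) (\<lambda>(p,q). L $$ (p,i) * R $$ (i,q))"

definition parts :: "'a::semiring_0 mat \<Rightarrow> 'a mat \<Rightarrow> nat set set" where
  "parts L R = {{j. j < dim_col L \<and> Umat L R j = Umat L R i} | i. i < dim_col L}"

definition repr :: "nat set \<Rightarrow> nat" where "repr P = (SOME i. i \<in> P)"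

definition RP :: "'a::semiring_0 mat \<Rightarrow> 'a mat \<Rightarrow> nat set \<Rightarrow> nat set" where
  "RP L R P = {p. p < dim_row L \<and> (\<exists>q<dim_col R. Umat L R (repr P) $$ (p,q) \<noteq> 0)}"

definition CP :: "'a::semiring_0 mat \<Rightarrow> 'a mat \<Rightarrow> nat set \<Rightarrow> nat set" where
  "CP L R P = {q. q < dim_col R \<and> (\<exists>p<dim_row L. Umat L R (repr P) $$ (p,q) \<noteq> 0)}"

section \<open>TwoFactor and Ortho (nondeterministic: sets of possible outputs)\<close>

definition is_minimizer :: "complex mat \<Rightarrow> nat \<Rightarrow> complex mat \<Rightarrow> complex mat \<Rightarrow> bool" where
  "is_minimizer Mb k H K \<longleftrightarrow>
     H \<in> carrier_mat (dim_row Mb) k \<and> K \<in> carrier_mat k (dim_col Mb) \<and>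
     (\<forall>H' K'. H' \<in> carrier_mat (dim_row Mb) k \<longrightarrow> K' \<in> carrier_mat k (dim_col Mb) \<longrightarrow>
        frob (Mb - H * K) \<le> frob (Mb - H' * K'))"

definition two_factor :: "complex mat \<Rightarrow> pattern \<Rightarrow> pattern \<Rightarrow> (complex mat \<times> complex mat) set" where
  "two_factor M \<pi> \<pi>' =
    (let L = S_pat \<pi>; R = S_pat \<pi>'; Ps = parts L R in
     {(assemble (nrows \<pi>) (ncols \<pi>) Ps (RP L R) id (\<lambda>P. fst (HK P)),
       assemble (nrows \<pi>') (ncols \<pi>') Ps id (CP L R) (\<lambda>P. snd (HK P))) | HK.
       \<forall>P\<in>Ps. is_minimizer (subm M (RP L R P) (CP L R P)) (card P) (fst (HK P)) (snd (HK P))})"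

definition is_qr :: "complex mat \<Rightarrow> complex mat \<Rightarrow> complex mat \<Rightarrow> bool" where
  "is_qr B Q R \<longleftrightarrow>
     Q \<in> carrier_mat (dim_row B) (dim_col B) \<and> R \<in> carrier_mat (dim_col B) (dim_col B) \<and>
     cadj Q * Q = 1\<^sub>m (dim_col B) \<and> upper_triangular R \<and> B = Q * R"

datatype orient = Column | Row

definition ortho :: "pattern \<Rightarrow> pattern \<Rightarrow> complex mat \<Rightarrow> complex mat \<Rightarrow> orient
    \<Rightarrow> (complex mat \<times> complex mat) set" where
  "ortho \<pi> \<pi>' X Y u =
    (let L = S_pat \<pi>; R = S_pat \<pi>'; Ps = parts L R in
     if u = Column then
       {(assemble (nrows \<pi>) (ncols \<pi>) Ps (RP L R) id (\<lambda>P. fst (QR P)),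
         assemble (nrows \<pi>') (ncols \<pi>') Ps id (CP L R)
            (\<lambda>P. snd (QR P) * subm Y P (CP L R P))) | QR.
         \<forall>P\<in>Ps. is_qr (subm X (RP L R P) P) (fst (QR P)) (snd (QR P))}
     else
       {(assemble (nrows \<pi>) (ncols \<pi>) Ps (RP L R) id
            (\<lambda>P. subm X (RP L R P) P * transpose_mat (snd (QR P))),
         assemble (nrows \<pi>') (ncols \<pi>') Ps id (CP L R) (\<lambda>P. transpose_mat (fst (QR P)))) | QR.
         \<forall>P\<in>Ps. is_qr (transpose_mat (subm Y P (CP L R P))) (fst (QR P)) (snd (QR P))})"

text \<open>State: list of consecutive intervals \<open>[q,t]\<close> (as pairs) with their current factors.\<close>
type_synonym bstate = "((nat \<times> nat) \<times> complex mat) list"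

definition ipat :: "pattern list \<Rightarrow> nat \<times> nat \<Rightarrow> pattern" where
  "ipat \<beta> I = pint \<beta> (fst I) (snd I)"

definition ortho_step :: "pattern list \<Rightarrow> orient \<Rightarrow> nat \<Rightarrow> bstate \<Rightarrow> bstate set" where
  "ortho_step \<beta> u k st =
    (let (I1, X1) = st ! (k - 1); (I2, X2) = st ! k in
     {st[k - 1 := (I1, fst XY), k := (I2, snd XY)] | XY.
        XY \<in> ortho (ipat \<beta> I1) (ipat \<beta> I2) X1 X2 u})"

definition seq_steps :: "(nat \<Rightarrow> bstate \<Rightarrow> bstate set) \<Rightarrow> nat list \<Rightarrow> bstate \<Rightarrow> bstate set" where
  "seq_steps f ks st = foldl (\<lambda>S k. Set.bind S (f k)) {st} ks"

definition butterfly_iter :: "pattern list \<Rightarrow> nat \<Rightarrow> nat \<Rightarrow> bstate \<Rightarrow> bstate set" where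
  "butterfly_iter \<beta> J s st =
    (\<Union>j \<in> {j. 1 \<le> j \<and> j \<le> length st \<and> fst (fst (st ! (j-1))) \<le> s \<and> s \<le> snd (fst (st ! (j-1)))}.
      Set.bind (seq_steps (ortho_step \<beta> Column) [1..<j] st) (\<lambda>st1.
      Set.bind (seq_steps (\<lambda>k. ortho_step \<beta> Row (k - 1)) (rev [j+1..<J+1]) st1) (\<lambda>st2.
        (let ((q,t), Xj) = st2 ! (j-1) in
          {take (j-1) st2 @ [((q,s), fst XY), ((s+1,t), snd XY)] @ drop j st2 | XY.
             XY \<in> two_factor Xj (pint \<beta> q s) (pint \<beta> (s+1) t)}))))"

text \<open>All possible outputs of the butterfly algorithm on \<open>(A,\<beta>,\<sigma>)\<close>, with \<open>\<sigma>\<close>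
  given as the list \<open>[\<sigma>_1,\<dots>,\<sigma>_{L-1}]\<close>.\<close>
definition butterfly :: "complex mat \<Rightarrow> pattern list \<Rightarrow> nat list \<Rightarrow> complex mat list set" where
  "butterfly A \<beta> \<sigma> =
     (\<lambda>st. map snd st) `
       foldl (\<lambda>S J. Set.bind S (butterfly_iter \<beta> J (\<sigma> ! (J-1))))
         {[((1, length \<beta>), A)]} [1..<length \<beta>]"

definition mat_list_prod :: "complex mat list \<Rightarrow> complex mat" where
  "mat_list_prod Xs = foldl (*) (hd Xs) (tl Xs)"

end

theory Submission
  imports Defs "HOL-Analysis.Function_Topology" "Jordan_Normal_Form.Determinant"
begin

text \<open>
  Consider the order \<open>(1,\<dots>,L-1)\<close>. Before the \<open>(J+1)\<close>-st split the current product is \<open>W M\<close>, where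
  \<open>W = X\<^sub>1 \<cdots> X\<^sub>J\<close> has been orthonormalised. The supports of the factors are nested so that
  \<open>W\<^sup>*W\<close> acts as the identity on every matrix with the support of \<open>M\<close>; hence \<open>Z \<mapsto> W Z\<close> is
  an isometry on these matrices. The residual \<open>A - W M\<close> is orthogonal to all \<open>W Z\<close>, because the
  previous split was optimal (optimality, unlike orthogonality, survives a rank-deficient QR step).
  By Pythagoras, replacing \<open>M\<close> by its best factorisation \<open>H K\<close> adds exactly \<open>\<parallel>M - H K\<parallel>\<^sup>2\<close> to the
  squared error. Compressing any competitor \<open>X Y\<close> for \<open>E\<^sub>J\<^sub>+\<^sub>1(A)\<close> by \<open>W\<^sup>*\<close> gives a competitor for
  the factorisation of \<open>M\<close> that is at least as good, so this increment is at most the square of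
  \<open>E\<^sub>J\<^sub>+\<^sub>1(A)\<close>. Non-redundancy makes all the QR decompositions exist.
\<close>

text \<open>Only part of the Gram matrix of \<open>W\<close> is under control: columns with
  different labels \<open>U\<close> may have overlapping supports and need not be orthogonal. So
  applying \<open>cadj W * W\<close> to \<open>Z\<close> is known to return \<open>Z\<close> only at
  positions with matching labels, and all estimates test against matrices supported there. The left
  factor of a split is an arbitrary minimiser, possibly of deficient rank. QR then adds columns
  outside its range, so orthogonality of the residual to the old range would say too little.
  Optimality over all pairs of factors says more: the new \<open>Q\<close> is itself an admissible
  left factor, which gives orthogonality to everything built on \<open>Q\<close>. The earlier
  factors were already orthonormal, so repeating QR on them produces only unitary transfer matrices,
  and these carry the old optimality to the new prefix. The set of outputs must also be shown
  nonempty. A class of the partition has \<open>r\<close> indices, and \<open>r < min b c\<close>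
  leaves room for \<open>r\<close> orthonormal columns in its block, or in the transposed block.
  Best approximations exist by the same inequality, through QR and compactness.\<close>

section \<open>The Frobenius inner product\<close>

definition ip :: "complex mat \<Rightarrow> complex mat \<Rightarrow> complex" where
  "ip A B = (\<Sum>i<dim_row A. \<Sum>j<dim_col A. cnj (A $$ (i,j)) * B $$ (i,j))"

lemma frob_sq: "(frob A)\<^sup>2 = (\<Sum>i<dim_row A. \<Sum>j<dim_col A. (cmod (A $$ (i,j)))\<^sup>2)"
  unfolding frob_def by (intro real_sqrt_pow2 sum_nonneg) auto

lemma frob_nonneg [simp]: "0 \<le> frob A"
  unfolding frob_def by (intro real_sqrt_ge_zero sum_nonneg) auto

lemma frob_transpose: "frob (transpose_mat A) = frob A"
proof -
  have "(\<Sum>i<dim_col A. \<Sum>j<dim_row A. (cmod (transpose_mat A $$ (i,j)))\<^sup>2)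
      = (\<Sum>i<dim_col A. \<Sum>j<dim_row A. (cmod (A $$ (j,i)))\<^sup>2)"
    by (intro sum.cong) auto
  also have "\<dots> = (\<Sum>j<dim_row A. \<Sum>i<dim_col A. (cmod (A $$ (j,i)))\<^sup>2)"
    by (rule sum.swap)
  finally show ?thesis by (simp add: frob_def)
qed

lemma frob_le_iff: "frob A \<le> frob B \<longleftrightarrow> (frob A)\<^sup>2 \<le> (frob B)\<^sup>2"
  by (metis frob_nonneg power2_le_imp_le power_mono)

lemma ip_self: "ip A A = of_real ((frob A)\<^sup>2)"
  unfolding ip_def frob_sq of_real_sum
  by (intro sum.cong refl) (simp add: complex_norm_square mult.commute del: of_real_power)

lemma ip_add_right:
  assumes "A \<in> carrier_mat m n" "B \<in> carrier_mat m n" "C \<in> carrier_mat m n"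
  shows "ip A (B + C) = ip A B + ip A C"
proof -
  have "ip A (B + C) = (\<Sum>i<m. \<Sum>j<n. cnj (A $$ (i,j)) * B $$ (i,j) + cnj (A $$ (i,j)) * C $$ (i,j))"
    unfolding ip_def using assms by (intro sum.cong) (auto simp: algebra_simps)
  then show ?thesis using assms by (simp add: ip_def sum.distrib)
qed

lemma ip_diff_right:
  assumes "A \<in> carrier_mat m n" "B \<in> carrier_mat m n" "C \<in> carrier_mat m n"
  shows "ip A (B - C) = ip A B - ip A C"
proof -
  have "ip A (B - C) = (\<Sum>i<m. \<Sum>j<n. cnj (A $$ (i,j)) * B $$ (i,j) - cnj (A $$ (i,j)) * C $$ (i,j))"
    unfolding ip_def using assms by (intro sum.cong) (auto simp: algebra_simps)
  then show ?thesis using assms by (simp add: ip_def sum_subtractf)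
qed

lemma ip_cnj:
  assumes "A \<in> carrier_mat m n" "B \<in> carrier_mat m n"
  shows "ip A B = cnj (ip B A)"
  using assms unfolding ip_def by (auto simp: mult.commute)

lemma ip_smult_right:
  assumes "A \<in> carrier_mat m n" "B \<in> carrier_mat m n"
  shows "ip A (c \<cdot>\<^sub>m B) = c * ip A B"
  using assms unfolding ip_def by (auto simp: sum_distrib_left algebra_simps intro!: sum.cong)

lemma cmod_add_sq: "(cmod (x + y))\<^sup>2 = (cmod x)\<^sup>2 + (cmod y)\<^sup>2 + 2 * Re (cnj x * y)"
  unfolding cmod_power2 by (simp add: power2_eq_square algebra_simps)

lemma frob_add_sq:
  assumes A: "A \<in> carrier_mat m n" and B: "B \<in> carrier_mat m n"
  shows "(frob (A + B))\<^sup>2 = (frob A)\<^sup>2 + (frob B)\<^sup>2 + 2 * Re (ip A B)"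
proof -
  have "(frob (A + B))\<^sup>2 = (\<Sum>i<m. \<Sum>j<n. (cmod (A $$ (i,j)))\<^sup>2 + (cmod (B $$ (i,j)))\<^sup>2
      + 2 * Re (cnj (A $$ (i,j)) * B $$ (i,j)))"
    unfolding frob_sq using A B
    by (intro sum.cong) (auto simp: cmod_add_sq)
  also have "\<dots> = (frob A)\<^sup>2 + (frob B)\<^sup>2 + 2 * Re (ip A B)"
    unfolding frob_sq ip_def using A B by (simp add: sum.distrib Re_sum sum_distrib_left)
  finally show ?thesis .
qed

lemma frob_smult_sq: "(frob (c \<cdot>\<^sub>m A))\<^sup>2 = (cmod c)\<^sup>2 * (frob A)\<^sup>2"
  unfolding frob_sq by (simp add: sum_distrib_left norm_mult power_mult_distrib)

text \<open>First-order condition: for a short step \<open>- t * cnj z\<close> along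
  \<open>B\<close> the linear decrease beats the quadratic increase unless \<open>z = ip R B\<close>
  vanishes. The complex direction makes the whole inner product vanish and not only its real
  part.\<close>

lemma ip_eq_0_if_minimal:
  assumes R: "R \<in> carrier_mat m n" and B: "B \<in> carrier_mat m n"
    and min: "\<And>c. frob R \<le> frob (R + c \<cdot>\<^sub>m B)"
  shows "ip R B = 0"
proof -
  define z where "z = ip R B"
  define b where "b = (frob B)\<^sup>2"
  \<comment> \<open>The added 1 keeps \<open>t\<close> positive when \<open>B = 0\<close> and
    ensures \<open>t * b < 2\<close>.\<close>
  define t where "t = 1 / (b + 1)"
  have b: "b \<ge> 0" by (simp add: b_def)
  have "(frob R)\<^sup>2 \<le> (frob (R + (- of_real t * cnj z) \<cdot>\<^sub>m B))\<^sup>2"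
    using min frob_le_iff by blast
  also have "\<dots> = (frob R)\<^sup>2 + (cmod (- of_real t * cnj z))\<^sup>2 * b + 2 * Re ((- of_real t * cnj z) * z)"
    using R B by (simp add: frob_add_sq[OF R] frob_smult_sq ip_smult_right[OF R] b_def z_def)
  also have "(cmod (- of_real t * cnj z))\<^sup>2 = t\<^sup>2 * (cmod z)\<^sup>2"
    by (simp add: norm_mult power_mult_distrib)
  also have "Re ((- of_real t * cnj z) * z) = - t * (cmod z)\<^sup>2"
    unfolding cmod_power2 by (simp add: power2_eq_square algebra_simps)
  finally have "0 \<le> (cmod z)\<^sup>2 * (t * (t * b - 2))"
    by (simp add: power2_eq_square algebra_simps)
  moreover have "t * (t * b - 2) < 0"
  proof -
    have "t > 0" "t * b < 2" using b by (auto simp: t_def field_simps)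
    then show ?thesis by (simp add: mult_pos_neg)
  qed
  ultimately have "(cmod z)\<^sup>2 \<le> 0" by (smt (verit, best) mult_pos_neg)
  then show ?thesis by (simp add: z_def)
qed

section \<open>Adjoints and entrywise matrix products\<close>

lemma cadj_carrier [simp]: "A \<in> carrier_mat m n \<Longrightarrow> cadj A \<in> carrier_mat n m"
  by (auto simp: cadj_def)

lemma cadj_dim [simp]: "dim_row (cadj A) = dim_col A" "dim_col (cadj A) = dim_row A"
  by (auto simp: cadj_def)

lemma cadj_index [simp]:
  "i < dim_col A \<Longrightarrow> j < dim_row A \<Longrightarrow> cadj A $$ (i,j) = cnj (A $$ (j,i))"
  by (simp add: cadj_def)

lemma mult_mat_index:
  assumes "A \<in> carrier_mat m k" "B \<in> carrier_mat k n" "i < m" "j < n"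
  shows "(A * B) $$ (i,j) = (\<Sum>x<k. A $$ (i,x) * B $$ (x,j))"
  using assms by (auto simp: scalar_prod_def atLeast0LessThan intro!: sum.cong)

lemma mat_diff_split:
  fixes A :: "complex mat"
  assumes "A \<in> carrier_mat m n" "B \<in> carrier_mat m n" "C \<in> carrier_mat m n"
  shows "A - C = (A - B) + (B - C)"
  using assms by (intro eq_matI) auto

lemma cadj_mult:
  assumes A: "A \<in> carrier_mat m k" and B: "B \<in> carrier_mat k n"
  shows "cadj (A * B) = cadj B * cadj A"
proof (rule eq_matI)
  fix i j assume ij: "i < dim_row (cadj B * cadj A)" "j < dim_col (cadj B * cadj A)"
  then have i: "i < n" and j: "j < m" using A B by auto
  have "cadj (A * B) $$ (i,j) = cnj ((A * B) $$ (j,i))" using i j A B by simp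
  also have "\<dots> = (\<Sum>x<k. cadj B $$ (i,x) * cadj A $$ (x,j))"
    using i j A B by (auto simp: mult_mat_index[OF A B] mult.commute simp del: index_mult_mat(1) intro!: sum.cong)
  also have "\<dots> = (cadj B * cadj A) $$ (i,j)"
    by (rule mult_mat_index[symmetric, OF cadj_carrier[OF B] cadj_carrier[OF A] i j])
  finally show "cadj (A * B) $$ (i,j) = (cadj B * cadj A) $$ (i,j)" .
qed (use A B in auto)

lemma ip_mult_left:
  assumes W: "W \<in> carrier_mat m k" and Z: "Z \<in> carrier_mat k n" and B: "B \<in> carrier_mat m n"
  shows "ip (W * Z) B = ip Z (cadj W * B)"
proof -
  have "ip (W * Z) B = (\<Sum>i<m. \<Sum>j<n. \<Sum>x<k. cnj (Z $$ (x,j)) * (cnj (W $$ (i,x)) * B $$ (i,j)))"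
    unfolding ip_def using W Z B
    by (auto simp: mult_mat_index[OF W Z] sum_distrib_right sum_distrib_left algebra_simps simp del: index_mult_mat(1) intro!: sum.cong)
  also have "\<dots> = (\<Sum>j<n. \<Sum>i<m. \<Sum>x<k. cnj (Z $$ (x,j)) * (cnj (W $$ (i,x)) * B $$ (i,j)))"
    by (rule sum.swap)
  also have "\<dots> = (\<Sum>j<n. \<Sum>x<k. \<Sum>i<m. cnj (Z $$ (x,j)) * (cnj (W $$ (i,x)) * B $$ (i,j)))"
    by (intro sum.cong refl sum.swap)
  also have "\<dots> = (\<Sum>x<k. \<Sum>j<n. \<Sum>i<m. cnj (Z $$ (x,j)) * (cnj (W $$ (i,x)) * B $$ (i,j)))"
    by (rule sum.swap)
  also have "\<dots> = ip Z (cadj W * B)"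
    unfolding ip_def using W Z B
    by (auto simp: mult_mat_index[OF cadj_carrier[OF W] B] sum_distrib_left simp del: index_mult_mat(1) intro!: sum.cong)
  finally show ?thesis .
qed

section \<open>Factors with nested supports\<close>

text \<open>Level \<open>l\<close> indexes the columns of the \<open>l\<close>-th factor (and level \<open>0\<close> the rows of the first one).
  A factor spanning the levels \<open>s \<le> t\<close> is supported on the pairs of indices with equal
  labels \<open>U s\<close> and \<open>V t\<close>; for butterfly architectures these labels are the
  quotient of the index by \<open>n l div a\<^bsub>s+1\<^esub>\<close> and its remainder modulo \<open>d\<^sub>t\<close>.\<close>

locale cuts =
  fixes L :: nat and n :: "nat \<Rightarrow> nat" and U :: "nat \<Rightarrow> nat \<Rightarrow> nat \<Rightarrow> nat" and V :: "nat \<Rightarrow> nat \<Rightarrow> nat \<Rightarrow> nat"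
  assumes U_mono: "\<lbrakk>s \<le> t; t \<le> l; t \<le> l'; l \<le> L; l' \<le> L; i < n l; j < n l'; U t l i = U t l' j\<rbrakk>
      \<Longrightarrow> U s l i = U s l' j"
    and V_mono: "\<lbrakk>t \<le> u; u \<le> L; l \<le> t; l' \<le> t; i < n l; j < n l'; V t l i = V t l' j\<rbrakk>
      \<Longrightarrow> V u l i = V u l' j"
begin

text \<open>For an architecture and \<open>s < t\<close> these are exactly the factors of the
  product pattern between the two levels (\<open>Sigma_pint\<close>). The case \<open>s = t\<close>
  gives the matrices that are block diagonal over classes of equal labels; the transfer matrices of
  QR steps live there.\<close>

definition Sg :: "nat \<Rightarrow> nat \<Rightarrow> complex mat set" where
  "Sg s t = {X \<in> carrier_mat (n s) (n t).
     \<forall>i<n s. \<forall>j<n t. X $$ (i,j) \<noteq> 0 \<longrightarrow> U s s i = U s t j \<and> V t s i = V t t j}"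

text \<open>Restricted to pairs inside one \<open>U\<close> class: a column of any \<open>Z\<close>
  in \<open>Sg s t\<close> is supported on a single such class, so these are the only Gram entries
  that matter when \<open>W\<close> acts on factors to its right.\<close>

definition colorth :: "nat \<Rightarrow> complex mat \<Rightarrow> bool" where
  "colorth s W \<longleftrightarrow> (\<forall>i<n s. \<forall>j<n s. U s s i = U s s j \<longrightarrow>
     (cadj W * W) $$ (i,j) = (if i = j then 1 else 0))"

lemma Sg_carrier [dest]: "X \<in> Sg s t \<Longrightarrow> X \<in> carrier_mat (n s) (n t)"
  by (simp add: Sg_def)

lemma SgD:
  assumes "X \<in> Sg s t" "i < n s" "j < n t" "X $$ (i,j) \<noteq> 0"
  shows "U s s i = U s t j" "V t s i = V t t j"
  using assms by (auto simp: Sg_def)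

lemma SgI:
  assumes "X \<in> carrier_mat (n s) (n t)"
    and "\<And>i j. i < n s \<Longrightarrow> j < n t \<Longrightarrow> X $$ (i,j) \<noteq> 0 \<Longrightarrow> U s s i = U s t j \<and> V t s i = V t t j"
  shows "X \<in> Sg s t"
  using assms by (auto simp: Sg_def)

text \<open>\<open>U s\<close> is a coarsening of \<open>U t\<close>, and \<open>V u\<close> of
  \<open>V t\<close>. So \<open>U s\<close> is carried across \<open>Y\<close> and
  \<open>V u\<close> across \<open>X\<close> through any inner index that contributes to the
  entry.\<close>

lemma Sg_mult:
  assumes X: "X \<in> Sg s t" and Y: "Y \<in> Sg t u" and le: "s \<le> t" "t \<le> u" "u \<le> L"
  shows "X * Y \<in> Sg s u"
proof (rule SgI)
  show "X * Y \<in> carrier_mat (n s) (n u)" using X Y by (meson Sg_carrier mult_carrier_mat)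
  fix i j assume i: "i < n s" and j: "j < n u" and nz: "(X * Y) $$ (i,j) \<noteq> 0"
  have "(\<Sum>k<n t. X $$ (i,k) * Y $$ (k,j)) \<noteq> 0"
    using nz mult_mat_index[OF Sg_carrier[OF X] Sg_carrier[OF Y] i j] by simp
  then obtain k where k: "k < n t" "X $$ (i,k) * Y $$ (k,j) \<noteq> 0"
    by (meson lessThan_iff sum.not_neutral_contains_not_neutral)
  then have "X $$ (i,k) \<noteq> 0" "Y $$ (k,j) \<noteq> 0" by auto
  then have a: "U s s i = U s t k" "V t s i = V t t k" "U t t k = U t u j" "V u t k = V u u j"
    using SgD[OF X i k(1)] SgD[OF Y k(1) j] by auto
  have "U s t k = U s u j" using U_mono[of s t t u k j] a le k j by auto
  moreover have "V u s i = V u t k" using V_mono[of t u s t i k] a le i k by auto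
  ultimately show "U s s i = U s u j \<and> V u s i = V u u j" using a by simp
qed

lemma Sg_diff:
  assumes X: "X \<in> Sg s t" and Y: "Y \<in> Sg s t"
  shows "X - Y \<in> Sg s t"
proof (rule SgI)
  show "X - Y \<in> carrier_mat (n s) (n t)" using Y by (intro minus_carrier_mat) auto
  fix i j assume "i < n s" "j < n t" "(X - Y) $$ (i,j) \<noteq> 0"
  then show "U s s i = U s t j \<and> V t s i = V t t j"
    using SgD[OF X, of i j] SgD[OF Y, of i j] Sg_carrier[OF X] Sg_carrier[OF Y]
    by (cases "X $$ (i,j) = 0") auto
qed

lemma Sg_add:
  assumes X: "X \<in> Sg s t" and Y: "Y \<in> Sg s t"
  shows "X + Y \<in> Sg s t"
proof (rule SgI)
  show "X + Y \<in> carrier_mat (n s) (n t)" using Sg_carrier[OF X] Sg_carrier[OF Y] by simp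
  fix i j assume "i < n s" "j < n t" "(X + Y) $$ (i,j) \<noteq> 0"
  then show "U s s i = U s t j \<and> V t s i = V t t j"
    using SgD[OF X, of i j] SgD[OF Y, of i j] Sg_carrier[OF X] Sg_carrier[OF Y]
    by (cases "X $$ (i,j) = 0") auto
qed

lemma Sg_smult: "X \<in> Sg s t \<Longrightarrow> c \<cdot>\<^sub>m X \<in> Sg s t"
  by (intro SgI smult_carrier_mat) (auto simp: Sg_def)

lemma one_Sg: "1\<^sub>m (n s) \<in> Sg s s"
  by (intro SgI) (auto split: if_splits)

lemma cadj_Sg: "D \<in> Sg s s \<Longrightarrow> cadj D \<in> Sg s s"
  by (intro SgI cadj_carrier) (auto simp: Sg_def)

text \<open>Allows \<open>B\<close> and \<open>C\<close> to differ off the support, as do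
  \<open>cadj W * (W * Z)\<close> and \<open>Z\<close>.\<close>

lemma ip_Sg_cong:
  assumes Z: "Z \<in> Sg s t"
    and eq: "\<And>i j. \<lbrakk>i < n s; j < n t; U s s i = U s t j; V t s i = V t t j\<rbrakk> \<Longrightarrow> B $$ (i,j) = C $$ (i,j)"
  shows "ip Z B = ip Z C"
proof -
  have d: "dim_row Z = n s" "dim_col Z = n t" using Z by auto
  show ?thesis unfolding ip_def d
  proof (intro sum.cong refl)
    fix i j assume "i \<in> {..<n s}" "j \<in> {..<n t}"
    then show "cnj (Z $$ (i,j)) * B $$ (i,j) = cnj (Z $$ (i,j)) * C $$ (i,j)"
      using SgD[OF Z, of i j] eq[of i j] by (cases "Z $$ (i,j) = 0") auto
  qed
qed

lemma colorth_one: "colorth s (1\<^sub>m (n s))"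
proof -
  have "cadj (1\<^sub>m (n s)) = 1\<^sub>m (n s)" by (intro eq_matI) auto
  then show ?thesis by (simp add: colorth_def)
qed

text \<open>A nonzero \<open>Z $$ (x,j)\<close> puts \<open>x\<close> into the \<open>U\<close>
  class of \<open>i\<close>, where the Gram matrix of \<open>W\<close> is the identity.\<close>

lemma colorth_gram_mult:
  assumes W: "W \<in> carrier_mat m (n s)" "colorth s W" and Z: "Z \<in> Sg s t"
    and i: "i < n s" and j: "j < n t" and ij: "U s s i = U s t j"
  shows "(cadj W * (W * Z)) $$ (i,j) = Z $$ (i,j)"
proof -
  have Zc: "Z \<in> carrier_mat (n s) (n t)" using Z by auto
  have G: "cadj W * W \<in> carrier_mat (n s) (n s)" using W by auto
  have "cadj W * (W * Z) = (cadj W * W) * Z"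
    using W Zc by (intro assoc_mult_mat[symmetric]) auto
  then have "(cadj W * (W * Z)) $$ (i,j) = (\<Sum>x<n s. (cadj W * W) $$ (i,x) * Z $$ (x,j))"
    using mult_mat_index[OF G Zc i j] by simp
  also have "\<dots> = (\<Sum>x<n s. if x = i then Z $$ (x,j) else 0)"
  proof (intro sum.cong refl)
    fix x assume "x \<in> {..<n s}"
    then show "(cadj W * W) $$ (i,x) * Z $$ (x,j) = (if x = i then Z $$ (x,j) else 0)"
      using W(2) i ij SgD[OF Z, of x j] j unfolding colorth_def
      by (cases "Z $$ (x,j) = 0") (auto simp del: index_mult_mat(1))
  qed
  also have "\<dots> = Z $$ (i,j)" using i by simp
  finally show ?thesis .
qed

lemma ip_colorth_mult:
  assumes W: "W \<in> carrier_mat m (n s)" "colorth s W" and Z: "Z \<in> Sg s t" and Z': "Z' \<in> Sg s t"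
  shows "ip (W * Z) (W * Z') = ip Z Z'"
proof -
  have "ip (W * Z) (W * Z') = ip Z (cadj W * (W * Z'))"
    using W Z Z' by (intro ip_mult_left[of W m "n s" Z "n t"]) auto
  also have "\<dots> = ip Z Z'"
    by (rule ip_Sg_cong[OF Z]) (rule colorth_gram_mult[OF W Z'])
  finally show ?thesis .
qed

lemma frob_colorth_mult:
  assumes "W \<in> carrier_mat m (n s)" "colorth s W" "Z \<in> Sg s t"
  shows "(frob (W * Z))\<^sup>2 = (frob Z)\<^sup>2"
  using ip_colorth_mult[OF assms assms(3)] by (simp add: ip_self flip: of_real_power)

text \<open>Columns with different labels \<open>V\<close> have disjoint supports.\<close>
lemma colorth_if_orthonormal_on_classes:
  assumes X: "X \<in> Sg r s"
    and orth: "\<And>i j. \<lbrakk>i < n s; j < n s; U s s i = U s s j; V s s i = V s s j\<rbrakk>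
      \<Longrightarrow> (cadj X * X) $$ (i,j) = (if i = j then 1 else 0)"
  shows "colorth s X"
  unfolding colorth_def
proof (intro allI impI)
  fix i j assume i: "i < n s" and j: "j < n s" and U: "U s s i = U s s j"
  have Xc: "X \<in> carrier_mat (n r) (n s)" using X by auto
  show "(cadj X * X) $$ (i,j) = (if i = j then 1 else 0)"
  proof (cases "V s s i = V s s j")
    case True
    then show ?thesis using orth i j U by blast
  next
    case False
    have "(cadj X * X) $$ (i,j) = (\<Sum>x<n r. cadj X $$ (i,x) * X $$ (x,j))"
      by (rule mult_mat_index[OF cadj_carrier[OF Xc] Xc i j])
    also have "\<dots> = 0"
    proof (intro sum.neutral ballI)
      fix x assume "x \<in> {..<n r}"
      then show "cadj X $$ (i,x) * X $$ (x,j) = 0"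
        using SgD(2)[OF X, of x i] SgD(2)[OF X, of x j] False i j Xc
        by (cases "X $$ (x,i) = 0") auto
    qed
    finally show ?thesis using False by auto
  qed
qed

text \<open>Columns \<open>i\<close> and \<open>j\<close> of \<open>X\<close> with equal
  \<open>U t\<close> label also have equal \<open>U s\<close> label, so both are supported on one
  \<open>U s\<close> class and \<open>W\<close> preserves their inner product. This propagates
  orthonormality along a product of factors.\<close>

lemma gram_colorth_mult:
  assumes W: "W \<in> carrier_mat m (n s)" "colorth s W" and X: "X \<in> Sg s t"
    and le: "s \<le> t" "t \<le> L" and i: "i < n t" and j: "j < n t" and U: "U t t i = U t t j"
  shows "(cadj (W * X) * (W * X)) $$ (i,j) = (cadj X * X) $$ (i,j)"
proof -
  have Xc: "X \<in> carrier_mat (n s) (n t)" using X by auto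
  have C: "cadj W * (W * X) \<in> carrier_mat (n s) (n t)" using W Xc by auto
  have Ust: "U s t i = U s t j" using U_mono[of s t t t i j] U le i j by auto
  have "cadj (W * X) * (W * X) = cadj X * (cadj W * (W * X))"
    unfolding cadj_mult[OF W(1) Xc] using W Xc by (intro assoc_mult_mat) auto
  then have "(cadj (W * X) * (W * X)) $$ (i,j)
      = (\<Sum>x<n s. cadj X $$ (i,x) * (cadj W * (W * X)) $$ (x,j))"
    using mult_mat_index[OF cadj_carrier[OF Xc] C i j] by simp
  also have "\<dots> = (\<Sum>x<n s. cadj X $$ (i,x) * X $$ (x,j))"
  proof (intro sum.cong refl)
    fix x assume x: "x \<in> {..<n s}"
    show "cadj X $$ (i,x) * (cadj W * (W * X)) $$ (x,j) = cadj X $$ (i,x) * X $$ (x,j)"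
    proof (cases "X $$ (x,i) = 0")
      case True
      then show ?thesis using x i Xc by simp
    next
      case False
      then have "U s s x = U s t j" using SgD(1)[OF X, of x i] x i Ust by simp
      then show ?thesis using colorth_gram_mult[OF W X, of x j] x j by simp
    qed
  qed
  also have "\<dots> = (cadj X * X) $$ (i,j)"
    by (rule mult_mat_index[OF cadj_carrier[OF Xc] Xc i j, symmetric])
  finally show ?thesis .
qed

lemma colorth_mult:
  assumes "W \<in> carrier_mat m (n s)" "colorth s W" "X \<in> Sg s t" "colorth t X" "s \<le> t" "t \<le> L"
  shows "colorth t (W * X)"
  using assms(4) gram_colorth_mult[OF assms(1-3,5,6)] unfolding colorth_def by simp

lemma frob_colorth_split:
  assumes W: "W \<in> carrier_mat (n 0) (n J)" "colorth J W" and A: "A \<in> carrier_mat (n 0) (n L)"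
    and M: "M \<in> Sg J L" and N: "N \<in> Sg J L"
    and orth: "\<And>Z. Z \<in> Sg J L \<Longrightarrow> ip (A - W * M) (W * Z) = 0"
  shows "(frob (A - W * N))\<^sup>2 = (frob (A - W * M))\<^sup>2 + (frob (M - N))\<^sup>2"
proof -
  have D: "M - N \<in> Sg J L" using M N by (rule Sg_diff)
  have c: "W * M \<in> carrier_mat (n 0) (n L)" "W * N \<in> carrier_mat (n 0) (n L)"
    "W * (M - N) \<in> carrier_mat (n 0) (n L)"
    using W M N D by (meson Sg_carrier mult_carrier_mat)+
  have "W * (M - N) = W * M - W * N"
    using W(1) M N by (meson Sg_carrier mult_minus_distrib_mat)
  then have "A - W * N = (A - W * M) + W * (M - N)"
    using mat_diff_split[OF A c(1,2)] by simp
  moreover have "(frob ((A - W * M) + W * (M - N)))\<^sup>2 = (frob (A - W * M))\<^sup>2 + (frob (W * (M - N)))\<^sup>2"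
    using frob_add_sq[OF minus_carrier_mat[OF c(1)] c(3)] orth[OF D] by simp
  ultimately show ?thesis using frob_colorth_mult[OF W D] by simp
qed

text \<open>The witness is the restriction of \<open>W\<^sup>*X\<close> to the support of a factor: a residual in
  \<open>Sg J L\<close> only sees that part of \<open>W\<^sup>*XY\<close>.\<close>
lemma compressed_approximation:
  assumes W: "W \<in> Sg 0 J" "colorth J W" and A: "A \<in> carrier_mat (n 0) (n L)"
    and M: "M \<in> Sg J L" and le: "J \<le> k" "k \<le> L"
    and orth: "\<And>Z. Z \<in> Sg J L \<Longrightarrow> ip (A - W * M) (W * Z) = 0"
    and X: "X \<in> Sg 0 k" and Y: "Y \<in> Sg k L"
  obtains H where "H \<in> Sg J k" "frob (M - H * Y) \<le> frob (A - X * Y)"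
proof -
  have Wc: "W \<in> carrier_mat (n 0) (n J)" using W by auto
  have Xc: "X \<in> carrier_mat (n 0) (n k)" using X by auto
  have Yc: "Y \<in> carrier_mat (n k) (n L)" using Y by auto
  have Mc: "M \<in> carrier_mat (n J) (n L)" using M by auto
  define G where "G = cadj W * X"
  define H where "H = mat (n J) (n k) (\<lambda>(i,j). if U J J i = U J k j \<and> V k J i = V k k j then G $$ (i,j) else 0)"
  have Gc: "G \<in> carrier_mat (n J) (n k)" using Wc Xc by (auto simp: G_def)
  have H: "H \<in> Sg J k" by (rule SgI) (auto simp: H_def split: if_splits)
  have Hc: "H \<in> carrier_mat (n J) (n k)" using H by auto
  \<comment> \<open>\<open>G\<close> satisfies the \<open>V\<close> condition by itself, because
    \<open>W\<close> fixes the finer label \<open>V J\<close> and \<open>X\<close> the coarser label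
    \<open>V k\<close>. The mask in \<open>H\<close> thus removes only entries that violate the
    \<open>U\<close> condition.\<close>
  have GV: "V k J i = V k k j" if "G $$ (i,j) \<noteq> 0" "i < n J" "j < n k" for i j
  proof -
    have "(\<Sum>x<n 0. cadj W $$ (i,x) * X $$ (x,j)) \<noteq> 0"
      using that mult_mat_index[OF cadj_carrier[OF Wc] Xc that(2,3)] by (simp add: G_def)
    then obtain x where x: "x < n 0" "cadj W $$ (i,x) * X $$ (x,j) \<noteq> 0"
      by (meson lessThan_iff sum.not_neutral_contains_not_neutral)
    then have "V J 0 x = V J J i" "V k 0 x = V k k j"
      using SgD(2)[OF W(1) x(1) that(2)] SgD(2)[OF X x(1) that(3)] Wc that by auto
    then show ?thesis using V_mono[of J k 0 J x i] le x that by auto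
  qed
  have mask: "(G * Y) $$ (i,q) = (H * Y) $$ (i,q)"
    if i: "i < n J" and q: "q < n L" and UV: "U J J i = U J L q" for i q
  proof -
    have "(\<Sum>x<n k. G $$ (i,x) * Y $$ (x,q)) = (\<Sum>x<n k. H $$ (i,x) * Y $$ (x,q))"
    proof (intro sum.cong refl)
      fix x assume x: "x \<in> {..<n k}"
      show "G $$ (i,x) * Y $$ (x,q) = H $$ (i,x) * Y $$ (x,q)"
      proof (cases "Y $$ (x,q) = 0 \<or> G $$ (i,x) = 0")
        case True
        then show ?thesis using i x by (auto simp: H_def)
      next
        case False
        then have "U k k x = U k L q" using SgD(1)[OF Y, of x q] x q by auto
        then have "U J k x = U J L q" using U_mono[of J k k L x q] le x q by auto
        moreover have "V k J i = V k k x" using False GV i x by auto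
        ultimately show ?thesis using UV i x by (simp add: H_def)
      qed
    qed
    then show ?thesis
      using mult_mat_index[OF Gc Yc i q] mult_mat_index[OF Hc Yc i q] by simp
  qed
  define N where "N = M - H * Y"
  have HY: "H * Y \<in> Sg J L" using Sg_mult[OF H Y] le by auto
  have N: "N \<in> Sg J L" unfolding N_def using M HY by (rule Sg_diff)
  define T where "T = A - X * Y"
  have XYc: "X * Y \<in> carrier_mat (n 0) (n L)" using Xc Yc by auto
  have Nc: "N \<in> carrier_mat (n J) (n L)" using N by auto
  have WNc: "W * N \<in> carrier_mat (n 0) (n L)" and WMc: "W * M \<in> carrier_mat (n 0) (n L)"
    using Wc Nc Mc by auto
  have Tc: "T \<in> carrier_mat (n 0) (n L)" unfolding T_def by (rule minus_carrier_mat[OF XYc])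
  have "ip (W * N) (X * Y) = ip N (cadj W * (X * Y))"
    by (rule ip_mult_left[OF Wc Nc XYc])
  also have "cadj W * (X * Y) = G * Y"
    unfolding G_def by (rule assoc_mult_mat[OF cadj_carrier[OF Wc] Xc Yc, symmetric])
  also have "ip N (G * Y) = ip N (H * Y)" by (rule ip_Sg_cong[OF N]) (rule mask)
  finally have 1: "ip (W * N) (X * Y) = ip N (H * Y)" .
  have 2: "ip (W * N) (A - W * M) = 0"
    using orth[OF N] ip_cnj[OF WNc minus_carrier_mat[OF WMc]] by simp
  have "T = (A - W * M) + (W * M - X * Y)"
    unfolding T_def by (rule mat_diff_split[OF A WMc XYc])
  then have "ip (W * N) T = ip (W * N) (A - W * M) + ip (W * N) (W * M - X * Y)"
    using ip_add_right[OF WNc minus_carrier_mat[OF WMc] minus_carrier_mat[OF XYc]] by simp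
  also have "ip (W * N) (W * M - X * Y) = ip (W * N) (W * M) - ip (W * N) (X * Y)"
    by (rule ip_diff_right[OF WNc WMc XYc])
  also have "\<dots> = ip N M - ip N (H * Y)"
    using ip_colorth_mult[OF Wc W(2) N M] 1 by simp
  also have "\<dots> = ip N N"
    using ip_diff_right[OF Nc Mc Sg_carrier[OF HY]] by (simp add: N_def)
  finally have 3: "ip (W * N) T = of_real ((frob N)\<^sup>2)"
    using 2 by (simp add: ip_self)
  \<comment> \<open>A form of Cauchy-Schwarz without division: the inner product of
    \<open>W * N\<close> with \<open>T\<close> and the square of the norm of \<open>W * N\<close>
    both equal the square of the norm of \<open>N\<close>, so expanding the norm of the difference
    bounds \<open>N\<close> by \<open>T\<close>.\<close>
  have "0 \<le> (frob (W * N + (-1) \<cdot>\<^sub>m T))\<^sup>2" by simp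
  also have "\<dots> = (frob (W * N))\<^sup>2 + (frob T)\<^sup>2 - 2 * (frob N)\<^sup>2"
    using frob_add_sq[OF WNc, of "(-1) \<cdot>\<^sub>m T"] Tc frob_smult_sq[of "-1" T]
      ip_smult_right[OF WNc Tc, of "-1"] 3 by (simp flip: of_real_power)
  finally have "(frob N)\<^sup>2 \<le> (frob T)\<^sup>2"
    using frob_colorth_mult[OF Wc W(2) N] by simp
  then have "frob N \<le> frob T" using frob_le_iff by blast
  then show ?thesis using that[OF H] unfolding N_def T_def by blast
qed

end

section \<open>Invariants of the sweeps and splits\<close>

context cuts
begin

text \<open>The triangular parts that arise when QR is applied again to an orthonormal factor have
  this form.\<close>

definition unitary_mat :: "nat \<Rightarrow> complex mat \<Rightarrow> bool" where
  "unitary_mat s D \<longleftrightarrow> D \<in> Sg s s \<and> cadj D * D = 1\<^sub>m (n s) \<and> D * cadj D = 1\<^sub>m (n s)"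

lemma unitary_mat_one: "unitary_mat s (1\<^sub>m (n s))"
proof -
  have "cadj (1\<^sub>m (n s)) = 1\<^sub>m (n s)" by (intro eq_matI) auto
  then show ?thesis using one_Sg by (simp add: unitary_mat_def)
qed

lemma colorth_unitary_mult:
  assumes D: "unitary_mat s D" and X: "X \<in> carrier_mat (n s) (n t)" "colorth t X"
  shows "colorth t (D * X)"
proof -
  have Dc: "D \<in> carrier_mat (n s) (n s)" using D by (auto simp: unitary_mat_def)
  have "cadj (D * X) * (D * X) = cadj X * (cadj D * (D * X))"
    unfolding cadj_mult[OF Dc X(1)] using Dc X by (intro assoc_mult_mat) auto
  also have "cadj D * (D * X) = cadj D * D * X"
    using Dc X by (intro assoc_mult_mat[symmetric]) auto
  also have "\<dots> = X" using D X by (simp add: unitary_mat_def)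
  finally show ?thesis using X(2) by (simp add: colorth_def)
qed

text \<open>Inside a \<open>U\<close> class the Gram matrix of \<open>D\<close> equals that of
  \<open>Q * D\<close>; across classes it vanishes by support. Since \<open>D\<close> is square, the
  one-sided inverse is two-sided.\<close>

lemma unitary_mat_if_colorth:
  assumes Q: "Q \<in> Sg r s" "colorth s Q" and D: "D \<in> Sg s s" and QD: "colorth s (Q * D)" and s: "s \<le> L"
  shows "unitary_mat s D"
proof -
  have Dc: "D \<in> carrier_mat (n s) (n s)" and Qc: "Q \<in> carrier_mat (n r) (n s)" using D Q by auto
  have DD: "cadj D * D \<in> Sg s s" using Sg_mult[OF cadj_Sg[OF D] D] s by simp
  have "cadj D * D = 1\<^sub>m (n s)"
  proof (rule eq_matI)
    fix i j assume "i < dim_row (1\<^sub>m (n s))" "j < dim_col (1\<^sub>m (n s))"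
    then have i: "i < n s" and j: "j < n s" by auto
    show "(cadj D * D) $$ (i,j) = 1\<^sub>m (n s) $$ (i,j)"
    proof (cases "U s s i = U s s j")
      case True
      then show ?thesis
        using gram_colorth_mult[OF Qc Q(2) D _ s i j] QD i j by (simp add: colorth_def)
    next
      case False
      then show ?thesis using SgD(1)[OF DD i j] i j by auto
    qed
  qed (use Dc in auto)
  moreover from this have "D * cadj D = 1\<^sub>m (n s)"
    by (rule mat_mult_left_right_inverse[OF cadj_carrier[OF Dc] Dc])
  ultimately show ?thesis using D by (simp add: unitary_mat_def)
qed

section \<open>Prefix products, cut errors and the two loop invariants\<close>

primrec Pr :: "(nat \<Rightarrow> complex mat) \<Rightarrow> nat \<Rightarrow> complex mat" where
  "Pr X 0 = 1\<^sub>m (n 0)"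
| "Pr X (Suc k) = Pr X k * X (Suc k)"

lemma Pr_cong: "(\<And>i. 1 \<le> i \<Longrightarrow> i \<le> k \<Longrightarrow> X i = Y i) \<Longrightarrow> Pr X k = Pr Y k"
  by (induction k) auto

lemma Pr_Sg:
  assumes "\<And>i. 1 \<le> i \<Longrightarrow> i \<le> k \<Longrightarrow> X i \<in> Sg (i - 1) i" "k \<le> L"
  shows "Pr X k \<in> Sg 0 k"
  using assms
proof (induction k)
  case (Suc k)
  have "Pr X k \<in> Sg 0 k" using Suc by auto
  moreover have "X (Suc k) \<in> Sg k (Suc k)" using Suc.prems(1)[of "Suc k"] by simp
  ultimately show ?case using Sg_mult[of "Pr X k" 0 k "X (Suc k)" "Suc k"] Suc.prems(2) by simp
qed (simp add: one_Sg)

lemma Pr_colorth: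
  assumes "\<And>i. 1 \<le> i \<Longrightarrow> i \<le> k \<Longrightarrow> X i \<in> Sg (i - 1) i \<and> colorth i (X i)" "k \<le> L"
  shows "colorth k (Pr X k)"
  using assms
proof (induction k)
  case (Suc k)
  have "Pr X k \<in> carrier_mat (n 0) (n k)" using Pr_Sg[of k X] Suc.prems by auto
  moreover have "X (Suc k) \<in> Sg k (Suc k)" "colorth (Suc k) (X (Suc k))"
    using Suc.prems(1)[of "Suc k"] by auto
  moreover have "colorth k (Pr X k)" using Suc by auto
  ultimately show ?case
    using colorth_mult[of "Pr X k" "n 0" k "X (Suc k)" "Suc k"] Suc.prems(2) by simp
qed (simp add: colorth_one)

text \<open>The error of the two-factor problem at cut \<open>k\<close>, expressed by labels so that
  it also makes sense for the mirrored levels; \<open>Ecut_eq\<close> identifies it with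
  \<open>E_err\<close>.\<close>

definition Ecut :: "complex mat \<Rightarrow> nat \<Rightarrow> real" where
  "Ecut A k = Inf {frob (A - X * Y) | X Y. X \<in> Sg 0 k \<and> Y \<in> Sg k L}"

lemma zero_Sg: "0\<^sub>m (n s) (n t) \<in> Sg s t"
  by (rule SgI) auto

text \<open>Zero factors make the set of errors nonempty, so a common lower bound stays below its
  infimum.\<close>

lemma le_Ecut:
  assumes "\<And>X Y. X \<in> Sg 0 k \<Longrightarrow> Y \<in> Sg k L \<Longrightarrow> c \<le> frob (A - X * Y)"
  shows "c \<le> Ecut A k"
  unfolding Ecut_def using assms zero_Sg by (intro cInf_greatest) blast+

text \<open>The state after the \<open>J\<close>-th two-factor step; \<open>X (J+1)\<close> is the factor not yet split.
  The last factor \<open>X J\<close> need not be orthonormal.\<close>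
definition after_split :: "complex mat \<Rightarrow> nat \<Rightarrow> (nat \<Rightarrow> complex mat) \<Rightarrow> bool" where
  "after_split A J X \<longleftrightarrow>
     (\<forall>i. 1 \<le> i \<and> i \<le> J \<longrightarrow> X i \<in> Sg (i - 1) i) \<and> X (Suc J) \<in> Sg J L \<and>
     (\<forall>i. 1 \<le> i \<and> i < J \<longrightarrow> colorth i (X i)) \<and>
     (\<forall>H K. H \<in> Sg (J - 1) J \<longrightarrow> K \<in> Sg J L \<longrightarrow>
        frob (A - Pr X J * X (Suc J)) \<le> frob (A - Pr X (J - 1) * (H * K))) \<and>
     (frob (A - Pr X J * X (Suc J)))\<^sup>2 \<le> (\<Sum>k=1..J. (Ecut A k)\<^sup>2)"

text \<open>All factors before the unsplit one are now orthonormal, and optimality of the previous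
  split has been converted into the orthogonality that the Pythagorean step of the next split
  consumes.\<close>

definition after_sweep :: "complex mat \<Rightarrow> nat \<Rightarrow> (nat \<Rightarrow> complex mat) \<Rightarrow> bool" where
  "after_sweep A J X \<longleftrightarrow>
     (\<forall>i. 1 \<le> i \<and> i \<le> J \<longrightarrow> X i \<in> Sg (i - 1) i \<and> colorth i (X i)) \<and> X (Suc J) \<in> Sg J L \<and>
     (\<forall>Z. Z \<in> Sg J L \<longrightarrow> ip (A - Pr X J * X (Suc J)) (Pr X J * Z) = 0) \<and>
     (frob (A - Pr X J * X (Suc J)))\<^sup>2 \<le> (\<Sum>k=1..J. (Ecut A k)\<^sup>2)"

text \<open>The prefix is still the identity, so minimality of the pair gives both the optimality
  clause and the bound by the error of the first cut.\<close>

lemma first_split: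
  assumes A: "A \<in> carrier_mat (n 0) (n L)" and L: "1 \<le> L" and X: "X 1 \<in> Sg 0 1" "X 2 \<in> Sg 1 L"
    and min: "\<And>H K. H \<in> Sg 0 1 \<Longrightarrow> K \<in> Sg 1 L \<Longrightarrow> frob (A - X 1 * X 2) \<le> frob (A - H * K)"
  shows "after_split A 1 X"
proof -
  have P: "Pr X (Suc 0) = X (Suc 0)" using X by auto
  have one: "1\<^sub>m (n 0) * (H * K) = H * K" if "H \<in> Sg 0 1" "K \<in> Sg 1 L" for H K
    using that by (meson Sg_carrier left_mult_one_mat mult_carrier_mat)
  have "(frob (A - X 1 * X 2))\<^sup>2 \<le> (Ecut A 1)\<^sup>2"
    using le_Ecut[of 1 "frob (A - X 1 * X 2)" A] min by (intro power_mono) auto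
  moreover have "frob (A - X 1 * X 2) \<le> frob (A - 1\<^sub>m (n 0) * (H * K))"
    if "H \<in> Sg 0 1" "K \<in> Sg 1 L" for H K using one[OF that] min[OF that] by simp
  ultimately show ?thesis using X P by (auto simp: after_split_def numeral_2_eq_2 le_Suc_eq simp del: Pr.simps(2))
qed

lemma split_step:
  assumes A: "A \<in> carrier_mat (n 0) (n L)" and J: "Suc J \<le> L" and X: "after_sweep A J X"
    and H: "H \<in> Sg J (Suc J)" and K: "K \<in> Sg (Suc J) L"
    and min: "\<And>H' K'. H' \<in> Sg J (Suc J) \<Longrightarrow> K' \<in> Sg (Suc J) L
      \<Longrightarrow> frob (X (Suc J) - H * K) \<le> frob (X (Suc J) - H' * K')"
  shows "after_split A (Suc J) (X(Suc J := H, Suc (Suc J) := K))"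
proof -
  let ?X = "X(Suc J := H, Suc (Suc J) := K)"
  define W where "W = Pr X J"
  define M where "M = X (Suc J)"
  have Xi: "\<And>i. 1 \<le> i \<Longrightarrow> i \<le> J \<Longrightarrow> X i \<in> Sg (i - 1) i \<and> colorth i (X i)" and M: "M \<in> Sg J L"
    and orth: "\<And>Z. Z \<in> Sg J L \<Longrightarrow> ip (A - W * M) (W * Z) = 0"
    and bnd: "(frob (A - W * M))\<^sup>2 \<le> (\<Sum>k=1..J. (Ecut A k)\<^sup>2)"
    using X by (auto simp: after_sweep_def M_def W_def)
  have W: "W \<in> Sg 0 J" "colorth J W" using Pr_Sg[of J X] Pr_colorth[of J X] Xi J by (auto simp: W_def)
  have Wc: "W \<in> carrier_mat (n 0) (n J)" using W by auto
  have PJ: "Pr ?X J = W" unfolding W_def by (rule Pr_cong) auto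
  have prod: "Pr ?X (Suc J) * ?X (Suc (Suc J)) = W * (H * K)"
    using PJ Wc H K by (auto intro!: assoc_mult_mat)
  have HK: "H' * K' \<in> Sg J L" if "H' \<in> Sg J (Suc J)" "K' \<in> Sg (Suc J) L" for H' K'
    using Sg_mult[OF that] J by simp
  have pyth: "(frob (A - W * (H' * K')))\<^sup>2 = (frob (A - W * M))\<^sup>2 + (frob (M - H' * K'))\<^sup>2"
    if "H' \<in> Sg J (Suc J)" "K' \<in> Sg (Suc J) L" for H' K'
    by (rule frob_colorth_split[OF Wc W(2) A M HK[OF that] orth])
  \<comment> \<open>The term with \<open>A - W * M\<close> is common to all competitors, so
    minimality for \<open>M\<close> becomes minimality for \<open>A\<close>.\<close>
  have min': "frob (A - W * (H * K)) \<le> frob (A - W * (H' * K'))"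
    if "H' \<in> Sg J (Suc J)" "K' \<in> Sg (Suc J) L" for H' K'
    using min[OF that, folded M_def] unfolding frob_le_iff pyth[OF that] pyth[OF H K] by simp
  have "frob (M - H * K) \<le> Ecut A (Suc J)"
  proof (rule le_Ecut)
    fix X' Y' assume X': "X' \<in> Sg 0 (Suc J)" and Y': "Y' \<in> Sg (Suc J) L"
    obtain H' where H': "H' \<in> Sg J (Suc J)" "frob (M - H' * Y') \<le> frob (A - X' * Y')"
      using compressed_approximation[OF W A M _ J orth X' Y'] by auto
    then show "frob (M - H * K) \<le> frob (A - X' * Y')"
      using min[OF H'(1) Y'] by (simp add: M_def)
  qed
  then have "(frob (M - H * K))\<^sup>2 \<le> (Ecut A (Suc J))\<^sup>2" by (intro power_mono) auto
  then have "(frob (A - W * (H * K)))\<^sup>2 \<le> (\<Sum>k=1..Suc J. (Ecut A k)\<^sup>2)"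
    using pyth[OF H K] bnd by simp
  then show ?thesis
    unfolding after_split_def prod using Xi H K min' PJ by (auto simp: le_Suc_eq less_Suc_eq)
qed

text \<open>\<open>D\<close> is the transfer matrix left by the last QR step and already absorbed
  into \<open>X' (Suc m)\<close>. Keeping it explicit records how the new prefix relates to the old
  one and lets its unitarity be tracked.\<close>

definition swept :: "nat \<Rightarrow> (nat \<Rightarrow> complex mat) \<Rightarrow> (nat \<Rightarrow> complex mat) \<Rightarrow> complex mat \<Rightarrow> bool" where
  "swept m X X' D \<longleftrightarrow> (\<forall>i. 1 \<le> i \<and> i \<le> m \<longrightarrow> X' i \<in> Sg (i - 1) i \<and> colorth i (X' i)) \<and>
     (\<forall>i > Suc m. X' i = X i) \<and> D \<in> Sg m m \<and> Pr X' m * D = Pr X m \<and> X' (Suc m) = D * X (Suc m)"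

lemma swept_0: "X 1 \<in> carrier_mat (n 0) k \<Longrightarrow> swept 0 X X (1\<^sub>m (n 0))"
  using one_Sg[of 0] by (auto simp: swept_def)

text \<open>The second part says that QR only rotates a factor that is already orthonormal: the
  matrix being decomposed is \<open>D * X (Suc m)\<close>, which is orthonormal when
  \<open>D\<close> is unitary, and so is \<open>Q\<close>; this forces \<open>R\<close> to be
  unitary.\<close>

lemma swept_step:
  assumes sw: "swept m X X' D" and Xm: "X (Suc m) \<in> Sg m (Suc m)" and m: "Suc m \<le> L"
    and Q: "Q \<in> Sg m (Suc m)" "colorth (Suc m) Q" and R: "R \<in> Sg (Suc m) (Suc m)"
    and QR: "X' (Suc m) = Q * R"
  shows "swept (Suc m) X (X'(Suc m := Q, Suc (Suc m) := R * X' (Suc (Suc m)))) R"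
    and "unitary_mat m D \<Longrightarrow> colorth (Suc m) (X (Suc m)) \<Longrightarrow> unitary_mat (Suc m) R"
proof -
  let ?X = "X'(Suc m := Q, Suc (Suc m) := R * X' (Suc (Suc m)))"
  have X'i: "\<And>i. 1 \<le> i \<Longrightarrow> i \<le> m \<Longrightarrow> X' i \<in> Sg (i - 1) i \<and> colorth i (X' i)"
    and X'X: "\<And>i. i > Suc m \<Longrightarrow> X' i = X i" and D: "D \<in> Sg m m" "Pr X' m * D = Pr X m"
    and X'm: "X' (Suc m) = D * X (Suc m)"
    using sw by (auto simp: swept_def)
  have P'c: "Pr X' m \<in> carrier_mat (n 0) (n m)" using Pr_Sg[of m X'] X'i m by auto
  have "Pr ?X m = Pr X' m" by (rule Pr_cong) auto
  then have "Pr ?X (Suc m) * R = Pr X' m * Q * R" by simp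
  also have "\<dots> = Pr X' m * (D * X (Suc m))"
    using assoc_mult_mat[OF P'c Sg_carrier[OF Q(1)] Sg_carrier[OF R]] QR X'm by simp
  also have "\<dots> = Pr X (Suc m)"
    using assoc_mult_mat[OF P'c Sg_carrier[OF D(1)] Sg_carrier[OF Xm]] D(2) by simp
  finally show "swept (Suc m) X ?X R"
    unfolding swept_def using X'i X'X Q R by (auto simp: le_Suc_eq)
  assume un: "unitary_mat m D" and co: "colorth (Suc m) (X (Suc m))"
  have "colorth (Suc m) (Q * R)"
    using colorth_unitary_mult[OF un Sg_carrier[OF Xm] co] QR X'm by simp
  then show "unitary_mat (Suc m) R" by (rule unitary_mat_if_colorth[OF Q R _ m])
qed

text \<open>\<open>Pr X' (J - 1) = Pr X (J - 1) * cadj D\<close>, so the optimality of the split carries over to the new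
  factors; it implies that the residual is orthogonal to the range of \<open>Pr X' J\<close>.\<close>
lemma sweep_end:
  assumes A: "A \<in> carrier_mat (n 0) (n L)" and J: "1 \<le> J" "J \<le> L" and X: "after_split A J X"
    and sw: "swept (J - 1) X X' D" and un: "unitary_mat (J - 1) D" and sw2: "swept J X X'' R"
    and eq: "\<And>i. i < J \<Longrightarrow> X'' i = X' i"
  shows "after_sweep A J X''"
proof -
  have D: "D \<in> Sg (J - 1) (J - 1)" "D * cadj D = 1\<^sub>m (n (J - 1))" using un by (auto simp: unitary_mat_def)
  have R: "R \<in> Sg J J" "Pr X'' J * R = Pr X J" "X'' (Suc J) = R * X (Suc J)"
    and X''i: "\<And>i. 1 \<le> i \<Longrightarrow> i \<le> J \<Longrightarrow> X'' i \<in> Sg (i - 1) i \<and> colorth i (X'' i)"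
    using sw2 by (auto simp: swept_def)
  have XJ: "X (Suc J) \<in> Sg J L"
    and bnd: "(frob (A - Pr X J * X (Suc J)))\<^sup>2 \<le> (\<Sum>k=1..J. (Ecut A k)\<^sup>2)"
    and min: "\<And>H K. H \<in> Sg (J - 1) J \<Longrightarrow> K \<in> Sg J L \<Longrightarrow>
        frob (A - Pr X J * X (Suc J)) \<le> frob (A - Pr X (J - 1) * (H * K))"
    using X by (auto simp: after_split_def)
  have PJ: "Pr X'' J \<in> Sg 0 J" using Pr_Sg[of J X''] X''i J by auto
  then have PJc: "Pr X'' J \<in> carrier_mat (n 0) (n J)" by auto
  have prod: "Pr X'' J * X'' (Suc J) = Pr X J * X (Suc J)"
    using assoc_mult_mat[OF PJc Sg_carrier[OF R(1)] Sg_carrier[OF XJ]] R by simp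
  have M: "X'' (Suc J) \<in> Sg J L" unfolding R(3) using Sg_mult[OF R(1) XJ] J by simp
  have P1: "Pr X' (J - 1) \<in> Sg 0 (J - 1)"
    using sw J by (intro Pr_Sg) (auto simp: swept_def)
  have P1'': "Pr X'' (J - 1) = Pr X' (J - 1)" using eq J by (intro Pr_cong) auto
  have "Pr X (J - 1) * cadj D = Pr X' (J - 1) * (D * cadj D)"
    using assoc_mult_mat[OF Sg_carrier[OF P1] Sg_carrier[OF D(1)] cadj_carrier[OF Sg_carrier[OF D(1)]]] sw
    by (simp add: swept_def)
  also have "\<dots> = Pr X' (J - 1)" using D(2) P1 by auto
  finally have P2: "Pr X'' (J - 1) = Pr X (J - 1) * cadj D" using P1'' by simp
  have P0: "Pr X (J - 1) \<in> carrier_mat (n 0) (n (J - 1))"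
    using X J by (intro Sg_carrier Pr_Sg) (auto simp: after_split_def)
  have Pstep: "Pr X'' J = Pr X'' (J - 1) * X'' J" using J by (cases J) auto
  have XJJ: "X'' J \<in> Sg (J - 1) J" using X''i J by auto
  have DX: "cadj D * X'' J \<in> Sg (J - 1) J" using Sg_mult[OF cadj_Sg[OF D(1)] XJJ] J by simp
  \<comment> \<open>The pair \<open>cadj D * X'' J\<close>, \<open>K\<close> is a competitor in the
    split that produced \<open>X\<close>, and with the old prefix it yields precisely the new prefix
    times \<open>K\<close>.\<close>
  have opt: "frob (A - Pr X'' J * X'' (Suc J)) \<le> frob (A - Pr X'' J * K)" if K: "K \<in> Sg J L" for K
  proof -
    have cs: "cadj D \<in> carrier_mat (n (J-1)) (n (J-1))" "X'' J \<in> carrier_mat (n (J-1)) (n J)"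
      "K \<in> carrier_mat (n J) (n L)" using D XJJ K by auto
    have "Pr X'' J * K = Pr X (J - 1) * (cadj D * X'' J * K)"
      unfolding Pstep P2 using assoc_mult_mat[OF P0 cs(1,2)] assoc_mult_mat[OF P0 _ cs(3)] cs by simp
    then show ?thesis using min[OF DX K] prod by simp
  qed
  have orth: "ip (A - Pr X'' J * X'' (Suc J)) (Pr X'' J * Z) = 0" if Z: "Z \<in> Sg J L" for Z
  proof (rule ip_eq_0_if_minimal)
    let ?P = "Pr X'' J" and ?M = "X'' (Suc J)"
    have Mc: "?M \<in> carrier_mat (n J) (n L)" and Zc: "Z \<in> carrier_mat (n J) (n L)" using M Z by auto
    show "A - ?P * ?M \<in> carrier_mat (n 0) (n L)" by (intro minus_carrier_mat mult_carrier_mat[OF PJc Mc])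
    show "?P * Z \<in> carrier_mat (n 0) (n L)" by (intro mult_carrier_mat[OF PJc Zc])
    fix c
    \<comment> \<open>Shifting the residual by a multiple of \<open>?P * Z\<close> amounts to
      replacing \<open>?M\<close> by another element of \<open>Sg J L\<close>, to which
      \<open>opt\<close> applies.\<close>
    have "?P * (?M + (-c) \<cdot>\<^sub>m Z) = ?P * ?M + (-c) \<cdot>\<^sub>m (?P * Z)"
      using mult_add_distrib_mat[OF PJc Mc smult_carrier_mat[OF Zc]] mult_smult_distrib[OF PJc Zc] by simp
    moreover have "A - (?P * ?M + (-c) \<cdot>\<^sub>m (?P * Z)) = A - ?P * ?M + c \<cdot>\<^sub>m (?P * Z)"
      using A PJc Mc Zc by (intro eq_matI) (auto simp del: index_mult_mat(1))
    ultimately show "frob (A - ?P * ?M) \<le> frob (A - ?P * ?M + c \<cdot>\<^sub>m (?P * Z))"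
      using opt[OF Sg_add[OF M Sg_smult[OF Z]], of "-c"] by simp
  qed
  show ?thesis unfolding after_sweep_def using X''i M orth bnd prod by auto
qed

end

section \<open>Decoupling into blocks\<close>

text \<open>Counting the smaller elements gives the index in the increasing enumeration. With this
  inverse pair, entries of an extracted block can be addressed by their indices in the full matrix,
  and block sums become sums over the index sets.\<close>

lemma sorted_list_nth_pos:
  assumes "finite S" "i \<in> S"
  shows "sorted_list_of_set S ! pos S i = i" and "pos S i < card S"
proof -
  let ?l = "sorted_list_of_set S"
  have l: "set ?l = S" "sorted_wrt (<) ?l" "length ?l = card S"
    using assms by (auto simp: strict_sorted_list_of_set)
  obtain a where a: "a < length ?l" "?l ! a = i" using l assms by (metis in_set_conv_nth)
  have "{x \<in> S. x < i} = (\<lambda>b. ?l ! b) ` {..<a}"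
  proof (intro equalityI subsetI)
    fix x assume x: "x \<in> {x \<in> S. x < i}"
    then obtain b where b: "b < length ?l" "?l ! b = x" using l by (metis (mono_tags) in_set_conv_nth mem_Collect_eq)
    have "\<not> a \<le> b"
      using sorted_wrt_nth_less[OF l(2) _ b(1), of a] a x b(2) by (cases "a = b") auto
    then have "b < a" by simp
    then show "x \<in> (\<lambda>b. ?l ! b) ` {..<a}" using b by auto
  next
    fix x assume "x \<in> (\<lambda>b. ?l ! b) ` {..<a}"
    then obtain b where b: "b < a" "x = ?l ! b" by auto
    then have "x < i" using sorted_wrt_nth_less[OF l(2) b(1) a(1)] a(2) by simp
    moreover have "x \<in> S" using b a l by (metis nth_mem order.strict_trans)
    ultimately show "x \<in> {x \<in> S. x < i}" by simp
  qed
  moreover have "inj_on (\<lambda>b. ?l ! b) {..<a}"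
    using a by (auto simp: inj_on_def nth_eq_iff_index_eq)
  ultimately have "pos S i = a" by (simp add: pos_def card_image)
  then show "?l ! pos S i = i" "pos S i < card S" using a l by auto
qed

lemma pos_sorted_list_nth:
  assumes "finite S" "x < card S"
  shows "pos S (sorted_list_of_set S ! x) = x" and "sorted_list_of_set S ! x \<in> S"
proof -
  let ?l = "sorted_list_of_set S"
  have l: "set ?l = S" "distinct ?l" "length ?l = card S" using assms by auto
  then show m: "?l ! x \<in> S" using assms by (metis nth_mem)
  show "pos S (?l ! x) = x"
    using sorted_list_nth_pos[OF assms(1) m] l assms by (metis nth_eq_iff_index_eq)
qed

lemma sum_pos:
  assumes "finite S"
  shows "(\<Sum>x<card S. g x) = (\<Sum>k\<in>S. g (pos S k))"
  by (rule sum.reindex_bij_witness[of _ "pos S" "\<lambda>x. sorted_list_of_set S ! x"])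
     (use assms in \<open>auto simp: sorted_list_nth_pos pos_sorted_list_nth\<close>)

lemma subm_carrier [simp]: "subm X I J \<in> carrier_mat (card I) (card J)"
  by (simp add: subm_def)

lemma subm_dim [simp]: "dim_row (subm X I J) = card I" "dim_col (subm X I J) = card J"
  by (simp_all add: subm_def)

lemma subm_index_pos:
  assumes "finite I" "finite J" "i \<in> I" "j \<in> J"
  shows "subm X I J $$ (pos I i, pos J j) = X $$ (i,j)"
  using assms by (simp add: subm_def sorted_list_nth_pos)

lemma mat_eq_pos:
  assumes "finite I" "finite J" "A \<in> carrier_mat (card I) (card J)" "B \<in> carrier_mat (card I) (card J)"
    and "\<And>i j. i \<in> I \<Longrightarrow> j \<in> J \<Longrightarrow> A $$ (pos I i, pos J j) = B $$ (pos I i, pos J j)"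
  shows "A = B"
proof (rule eq_matI)
  fix a b assume "a < dim_row B" "b < dim_col B"
  then have ab: "a < card I" "b < card J" using assms by auto
  then show "A $$ (a,b) = B $$ (a,b)"
    using assms(5)[of "sorted_list_of_set I ! a" "sorted_list_of_set J ! b"]
      pos_sorted_list_nth[OF assms(1), of a] pos_sorted_list_nth[OF assms(2), of b] by simp
qed (use assms in auto)

lemma mult_mat_index_pos:
  assumes "finite I" "finite P" "finite J" "A \<in> carrier_mat (card I) (card P)" "B \<in> carrier_mat (card P) (card J)"
    "i \<in> I" "j \<in> J"
  shows "(A * B) $$ (pos I i, pos J j) = (\<Sum>k\<in>P. A $$ (pos I i, pos P k) * B $$ (pos P k, pos J j))"
  using mult_mat_index[OF assms(4,5), of "pos I i" "pos J j"] assms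
  by (simp add: sorted_list_nth_pos sum_pos del: index_mult_mat(1))

lemma frob_sq_pos:
  assumes "finite I" "finite J" "A \<in> carrier_mat (card I) (card J)"
  shows "(frob A)\<^sup>2 = (\<Sum>i\<in>I. \<Sum>j\<in>J. (cmod (A $$ (pos I i, pos J j)))\<^sup>2)"
  using assms by (simp add: frob_sq sum_pos)

lemma minus_mat_index:
  assumes "B \<in> carrier_mat m n" "i < m" "j < n"
  shows "(A - B) $$ (i,j) = A $$ (i,j) - B $$ (i,j)"
  using assms by auto

definition Supp :: "nat mat \<Rightarrow> complex mat set" where
  "Supp S = {X. X \<in> carrier_mat (dim_row S) (dim_col S) \<and>
     (\<forall>i<dim_row S. \<forall>j<dim_col S. S $$ (i,j) = 0 \<longrightarrow> X $$ (i,j) = 0)}"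

text \<open>The supports of the rank-one contributions are either equal or disjoint, so the problem
  decouples into the blocks \<open>RP P \<times> CP P\<close>.\<close>
locale block_pair =
  fixes Lm Rm :: "nat mat" and m n q :: nat
  assumes Lc: "Lm \<in> carrier_mat m n" and Rc: "Rm \<in> carrier_mat n q"
    and Lnz: "k < n \<Longrightarrow> \<exists>p<m. Lm $$ (p,k) \<noteq> 0" and Rnz: "k < n \<Longrightarrow> \<exists>x<q. Rm $$ (k,x) \<noteq> 0"
    and share: "\<lbrakk>k < n; k' < n; p < m; x < q; Lm $$ (p,k) \<noteq> 0; Lm $$ (p,k') \<noteq> 0;
       Rm $$ (k,x) \<noteq> 0; Rm $$ (k',x) \<noteq> 0\<rbrakk> \<Longrightarrow> Umat Lm Rm k = Umat Lm Rm k'"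
begin

definition cls :: "nat \<Rightarrow> nat set" where "cls k = {j. j < n \<and> Umat Lm Rm j = Umat Lm Rm k}"
definition Rr :: "nat \<Rightarrow> nat set" where "Rr k = {p. p < m \<and> Lm $$ (p,k) \<noteq> 0}"
definition Cc :: "nat \<Rightarrow> nat set" where "Cc k = {x. x < q \<and> Rm $$ (k,x) \<noteq> 0}"

lemma dims: "dim_row Lm = m" "dim_col Lm = n" "dim_row Rm = n" "dim_col Rm = q"
  using Lc Rc by auto

lemma finites [simp]: "finite (cls k)" "finite (Rr k)" "finite (Cc k)"
  by (auto simp: cls_def Rr_def Cc_def)

lemma Rr_less: "p \<in> Rr k \<Longrightarrow> p < m" by (simp add: Rr_def)

lemma parts_eq: "parts Lm Rm = cls ` {..<n}"
  by (auto simp: parts_def cls_def dims)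

lemma in_cls [simp]: "k < n \<Longrightarrow> k \<in> cls k" by (simp add: cls_def)
lemma cls_less: "j \<in> cls k \<Longrightarrow> j < n" by (simp add: cls_def)
lemma cls_eq: "j \<in> cls k \<Longrightarrow> cls j = cls k" by (auto simp: cls_def)

lemma Umat_nz: "p < m \<Longrightarrow> x < q \<Longrightarrow> Umat Lm Rm k $$ (p,x) \<noteq> 0 \<longleftrightarrow> Lm $$ (p,k) \<noteq> 0 \<and> Rm $$ (k,x) \<noteq> 0"
  by (simp add: Umat_def dims)

lemma Rr_alt: "k < n \<Longrightarrow> Rr k = {p. p < m \<and> (\<exists>x<q. Umat Lm Rm k $$ (p,x) \<noteq> 0)}"
  using Umat_nz Rnz unfolding Rr_def by blast
lemma Cc_alt: "k < n \<Longrightarrow> Cc k = {x. x < q \<and> (\<exists>p<m. Umat Lm Rm k $$ (p,x) \<noteq> 0)}"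
  using Umat_nz Lnz unfolding Cc_def by blast

text \<open>Makes the arbitrary choice in \<open>repr\<close> harmless: \<open>RP\<close> and
  \<open>CP\<close> depend on the class alone.\<close>

lemma Umat_repr: "k < n \<Longrightarrow> Umat Lm Rm (repr (cls k)) = Umat Lm Rm k"
proof -
  assume "k < n"
  then have "repr (cls k) \<in> cls k" unfolding repr_def by (metis in_cls someI_ex)
  then show ?thesis by (simp add: cls_def)
qed

lemma RP_cls: "k < n \<Longrightarrow> RP Lm Rm (cls k) = Rr k"
  unfolding RP_def Umat_repr using Rr_alt by (simp add: dims)
lemma CP_cls: "k < n \<Longrightarrow> CP Lm Rm (cls k) = Cc k"
  unfolding CP_def Umat_repr using Cc_alt by (simp add: dims)

lemma Rr_cls: "j \<in> cls k \<Longrightarrow> k < n \<Longrightarrow> Rr j = Rr k"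
  using RP_cls cls_eq cls_less by metis
lemma Cc_cls: "j \<in> cls k \<Longrightarrow> k < n \<Longrightarrow> Cc j = Cc k"
  using CP_cls cls_eq cls_less by metis

lemma cls_unique: "P \<in> parts Lm Rm \<Longrightarrow> k \<in> P \<Longrightarrow> P = cls k"
  using cls_eq by (auto simp: parts_eq)

lemma cls_in_parts: "k < n \<Longrightarrow> cls k \<in> parts Lm Rm"
  by (auto simp: parts_eq)

text \<open>The only part containing column \<open>k\<close> is its own class, so the choice
  operator inside \<open>assemble\<close> has a single candidate.\<close>

lemma assemble_left:
  assumes "p < m" "k < n"
  shows "assemble m n (parts Lm Rm) (RP Lm Rm) id B $$ (p,k) =
    (if p \<in> Rr k then B (cls k) $$ (pos (Rr k) p, pos (cls k) k) else 0)"
proof -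
  have *: "P \<in> parts Lm Rm \<and> p \<in> RP Lm Rm P \<and> k \<in> id P \<longleftrightarrow> P = cls k \<and> p \<in> Rr k" for P
    using cls_unique[of P k] RP_cls[OF assms(2)] cls_in_parts[OF assms(2)] in_cls[OF assms(2)] by auto
  then have "(\<exists>P\<in>parts Lm Rm. p \<in> RP Lm Rm P \<and> k \<in> id P) \<longleftrightarrow> p \<in> Rr k" by blast
  moreover have "(SOME P. P \<in> parts Lm Rm \<and> p \<in> RP Lm Rm P \<and> k \<in> id P) = cls k" if "p \<in> Rr k"
    unfolding * using that by simp
  ultimately show ?thesis using assms RP_cls[of k] by (simp add: assemble_def Let_def)
qed

lemma assemble_right:
  assumes "x < q" "k < n"
  shows "assemble n q (parts Lm Rm) id (CP Lm Rm) B $$ (k,x) =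
    (if x \<in> Cc k then B (cls k) $$ (pos (cls k) k, pos (Cc k) x) else 0)"
proof -
  have *: "P \<in> parts Lm Rm \<and> k \<in> id P \<and> x \<in> CP Lm Rm P \<longleftrightarrow> P = cls k \<and> x \<in> Cc k" for P
    using cls_unique[of P k] CP_cls[OF assms(2)] cls_in_parts[OF assms(2)] in_cls[OF assms(2)] by auto
  then have "(\<exists>P\<in>parts Lm Rm. k \<in> id P \<and> x \<in> CP Lm Rm P) \<longleftrightarrow> x \<in> Cc k" by blast
  moreover have "(SOME P. P \<in> parts Lm Rm \<and> k \<in> id P \<and> x \<in> CP Lm Rm P) = cls k" if "x \<in> Cc k"
    unfolding * using that by simp
  ultimately show ?thesis using assms CP_cls[of k] by (simp add: assemble_def Let_def)
qed

lemma assemble_left_Supp: "assemble m n (parts Lm Rm) (RP Lm Rm) id B \<in> Supp Lm"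
proof -
  have "assemble m n (parts Lm Rm) (RP Lm Rm) id B \<in> carrier_mat m n" by (simp add: assemble_def)
  then show ?thesis unfolding Supp_def dims by (simp add: assemble_left Rr_def)
qed

lemma assemble_right_Supp: "assemble n q (parts Lm Rm) id (CP Lm Rm) B \<in> Supp Rm"
proof -
  have "assemble n q (parts Lm Rm) id (CP Lm Rm) B \<in> carrier_mat n q" by (simp add: assemble_def)
  then show ?thesis unfolding Supp_def dims by (simp add: assemble_right Cc_def)
qed

lemma SuppLD: "X \<in> Supp Lm \<Longrightarrow> p < m \<Longrightarrow> k < n \<Longrightarrow> X $$ (p,k) \<noteq> 0 \<Longrightarrow> p \<in> Rr k"
  by (auto simp: Supp_def Rr_def dims)
lemma SuppRD: "Y \<in> Supp Rm \<Longrightarrow> k < n \<Longrightarrow> x < q \<Longrightarrow> Y $$ (k,x) \<noteq> 0 \<Longrightarrow> x \<in> Cc k"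
  by (auto simp: Supp_def Cc_def dims)
lemma SuppL_carrier: "X \<in> Supp Lm \<Longrightarrow> X \<in> carrier_mat m n"
  by (simp add: Supp_def dims)
lemma SuppR_carrier: "Y \<in> Supp Rm \<Longrightarrow> Y \<in> carrier_mat n q"
  by (simp add: Supp_def dims)

lemma class_if_share:
  assumes "k < n" "k' < n" "p \<in> Rr k" "p \<in> Rr k'" "x \<in> Cc k" "x \<in> Cc k'"
  shows "k' \<in> cls k"
  using share[of k' k p x] assms by (auto simp: cls_def Rr_def Cc_def)

text \<open>An index outside the class of \<open>k\<close> cannot contribute to an entry of the
  block of \<open>k\<close>: it would share a support position with \<open>k\<close>, and
  \<open>share\<close> would put it into that class.\<close>

lemma mult_on_block:
  assumes X: "X \<in> Supp Lm" and Y: "Y \<in> Supp Rm" and k: "k < n" and p: "p \<in> Rr k" and x: "x \<in> Cc k"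
  shows "(X * Y) $$ (p,x) = (subm X (Rr k) (cls k) * subm Y (cls k) (Cc k)) $$ (pos (Rr k) p, pos (Cc k) x)"
proof -
  have px: "p < m" "x < q" using p x by (auto simp: Rr_def Cc_def)
  have "(X * Y) $$ (p,x) = (\<Sum>j<n. X $$ (p,j) * Y $$ (j,x))"
    by (rule mult_mat_index[OF SuppL_carrier[OF X] SuppR_carrier[OF Y] px])
  also have "\<dots> = (\<Sum>j\<in>cls k. X $$ (p,j) * Y $$ (j,x))"
  proof (rule sum.mono_neutral_right)
    show "\<forall>j\<in>{..<n} - cls k. X $$ (p,j) * Y $$ (j,x) = 0"
    proof
      fix j assume j: "j \<in> {..<n} - cls k"
      then have "\<not> (p \<in> Rr j \<and> x \<in> Cc j)" using class_if_share[OF k, of j p x] p x by auto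
      then show "X $$ (p,j) * Y $$ (j,x) = 0"
        using SuppLD[OF X px(1), of j] SuppRD[OF Y _ px(2), of j] j by auto
    qed
  qed (auto simp: cls_def)
  also have "\<dots> = (subm X (Rr k) (cls k) * subm Y (cls k) (Cc k)) $$ (pos (Rr k) p, pos (Cc k) x)"
    using p x by (subst mult_mat_index_pos[where P="cls k"]) (auto simp: subm_index_pos intro!: sum.cong)
  finally show ?thesis .
qed

lemma mult_off_blocks:
  assumes X: "X \<in> Supp Lm" and Y: "Y \<in> Supp Rm" and px: "p < m" "x < q"
    and off: "\<And>k. k < n \<Longrightarrow> \<not> (p \<in> Rr k \<and> x \<in> Cc k)"
  shows "(X * Y) $$ (p,x) = 0"
proof -
  have "(X * Y) $$ (p,x) = (\<Sum>j<n. X $$ (p,j) * Y $$ (j,x))"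
    by (rule mult_mat_index[OF SuppL_carrier[OF X] SuppR_carrier[OF Y] px])
  also have "\<dots> = 0"
  proof (intro sum.neutral ballI)
    fix j assume j: "j \<in> {..<n}"
    show "X $$ (p,j) * Y $$ (j,x) = 0"
      using SuppLD[OF X px(1), of j] SuppRD[OF Y _ px(2), of j] j off[of j] by auto
  qed
  finally show ?thesis .
qed

text \<open>Positions covered by no block. Products of supported factors vanish there, so these
  entries of the target are a fixed part of the error.\<close>

definition off :: "(nat \<times> nat) set" where
  "off = {..<m} \<times> {..<q} - (\<Union>P\<in>parts Lm Rm. RP Lm Rm P \<times> CP Lm Rm P)"

text \<open>Distinct classes have disjoint blocks, and on each block the product only involves the
  block's own subfactors. The objective is therefore a sum of independent small problems plus a
  constant.\<close>

lemma frob_blocks: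
  assumes M: "M \<in> carrier_mat m q" and X: "X \<in> Supp Lm" and Y: "Y \<in> Supp Rm"
  shows "(frob (M - X * Y))\<^sup>2 = (\<Sum>P\<in>parts Lm Rm.
      (frob (subm M (RP Lm Rm P) (CP Lm Rm P) - subm X (RP Lm Rm P) P * subm Y P (CP Lm Rm P)))\<^sup>2)
    + (\<Sum>(p,x)\<in>off. (cmod (M $$ (p,x)))\<^sup>2)"
proof -
  let ?B = "\<lambda>P. RP Lm Rm P \<times> CP Lm Rm P"
  let ?f = "\<lambda>(p,x). (cmod ((M - X * Y) $$ (p,x)))\<^sup>2"
  have XY: "X * Y \<in> carrier_mat m q" using SuppL_carrier[OF X] SuppR_carrier[OF Y] by simp
  have sub: "(\<Union>P\<in>parts Lm Rm. ?B P) \<subseteq> {..<m} \<times> {..<q}"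
    using RP_cls CP_cls by (auto simp: parts_eq Rr_def Cc_def)
  have fin: "finite (parts Lm Rm)" by (simp add: parts_eq)
  have finB: "\<forall>P\<in>parts Lm Rm. finite (?B P)" using RP_cls CP_cls by (auto simp: parts_eq)
  have disj: "\<forall>P\<in>parts Lm Rm. \<forall>P'\<in>parts Lm Rm. P \<noteq> P' \<longrightarrow> ?B P \<inter> ?B P' = {}"
  proof (intro ballI impI)
    fix P P' assume P: "P \<in> parts Lm Rm" "P' \<in> parts Lm Rm" "P \<noteq> P'"
    then obtain k k' where k: "k < n" "P = cls k" "k' < n" "P' = cls k'" by (auto simp: parts_eq)
    then have "k' \<notin> cls k" using P(3) cls_eq by blast
    then show "?B P \<inter> ?B P' = {}"
      using class_if_share[OF k(1,3)] RP_cls[OF k(1)] RP_cls[OF k(3)] CP_cls[OF k(1)] CP_cls[OF k(3)]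
      unfolding k(2,4) by blast
  qed
  have "(frob (M - X * Y))\<^sup>2 = (\<Sum>z\<in>{..<m} \<times> {..<q}. ?f z)"
    using carrier_matD[OF minus_carrier_mat[OF XY], of M] by (simp add: frob_sq sum.cartesian_product split_def del: index_minus_mat)
  also have "{..<m} \<times> {..<q} = (\<Union>P\<in>parts Lm Rm. ?B P) \<union> off"
    using sub by (auto simp: off_def)
  also have "sum ?f ((\<Union>P\<in>parts Lm Rm. ?B P) \<union> off) = sum ?f (\<Union>P\<in>parts Lm Rm. ?B P) + sum ?f off"
    using finB fin by (intro sum.union_disjoint) (auto simp: off_def)
  also have "sum ?f (\<Union>P\<in>parts Lm Rm. ?B P) = (\<Sum>P\<in>parts Lm Rm. sum ?f (?B P))"
    by (rule sum.UNION_disjoint[OF fin finB disj])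
  also have "\<dots> = (\<Sum>P\<in>parts Lm Rm.
      (frob (subm M (RP Lm Rm P) (CP Lm Rm P) - subm X (RP Lm Rm P) P * subm Y P (CP Lm Rm P)))\<^sup>2)"
  proof (intro sum.cong refl)
    fix P assume "P \<in> parts Lm Rm"
    then obtain k where k: "k < n" "P = cls k" by (auto simp: parts_eq)
    let ?N = "subm M (Rr k) (Cc k) - subm X (Rr k) (cls k) * subm Y (cls k) (Cc k)"
    have Nc: "subm X (Rr k) (cls k) * subm Y (cls k) (Cc k) \<in> carrier_mat (card (Rr k)) (card (Cc k))"
      by (rule mult_carrier_mat[OF subm_carrier subm_carrier])
    have "sum ?f (Rr k \<times> Cc k) = (\<Sum>p\<in>Rr k. \<Sum>x\<in>Cc k. (cmod (?N $$ (pos (Rr k) p, pos (Cc k) x)))\<^sup>2)"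
      unfolding sum.cartesian_product[symmetric]
    proof (intro sum.cong refl)
      fix p x assume px: "p \<in> Rr k" "x \<in> Cc k"
      then have lt: "p < m" "x < q" by (auto simp: Rr_def Cc_def)
      have "(M - X * Y) $$ (p,x) = M $$ (p,x) - (X * Y) $$ (p,x)" using minus_mat_index[OF XY lt] .
      moreover have "?N $$ (pos (Rr k) p, pos (Cc k) x) = M $$ (p,x) - (X * Y) $$ (p,x)"
        using minus_mat_index[OF Nc sorted_list_nth_pos(2)[OF finites(2) px(1)] sorted_list_nth_pos(2)[OF finites(3) px(2)]]
          mult_on_block[OF X Y k(1) px] subm_index_pos[OF finites(2,3) px] by simp
      ultimately show "(cmod ((M - X * Y) $$ (p,x)))\<^sup>2 = (cmod (?N $$ (pos (Rr k) p, pos (Cc k) x)))\<^sup>2" by simp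
    qed
    also have "\<dots> = (frob ?N)\<^sup>2"
      by (rule frob_sq_pos[symmetric, OF _ _ minus_carrier_mat[OF Nc]]) auto
    finally show "sum ?f (?B P) = (frob (subm M (RP Lm Rm P) (CP Lm Rm P) - subm X (RP Lm Rm P) P * subm Y P (CP Lm Rm P)))\<^sup>2"
      using k RP_cls CP_cls by simp
  qed
  also have "sum ?f off = (\<Sum>(p,x)\<in>off. (cmod (M $$ (p,x)))\<^sup>2)"
  proof (intro sum.cong refl, clarify)
    fix p x assume px: "(p,x) \<in> off"
    then have lt: "p < m" "x < q" by (auto simp: off_def)
    have "\<not> (p \<in> Rr k \<and> x \<in> Cc k)" if "k < n" for k
      using px that RP_cls[OF that] CP_cls[OF that] by (auto simp: off_def parts_eq)
    then have "(X * Y) $$ (p,x) = 0" by (rule mult_off_blocks[OF X Y lt])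
    then show "(cmod ((M - X * Y) $$ (p,x)))\<^sup>2 = (cmod (M $$ (p,x)))\<^sup>2"
      using minus_mat_index[OF XY lt] by simp
  qed
  finally show ?thesis .
qed

lemma subm_assemble_left:
  assumes k: "k < n" and B: "B (cls k) \<in> carrier_mat (card (Rr k)) (card (cls k))"
  shows "subm (assemble m n (parts Lm Rm) (RP Lm Rm) id B) (Rr k) (cls k) = B (cls k)"
proof (rule mat_eq_pos[OF _ _ _ B])
  fix i j assume ij: "i \<in> Rr k" "j \<in> cls k"
  then have "i < m" "j < n" "cls j = cls k" "Rr j = Rr k"
    using cls_less cls_eq Rr_cls k by (auto simp: Rr_def)
  then show "subm (assemble m n (parts Lm Rm) (RP Lm Rm) id B) (Rr k) (cls k) $$ (pos (Rr k) i, pos (cls k) j)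
      = B (cls k) $$ (pos (Rr k) i, pos (cls k) j)"
    using ij by (simp add: subm_index_pos assemble_left)
qed auto

lemma subm_assemble_right:
  assumes k: "k < n" and B: "B (cls k) \<in> carrier_mat (card (cls k)) (card (Cc k))"
  shows "subm (assemble n q (parts Lm Rm) id (CP Lm Rm) B) (cls k) (Cc k) = B (cls k)"
proof (rule mat_eq_pos[OF _ _ _ B])
  fix i j assume ij: "i \<in> cls k" "j \<in> Cc k"
  then have "j < q" "i < n" "cls i = cls k" "Cc i = Cc k"
    using cls_less cls_eq Cc_cls k by (auto simp: Cc_def)
  then show "subm (assemble n q (parts Lm Rm) id (CP Lm Rm) B) (cls k) (Cc k) $$ (pos (cls k) i, pos (Cc k) j)
      = B (cls k) $$ (pos (cls k) i, pos (Cc k) j)"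
    using ij by (simp add: subm_index_pos assemble_right)
qed auto

text \<open>Each summand of \<open>frob_blocks\<close> is minimised separately, and the last term is
  the same for all factors.\<close>

lemma assemble_minimizers:
  assumes M: "M \<in> carrier_mat m q"
    and HK: "\<And>P. P \<in> parts Lm Rm \<Longrightarrow>
      is_minimizer (subm M (RP Lm Rm P) (CP Lm Rm P)) (card P) (fst (HK P)) (snd (HK P))"
    and X: "X \<in> Supp Lm" and Y: "Y \<in> Supp Rm"
  shows "frob (M - assemble m n (parts Lm Rm) (RP Lm Rm) id (\<lambda>P. fst (HK P))
      * assemble n q (parts Lm Rm) id (CP Lm Rm) (\<lambda>P. snd (HK P))) \<le> frob (M - X * Y)"
  unfolding frob_le_iff frob_blocks[OF M assemble_left_Supp assemble_right_Supp] frob_blocks[OF M X Y]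
proof (intro add_right_mono sum_mono)
  fix P assume P: "P \<in> parts Lm Rm"
  then obtain k where k: "k < n" "P = cls k" by (auto simp: parts_eq)
  have min: "is_minimizer (subm M (Rr k) (Cc k)) (card P) (fst (HK P)) (snd (HK P))"
    using HK[OF P] k RP_cls CP_cls by simp
  have "subm (assemble m n (parts Lm Rm) (RP Lm Rm) id (\<lambda>P. fst (HK P))) (Rr k) (cls k) = fst (HK P)"
    "subm (assemble n q (parts Lm Rm) id (CP Lm Rm) (\<lambda>P. snd (HK P))) (cls k) (Cc k) = snd (HK P)"
    using min k by (auto simp: is_minimizer_def intro!: subm_assemble_left subm_assemble_right)
  then show "(frob (subm M (RP Lm Rm P) (CP Lm Rm P)
        - subm (assemble m n (parts Lm Rm) (RP Lm Rm) id (\<lambda>P. fst (HK P))) (RP Lm Rm P) P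
        * subm (assemble n q (parts Lm Rm) id (CP Lm Rm) (\<lambda>P. snd (HK P))) P (CP Lm Rm P)))\<^sup>2
      \<le> (frob (subm M (RP Lm Rm P) (CP Lm Rm P) - subm X (RP Lm Rm P) P * subm Y P (CP Lm Rm P)))\<^sup>2"
    using min k RP_cls CP_cls unfolding frob_le_iff[symmetric] is_minimizer_def by simp
qed

text \<open>The many small QR decompositions amount to one factorisation of the full matrix:
  \<open>D\<close> collects the triangular blocks and mixes only indices of one class, and the same
  \<open>D\<close> is moved into the right factor. In the application this makes \<open>D\<close> an
  element of \<open>Sg k k\<close>.\<close>

lemma assemble_qr:
  assumes X: "X \<in> Supp Lm" and Y: "Y \<in> Supp Rm"
    and QR: "\<And>P. P \<in> parts Lm Rm \<Longrightarrow> is_qr (subm X (RP Lm Rm P) P) (fst (QR P)) (snd (QR P))"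
  defines "Q \<equiv> assemble m n (parts Lm Rm) (RP Lm Rm) id (\<lambda>P. fst (QR P))"
    and "Y' \<equiv> assemble n q (parts Lm Rm) id (CP Lm Rm) (\<lambda>P. snd (QR P) * subm Y P (CP Lm Rm P))"
  obtains D where "D \<in> carrier_mat n n"
    "\<And>i j. i < n \<Longrightarrow> j < n \<Longrightarrow> D $$ (i,j) \<noteq> 0 \<Longrightarrow> Umat Lm Rm i = Umat Lm Rm j"
    "X = Q * D" "Y' = D * Y"
    "\<And>i j. i < n \<Longrightarrow> j < n \<Longrightarrow> Umat Lm Rm i = Umat Lm Rm j
      \<Longrightarrow> (cadj Q * Q) $$ (i,j) = (if i = j then 1 else 0)"
proof -
  define D where "D = mat n n (\<lambda>(i,j). if i \<in> cls j then snd (QR (cls j)) $$ (pos (cls j) i, pos (cls j) j) else 0)"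
  have Dc: "D \<in> carrier_mat n n" by (simp add: D_def)
  have Q: "Q \<in> Supp Lm" unfolding Q_def by (rule assemble_left_Supp)
  note Qc = SuppL_carrier[OF Q] and Xc = SuppL_carrier[OF X] and Yc = SuppR_carrier[OF Y]
  have Y'c: "Y' \<in> carrier_mat n q" unfolding Y'_def by (rule SuppR_carrier[OF assemble_right_Supp])
  have qr: "is_qr (subm X (Rr k) (cls k)) (fst (QR (cls k))) (snd (QR (cls k)))" if "k < n" for k
    using QR[of "cls k"] RP_cls[OF that] that by (simp add: parts_eq)
  have Qi: "Q $$ (p,j) = fst (QR (cls k)) $$ (pos (Rr k) p, pos (cls k) j)"
    if "p \<in> Rr k" "j \<in> cls k" "k < n" for p j k
  proof -
    have "p < m" using that(1) by (simp add: Rr_def)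
    then show ?thesis
      using that(1) assemble_left[of p j] cls_less[OF that(2)] cls_eq[OF that(2)] Rr_cls[OF that(2,3)]
      by (simp add: Q_def)
  qed
  have XQD: "X $$ (p,k) = (Q * D) $$ (p,k)" if p: "p < m" and k: "k < n" for p k
  proof -
    have "(Q * D) $$ (p,k) = (\<Sum>j<n. Q $$ (p,j) * D $$ (j,k))" by (rule mult_mat_index[OF Qc Dc p k])
    also have "\<dots> = (\<Sum>j\<in>cls k. Q $$ (p,j) * D $$ (j,k))"
      using k by (intro sum.mono_neutral_right) (auto simp: D_def cls_less)
    also have "\<dots> = X $$ (p,k)"
    proof (cases "p \<in> Rr k")
      case True
      have "X $$ (p,k) = subm X (Rr k) (cls k) $$ (pos (Rr k) p, pos (cls k) k)"
        using True k by (simp add: subm_index_pos)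
      also have "subm X (Rr k) (cls k) = fst (QR (cls k)) * snd (QR (cls k))"
        using qr[OF k] by (simp add: is_qr_def)
      also have "\<dots> $$ (pos (Rr k) p, pos (cls k) k) = (\<Sum>j\<in>cls k.
          fst (QR (cls k)) $$ (pos (Rr k) p, pos (cls k) j) * snd (QR (cls k)) $$ (pos (cls k) j, pos (cls k) k))"
        using qr[OF k] True k by (intro mult_mat_index_pos) (auto simp: is_qr_def)
      also have "\<dots> = (\<Sum>j\<in>cls k. Q $$ (p,j) * D $$ (j,k))"
        using True k by (intro sum.cong refl) (simp add: Qi D_def cls_less)
      finally show ?thesis by simp
    next
      case False
      then have "X $$ (p,k) = 0" using SuppLD[OF X p k] by blast
      moreover have "Q $$ (p,j) = 0" if "j \<in> cls k" for j
        using SuppLD[OF Q p, of j] Rr_cls[OF that k] cls_less[OF that] False by blast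
      ultimately show ?thesis by simp
    qed
    finally show ?thesis by simp
  qed
  have YDY: "Y' $$ (k,x) = (D * Y) $$ (k,x)" if k: "k < n" and x: "x < q" for k x
  proof -
    have "(D * Y) $$ (k,x) = (\<Sum>j<n. D $$ (k,j) * Y $$ (j,x))" by (rule mult_mat_index[OF Dc Yc k x])
    also have "\<dots> = (\<Sum>j\<in>cls k. D $$ (k,j) * Y $$ (j,x))"
      using k by (intro sum.mono_neutral_right) (auto simp: D_def cls_def)
    also have "\<dots> = Y' $$ (k,x)"
    proof (cases "x \<in> Cc k")
      case True
      have "Y' $$ (k,x) = (snd (QR (cls k)) * subm Y (cls k) (Cc k)) $$ (pos (cls k) k, pos (Cc k) x)"
        using True assemble_right[OF x k] CP_cls[OF k] by (simp add: Y'_def)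
      also have "\<dots> = (\<Sum>j\<in>cls k. snd (QR (cls k)) $$ (pos (cls k) k, pos (cls k) j)
          * subm Y (cls k) (Cc k) $$ (pos (cls k) j, pos (Cc k) x))"
        using qr[OF k] True k by (intro mult_mat_index_pos) (auto simp: is_qr_def)
      also have "\<dots> = (\<Sum>j\<in>cls k. D $$ (k,j) * Y $$ (j,x))"
      proof (intro sum.cong refl)
        fix j assume j: "j \<in> cls k"
        have "k \<in> cls j" using cls_eq[OF j] k by (metis in_cls)
        then show "snd (QR (cls k)) $$ (pos (cls k) k, pos (cls k) j)
            * subm Y (cls k) (Cc k) $$ (pos (cls k) j, pos (Cc k) x) = D $$ (k,j) * Y $$ (j,x)"
          using True j k cls_less[OF j] cls_eq[OF j] by (simp add: subm_index_pos D_def)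
      qed
      finally show ?thesis by simp
    next
      case False
      then have "Y' $$ (k,x) = 0" using assemble_right[OF x k] by (simp add: Y'_def)
      moreover have "Y $$ (j,x) = 0" if "j \<in> cls k" for j
        using SuppRD[OF Y cls_less[OF that] x] Cc_cls[OF that k] False by blast
      ultimately show ?thesis by simp
    qed
    finally show ?thesis by simp
  qed
  have QQ: "(cadj Q * Q) $$ (i,k) = (if i = k then 1 else 0)"
    if i: "i < n" and k: "k < n" and U: "Umat Lm Rm i = Umat Lm Rm k" for i k
  proof -
    let ?Q = "fst (QR (cls k))"
    have ik: "i \<in> cls k" using U i by (simp add: cls_def)
    have Qk: "?Q \<in> carrier_mat (card (Rr k)) (card (cls k))" "cadj ?Q * ?Q = 1\<^sub>m (card (cls k))"
      using qr[OF k] by (auto simp: is_qr_def)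
    have "(cadj Q * Q) $$ (i,k) = (\<Sum>p<m. cadj Q $$ (i,p) * Q $$ (p,k))"
      by (rule mult_mat_index[OF cadj_carrier[OF Qc] Qc i k])
    also have "\<dots> = (\<Sum>p\<in>Rr k. cadj Q $$ (i,p) * Q $$ (p,k))"
      using SuppLD[OF Q _ k] by (intro sum.mono_neutral_right) (auto simp: Rr_def)
    also have "\<dots> = (\<Sum>p\<in>Rr k. cadj ?Q $$ (pos (cls k) i, pos (Rr k) p) * ?Q $$ (pos (Rr k) p, pos (cls k) k))"
    proof (intro sum.cong refl)
      fix p assume p: "p \<in> Rr k"
      then show "cadj Q $$ (i,p) * Q $$ (p,k)
          = cadj ?Q $$ (pos (cls k) i, pos (Rr k) p) * ?Q $$ (pos (Rr k) p, pos (cls k) k)"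
        using Qi[OF p ik k] Qi[OF p in_cls[OF k] k] Qc Qk(1) i Rr_less[OF p]
          sorted_list_nth_pos(2)[OF finites(1) ik] sorted_list_nth_pos(2)[OF finites(2) p] by simp
    qed
    also have "\<dots> = (cadj ?Q * ?Q) $$ (pos (cls k) i, pos (cls k) k)"
      using Qk ik k by (intro mult_mat_index_pos[symmetric]) auto
    also have "\<dots> = (if i = k then 1 else 0)"
      unfolding Qk(2) using ik k sorted_list_nth_pos[of "cls k" i] sorted_list_nth_pos[of "cls k" k] by auto
    finally show ?thesis .
  qed
  have DU: "Umat Lm Rm i = Umat Lm Rm j" if "i < n" "j < n" "D $$ (i,j) \<noteq> 0" for i j
    using that by (auto simp: D_def cls_def split: if_splits)
  show ?thesis
    by (rule that[OF Dc DU _ _ QQ]) (use Xc Qc Dc Yc Y'c XQD YDY in \<open>auto simp del: index_mult_mat(1) intro!: eq_matI\<close>)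
qed

end

section \<open>QR decompositions and best low-rank approximations\<close>

text \<open>Vectors are functions of which the first \<open>m\<close> entries count, so that a
  Gram-Schmidt family can be extended by function update.\<close>

definition fip :: "nat \<Rightarrow> (nat \<Rightarrow> complex) \<Rightarrow> (nat \<Rightarrow> complex) \<Rightarrow> complex" where
  "fip m f g = (\<Sum>i<m. cnj (f i) * g i)"

definition orthonormal :: "nat \<Rightarrow> nat \<Rightarrow> (nat \<Rightarrow> nat \<Rightarrow> complex) \<Rightarrow> bool" where
  "orthonormal m k q \<longleftrightarrow> (\<forall>j<k. \<forall>l<k. fip m (q j) (q l) = (if j = l then 1 else 0))"

lemma fip_residual_orthogonal:
  assumes q: "orthonormal m k q" and j: "j < k"
  shows "fip m (q j) (\<lambda>i. v i - (\<Sum>l<k. fip m (q l) v * q l i)) = 0"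
proof -
  have "fip m (q j) (\<lambda>i. v i - (\<Sum>l<k. fip m (q l) v * q l i))
      = fip m (q j) v - (\<Sum>i<m. \<Sum>l<k. fip m (q l) v * (cnj (q j i) * q l i))"
    unfolding fip_def[of m "q j"] by (simp add: right_diff_distrib sum_subtractf sum_distrib_left mult.left_commute)
  also have "(\<Sum>i<m. \<Sum>l<k. fip m (q l) v * (cnj (q j i) * q l i))
      = (\<Sum>l<k. fip m (q l) v * fip m (q j) (q l))"
    unfolding fip_def[of m "q j"] by (subst sum.swap) (simp add: sum_distrib_left)
  also have "\<dots> = (\<Sum>l<k. if j = l then fip m (q l) v else 0)"
    using q j by (intro sum.cong) (auto simp: orthonormal_def)
  also have "\<dots> = fip m (q j) v" using j by simp
  finally show ?thesis by simp
qed

lemma fip_self: "fip m w w = of_real (\<Sum>i<m. (cmod (w i))\<^sup>2)"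
  unfolding fip_def of_real_sum by (intro sum.cong refl) (simp add: complex_norm_square mult.commute del: of_real_power)

lemma normalise_orthogonal:
  assumes w: "\<exists>i<m. w i \<noteq> 0" and orth: "\<And>j. j < k \<Longrightarrow> fip m (q j) w = 0"
  obtains u t where "fip m u u = 1" "\<And>j. j < k \<Longrightarrow> fip m (q j) u = 0" "\<And>i. w i = t * u i"
proof -
  define s where "s = sqrt (\<Sum>i<m. (cmod (w i))\<^sup>2)"
  have "0 < (\<Sum>i<m. (cmod (w i))\<^sup>2)" using w by (auto intro!: sum_pos2)
  then have s: "s > 0" "s\<^sup>2 = (\<Sum>i<m. (cmod (w i))\<^sup>2)" by (auto simp: s_def)
  define u where "u = (\<lambda>i. w i / of_real s)"
  have "fip m u u = fip m w w / (of_real s)\<^sup>2"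
    by (simp add: fip_def u_def sum_divide_distrib power2_eq_square)
  also have "fip m w w = (of_real s)\<^sup>2" unfolding fip_self s(2)[symmetric] by simp
  finally have "fip m u u = 1" using s(1) by simp
  moreover have "fip m (q j) u = 0" if "j < k" for j
    using orth[OF that] by (simp add: fip_def u_def flip: sum_divide_distrib)
  moreover have "w i = of_real s * u i" for i using s by (simp add: u_def)
  ultimately show ?thesis using that by blast
qed

text \<open>A trace count: if every residual of a standard basis vector vanished at its own
  coordinate, the projection onto the span of the \<open>q l\<close> would have unit diagonal, so
  its trace would be \<open>m\<close>; but that trace is \<open>k\<close>.\<close>

lemma exists_unit_orthogonal:
  assumes q: "orthonormal m k q" and k: "k < m"
  obtains u where "fip m u u = 1" "\<And>j. j < k \<Longrightarrow> fip m (q j) u = 0"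
proof -
  define w where "w = (\<lambda>p i. (if i = p then 1 else 0) - (\<Sum>l<k. fip m (q l) (\<lambda>i. if i = p then 1 else 0) * q l i))"
  have orth: "fip m (q j) (w p) = 0" if "j < k" for j p
    unfolding w_def by (rule fip_residual_orthogonal[OF q that])
  have "\<exists>p<m. w p p \<noteq> 0"
  proof (rule ccontr)
    assume "\<not> ?thesis"
    then have "1 = (\<Sum>l<k. cnj (q l p) * q l p)" if "p < m" for p
      using that by (auto simp: w_def fip_def if_distrib cong: if_cong)
    then have "(\<Sum>p<m. 1) = (\<Sum>p<m. \<Sum>l<k. cnj (q l p) * q l p)" by (intro sum.cong) auto
    also have "\<dots> = (\<Sum>l<k. fip m (q l) (q l))" unfolding fip_def by (rule sum.swap)
    also have "\<dots> = (\<Sum>l<k. 1)" using q by (intro sum.cong) (auto simp: orthonormal_def)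
    finally show False using k by simp
  qed
  then obtain p where "\<exists>i<m. w p i \<noteq> 0" by blast
  then show ?thesis using normalise_orthogonal[of m "w p" k q] orth that by metis
qed

text \<open>Holds for rank-deficient \<open>B\<close> too: orthonormal vectors with zero
  coefficients fill the gaps, and \<open>k \<le> m\<close> guarantees that they exist.\<close>

lemma gram_schmidt_exists:
  assumes "k \<le> m"
  shows "\<exists>q c. orthonormal m k q \<and> (\<forall>j<k. \<forall>i<m. B i j = (\<Sum>l<k. q l i * c l j)) \<and>
    (\<forall>j<k. \<forall>l<k. j < l \<longrightarrow> c l j = (0::complex))"
  using assms
proof (induction k)
  case 0
  show ?case by (auto simp: orthonormal_def)
next
  case (Suc k)
  then obtain q c where q: "orthonormal m k q" and B: "\<And>j i. j < k \<Longrightarrow> i < m \<Longrightarrow> B i j = (\<Sum>l<k. q l i * c l j)"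
    and tri: "\<And>j l. j < k \<Longrightarrow> l < k \<Longrightarrow> j < l \<Longrightarrow> c l j = 0" by auto
  define v where "v = (\<lambda>i. B i k)"
  define w where "w = (\<lambda>i. v i - (\<Sum>l<k. fip m (q l) v * q l i))"
  have orth: "fip m (q j) w = 0" if "j < k" for j
    unfolding w_def by (rule fip_residual_orthogonal[OF q that])
  obtain u t where u: "fip m u u = 1" "\<And>j. j < k \<Longrightarrow> fip m (q j) u = 0" "\<And>i. i < m \<Longrightarrow> w i = t * u i"
  proof (cases "\<exists>i<m. w i \<noteq> 0")
    case True
    then show ?thesis using normalise_orthogonal[of m w k q] orth that by metis
  next
    case False
    \<comment> \<open>The new column depends on the earlier ones, so any unit vector orthogonal to
      them serves, with coefficient 0.\<close>
    obtain u where "fip m u u = 1" "\<And>j. j < k \<Longrightarrow> fip m (q j) u = 0"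
      using exists_unit_orthogonal[OF q] Suc.prems by auto
    then show ?thesis using that[of u 0] False by auto
  qed
  have u': "fip m u (q j) = 0" if "j < k" for j
  proof -
    have "fip m u (q j) = cnj (fip m (q j) u)" by (simp add: fip_def mult.commute)
    then show ?thesis using u(2)[OF that] by simp
  qed
  define q' where "q' = q(k := u)"
  define c' where "c' = (\<lambda>l j. if j = k then (if l = k then t else fip m (q l) v) else if l = k then 0 else c l j)"
  have "orthonormal m (Suc k) q'"
    using q u(1,2) u' by (auto simp: orthonormal_def q'_def less_Suc_eq)
  moreover have "B i j = (\<Sum>l<Suc k. q' l i * c' l j)" if "j < Suc k" "i < m" for i j
  proof (cases "j = k")
    case True
    have "(\<Sum>l<Suc k. q' l i * c' l j) = (\<Sum>l<k. fip m (q l) v * q l i) + w i"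
      using True u(3)[OF that(2)] by (simp add: q'_def c'_def mult.commute)
    then show ?thesis using True by (simp add: w_def v_def)
  next
    case False
    then show ?thesis using that B[of j i] by (simp add: q'_def c'_def)
  qed
  moreover have "c' l j = 0" if "j < Suc k" "l < Suc k" "j < l" for j l
    using that tri[of j l] by (auto simp: c'_def less_Suc_eq)
  ultimately show ?case by blast
qed

lemma qr_exists:
  assumes B: "B \<in> carrier_mat m k" and "k \<le> m"
  obtains Q R where "is_qr B Q R"
proof -
  obtain q c where q: "orthonormal m k q" and B': "\<And>j i. j < k \<Longrightarrow> i < m \<Longrightarrow> B $$ (i,j) = (\<Sum>l<k. q l i * c l j)"
    and tri: "\<And>j l. j < k \<Longrightarrow> l < k \<Longrightarrow> j < l \<Longrightarrow> c l j = 0"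
    using gram_schmidt_exists[OF assms(2), of "\<lambda>i j. B $$ (i,j)"] by auto
  define Q where "Q = mat m k (\<lambda>(i,j). q j i)"
  define R where "R = mat k k (\<lambda>(i,j). c i j)"
  have Q: "Q \<in> carrier_mat m k" and R: "R \<in> carrier_mat k k" by (auto simp: Q_def R_def)
  have "cadj Q * Q = 1\<^sub>m k"
  proof (rule eq_matI)
    fix i j assume "i < dim_row (1\<^sub>m k)" "j < dim_col (1\<^sub>m k)"
    then have ij: "i < k" "j < k" by auto
    have "(cadj Q * Q) $$ (i,j) = fip m (q i) (q j)"
      unfolding mult_mat_index[OF cadj_carrier[OF Q] Q ij] fip_def
      using ij Q by (intro sum.cong) (auto simp: Q_def)
    then show "(cadj Q * Q) $$ (i,j) = 1\<^sub>m k $$ (i,j)" using q ij by (simp add: orthonormal_def)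
  qed (use Q in auto)
  moreover have "B = Q * R"
  proof (rule eq_matI)
    fix i j assume "i < dim_row (Q * R)" "j < dim_col (Q * R)"
    then have ij: "i < m" "j < k" using Q R by auto
    show "B $$ (i,j) = (Q * R) $$ (i,j)"
      unfolding mult_mat_index[OF Q R ij] using B' ij by (simp add: Q_def R_def)
  qed (use B Q R in auto)
  moreover have "upper_triangular R" using tri by (auto simp: R_def)
  ultimately have "is_qr B Q R" using B Q R by (simp add: is_qr_def)
  then show ?thesis using that by blast
qed

text \<open>Tychonoff's theorem. It permits matrices to be treated as functions on all index pairs,
  with continuity checked coordinate by coordinate.\<close>

lemma compact_fun_box:
  fixes T :: "'i \<Rightarrow> complex set"
  assumes "\<And>x. compact (T x)"
  shows "compact {f. \<forall>x. f x \<in> T x}"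
proof -
  have "compactin (product_topology (\<lambda>_. euclidean) UNIV) (PiE UNIV T)"
    using assms by (subst compactin_PiE) auto
  then show ?thesis by (simp add: euclidean_product_topology PiE_UNIV_domain Pi_def)
qed

lemma compact_unit_box: "compact {z :: complex. \<bar>Re z\<bar> \<le> 1 \<and> \<bar>Im z\<bar> \<le> 1}"
proof -
  have "compact ((\<lambda>x. of_real (fst x) + \<i> * of_real (snd x)) ` ({-1..1::real} \<times> {-1..1::real}))"
    by (intro compact_continuous_image continuous_intros compact_Times compact_Icc)
  also have "(\<lambda>x. of_real (fst x) + \<i> * of_real (snd x)) ` ({-1..1::real} \<times> {-1..1::real})
      = {z. \<bar>Re z\<bar> \<le> 1 \<and> \<bar>Im z\<bar> \<le> 1}"
  proof (intro equalityI subsetI)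
    fix z assume z: "z \<in> {z. \<bar>Re z\<bar> \<le> 1 \<and> \<bar>Im z\<bar> \<le> 1}"
    then show "z \<in> (\<lambda>x. of_real (fst x) + \<i> * of_real (snd x)) ` ({-1..1::real} \<times> {-1..1::real})"
      by (intro image_eqI[of _ _ "(Re z, Im z)"]) (auto simp: complex_eq_iff)
  qed auto
  finally show ?thesis .
qed

text \<open>For \<open>Q\<close> with orthonormal columns the best \<open>K\<close> is \<open>cadj Q * M\<close>, and by QR it suffices to
  consider such \<open>Q\<close>, which form a compact set.\<close>
lemma minimizer_exists:
  assumes M: "M \<in> carrier_mat m n" and k: "k \<le> m"
  obtains H K where "is_minimizer M k H K"
proof -
  define qm :: "(nat \<times> nat \<Rightarrow> complex) \<Rightarrow> complex mat" where "qm = mat m k"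
  \<comment> \<open>Coordinates outside the \<open>m\<close> by \<open>k\<close> range are pinned to
    0, so every coordinate has a compact range; the entries of a unit column have modulus at most 1
    and hence lie in the box. The Gram equations then cut out a closed subset.\<close>
  define St where "St = {f. \<forall>x. f x \<in> (if fst x < m \<and> snd x < k then {z. \<bar>Re z\<bar> \<le> 1 \<and> \<bar>Im z\<bar> \<le> 1} else {0::complex})} \<inter>
    (\<Inter>a\<in>{..<k}. \<Inter>b\<in>{..<k}. {f. (\<Sum>i<m. cnj (f (i,a)) * f (i,b)) = (if a = b then 1 else 0)})"
  define \<phi> where "\<phi> f = (\<Sum>i<m. \<Sum>j<n. (cmod (M $$ (i,j) - (\<Sum>l<k. f (i,l) * (\<Sum>p<m. cnj (f (p,l)) * M $$ (p,j)))))\<^sup>2)"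
    for f :: "nat \<times> nat \<Rightarrow> complex"
  have qc: "qm f \<in> carrier_mat m k" for f by (simp add: qm_def)
  have \<phi>: "\<phi> f = (frob (M - qm f * (cadj (qm f) * M)))\<^sup>2" for f
  proof -
    have c: "cadj (qm f) * M \<in> carrier_mat k n" by (rule mult_carrier_mat[OF cadj_carrier[OF qc] M])
    have c2: "qm f * (cadj (qm f) * M) \<in> carrier_mat m n" by (rule mult_carrier_mat[OF qc c])
    have g: "(cadj (qm f) * M) $$ (l,j) = (\<Sum>p<m. cnj (f (p,l)) * M $$ (p,j))" if "l < k" "j < n" for l j
      unfolding mult_mat_index[OF cadj_carrier[OF qc] M that] using that by (intro sum.cong) (auto simp: qm_def)
    have e: "(M - qm f * (cadj (qm f) * M)) $$ (i,j)
        = M $$ (i,j) - (\<Sum>l<k. f (i,l) * (\<Sum>p<m. cnj (f (p,l)) * M $$ (p,j)))" if "i < m" "j < n" for i j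
      unfolding minus_mat_index[OF c2 that] mult_mat_index[OF qc c that]
      using that g by (simp add: qm_def)
    show ?thesis unfolding \<phi>_def frob_sq using e carrier_matD[OF minus_carrier_mat[OF c2, of M]] by simp
  qed
  have gram: "(\<Sum>i<m. cnj (f (i,a)) * f (i,b)) = (cadj (qm f) * qm f) $$ (a,b)" if "a < k" "b < k" for f a b
    unfolding mult_mat_index[OF cadj_carrier[OF qc] qc that] using that by (intro sum.cong) (auto simp: qm_def)
  have "compact St"
  proof -
    have "closed {f :: nat \<times> nat \<Rightarrow> complex. (\<Sum>i<m. cnj (f (i,a)) * f (i,b)) = (if a = b then 1 else 0)}" for a b
      by (intro closed_Collect_eq continuous_intros) auto
    then show ?thesis unfolding St_def
      by (intro compact_Int_closed closed_INT ballI compact_fun_box) (auto simp: compact_unit_box)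
  qed
  moreover have "continuous_on St \<phi>" unfolding \<phi>_def
    by (intro continuous_intros continuous_on_subset[OF continuous_on_product_coordinates]) auto
  moreover have reach: "\<exists>f\<in>St. \<phi> f \<le> (frob (M - H * K))\<^sup>2"
    if H: "H \<in> carrier_mat m k" and K: "K \<in> carrier_mat k n" for H K
  proof -
    obtain Q R where "is_qr H Q R" using qr_exists[OF H k] by auto
    then have Q: "Q \<in> carrier_mat m k" "cadj Q * Q = 1\<^sub>m k" and R: "R \<in> carrier_mat k k" and QR: "H = Q * R"
      using H by (auto simp: is_qr_def)
    define f where "f = (\<lambda>x. if fst x < m \<and> snd x < k then Q $$ x else 0)"
    have fQ: "qm f = Q" using Q by (intro eq_matI) (auto simp: qm_def f_def)
    have gr: "(\<Sum>i<m. cnj (f (i,a)) * f (i,b)) = (if a = b then 1 else 0)" if "a < k" "b < k" for a b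
      unfolding gram[OF that] fQ Q(2) using that by simp
    have "cmod (f (i,j)) \<le> 1" if "i < m" "j < k" for i j
    proof -
      have "of_real (\<Sum>i<m. (cmod (f (i,j)))\<^sup>2) = (\<Sum>i<m. cnj (f (i,j)) * f (i,j))"
        unfolding of_real_sum by (intro sum.cong refl) (simp add: complex_norm_square mult.commute del: of_real_power)
      also have "\<dots> = of_real 1" using gr[of j j] that by simp
      finally have "(\<Sum>i<m. (cmod (f (i,j)))\<^sup>2) = 1" using of_real_eq_iff by blast
      moreover have "(cmod (f (i,j)))\<^sup>2 \<le> (\<Sum>i<m. (cmod (f (i,j)))\<^sup>2)"
        using that by (intro member_le_sum) auto
      ultimately show ?thesis by (simp add: power2_le_imp_le[of _ 1])
    qed
    then have "\<bar>Re (f (i,j))\<bar> \<le> 1 \<and> \<bar>Im (f (i,j))\<bar> \<le> 1" if "i < m" "j < k" for i j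
      using that abs_Re_le_cmod abs_Im_le_cmod order_trans by blast
    then have "f \<in> St" using gr by (auto simp: St_def) (auto simp: f_def)
    moreover have "\<phi> f \<le> (frob (M - H * K))\<^sup>2"
    proof -
      let ?G = "cadj Q * M" and ?Y = "R * K"
      have c: "?G \<in> carrier_mat k n" "?Y \<in> carrier_mat k n" "cadj Q \<in> carrier_mat k m" using Q M R K by auto
      have c2: "Q * ?G \<in> carrier_mat m n" "Q * ?Y \<in> carrier_mat m n" "?G - ?Y \<in> carrier_mat k n"
        using Q c by (auto intro: minus_carrier_mat)
      have c3: "Q * (?G - ?Y) \<in> carrier_mat m n" using Q c2 by auto
      have "H * K = Q * ?Y" unfolding QR by (rule assoc_mult_mat[OF Q(1) R K])
      \<comment> \<open>The first summand is orthogonal to the range of \<open>Q\<close>, which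
        contains the second, so dropping the second cannot increase the norm.\<close>
      then have "M - H * K = (M - Q * ?G) + (Q * ?G - Q * ?Y)"
        using mat_diff_split[OF M c2(1,2)] by simp
      also have "Q * ?G - Q * ?Y = Q * (?G - ?Y)"
        by (rule mult_minus_distrib_mat[symmetric, OF Q(1) c(1,2)])
      finally have "(frob (M - H * K))\<^sup>2 = (frob (M - Q * ?G))\<^sup>2 + (frob (Q * (?G - ?Y)))\<^sup>2
          + 2 * Re (ip (M - Q * ?G) (Q * (?G - ?Y)))"
        using frob_add_sq[OF minus_carrier_mat[OF c2(1)] c3] by simp
      moreover have "ip (Q * (?G - ?Y)) (M - Q * ?G) = 0"
      proof -
        have "cadj Q * (M - Q * ?G) = ?G - cadj Q * (Q * ?G)"
          by (rule mult_minus_distrib_mat[OF c(3) M c2(1)])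
        also have "cadj Q * (Q * ?G) = ?G"
          using assoc_mult_mat[OF c(3) Q(1) c(1)] Q(2) left_mult_one_mat[OF c(1)] by simp
        finally have "cadj Q * (M - Q * ?G) = 0\<^sub>m k n" using c by auto
        then have "ip (Q * (?G - ?Y)) (M - Q * ?G) = ip (?G - ?Y) (0\<^sub>m k n)"
          using ip_mult_left[OF Q(1) c2(3) minus_carrier_mat[OF c2(1)]] by simp
        also have "\<dots> = 0" unfolding ip_def using carrier_matD[OF c2(3)] by (simp del: index_minus_mat)
        finally show ?thesis .
      qed
      ultimately show ?thesis
        using ip_cnj[OF minus_carrier_mat[OF c2(1)] c3] \<phi>[of f] fQ by simp
    qed
    ultimately show ?thesis by blast
  qed
  moreover have "St \<noteq> {}" using reach[of "0\<^sub>m m k" "0\<^sub>m k n"] by auto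
  ultimately obtain f where f: "f \<in> St" "\<And>g. g \<in> St \<Longrightarrow> \<phi> f \<le> \<phi> g"
    using continuous_attains_inf[of St \<phi>] by blast
  have "is_minimizer M k (qm f) (cadj (qm f) * M)"
    unfolding is_minimizer_def
  proof (intro conjI allI impI)
    show "qm f \<in> carrier_mat (dim_row M) k" "cadj (qm f) * M \<in> carrier_mat k (dim_col M)"
      using qc[of f] mult_carrier_mat[OF cadj_carrier[OF qc] M, of f] M by auto
    fix H K :: "complex mat" assume "H \<in> carrier_mat (dim_row M) k" "K \<in> carrier_mat k (dim_col M)"
    then obtain g where "g \<in> St" "\<phi> g \<le> (frob (M - H * K))\<^sup>2" using reach[of H K] M by auto
    then show "frob (M - qm f * (cadj (qm f) * M)) \<le> frob (M - H * K)"
      unfolding frob_le_iff using f(2)[of g] \<phi>[of f] by linarith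
  qed
  then show ?thesis using that by blast
qed

section \<open>The nondeterministic iteration\<close>

text \<open>Safety and progress together: the invariant has to guarantee that each step has an
  outcome, since a single empty step could make the whole set of outputs empty.\<close>

lemma foldl_bind_invariant:
  assumes "S \<noteq> {}" "\<And>x. x \<in> S \<Longrightarrow> I a x" "a \<le> b"
    and step: "\<And>k x. a \<le> k \<Longrightarrow> k < b \<Longrightarrow> I k x \<Longrightarrow> f k x \<noteq> {} \<and> (\<forall>y\<in>f k x. I (Suc k) y)"
  shows "foldl (\<lambda>S k. Set.bind S (f k)) S [a..<b] \<noteq> {} \<and>
    (\<forall>y\<in>foldl (\<lambda>S k. Set.bind S (f k)) S [a..<b]. I b y)"
  using assms(3,4)
proof (induction b rule: dec_induct)
  case base
  then show ?case using assms(1,2) by simp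
next
  case (step b)
  let ?F = "foldl (\<lambda>S k. Set.bind S (f k)) S [a..<b]"
  have IH: "?F \<noteq> {}" "\<And>y. y \<in> ?F \<Longrightarrow> I b y" using step by auto
  have st: "f b y \<noteq> {} \<and> (\<forall>z\<in>f b y. I (Suc b) z)" if "y \<in> ?F" for y
    using step.prems[of b y] IH(2)[OF that] step.hyps by simp
  obtain y where y: "y \<in> ?F" using IH(1) by blast
  then obtain z where "z \<in> f b y" using st by blast
  then have "z \<in> Set.bind ?F (f b)" using y by (auto simp: Set.bind_def)
  moreover have "\<forall>z\<in>Set.bind ?F (f b). I (Suc b) z" using st by (auto simp: Set.bind_def)
  moreover have "foldl (\<lambda>S k. Set.bind S (f k)) S [a..<Suc b] = Set.bind ?F (f b)" using step.hyps by simp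
  ultimately show ?case by (metis empty_iff)
qed

text \<open>Simulation of one nondeterministic loop by another. The encoding may depend on the step
  because the list of factors grows by one with every split.\<close>

lemma foldl_bind_image:
  assumes "a \<le> b" and step: "\<And>k x. a \<le> k \<Longrightarrow> k < b \<Longrightarrow> f k (e k x) = e (Suc k) ` g k x"
  shows "foldl (\<lambda>S k. Set.bind S (f k)) (e a ` S) [a..<b] = e b ` foldl (\<lambda>S k. Set.bind S (g k)) S [a..<b]"
  using assms
proof (induction b rule: dec_induct)
  case (step b)
  let ?F = "foldl (\<lambda>S k. Set.bind S (g k)) S [a..<b]"
  have "foldl (\<lambda>S k. Set.bind S (f k)) (e a ` S) [a..<b] = e b ` ?F" using step by auto
  moreover have "Set.bind (e b ` ?F) (f b) = e (Suc b) ` Set.bind ?F (g b)"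
    using step.prems[of b] step.hyps by (auto simp: Set.bind_def)
  ultimately show ?case using step.hyps by simp
qed simp

definition sweep_all :: "(nat \<Rightarrow> nat \<Rightarrow> 'x \<Rightarrow> 'x set) \<Rightarrow> nat \<Rightarrow> 'x \<Rightarrow> 'x set" where
  "sweep_all O1 J X = foldl (\<lambda>S k. Set.bind S (O1 J k)) {X} [1..<Suc J]"

definition sweep_split :: "(nat \<Rightarrow> nat \<Rightarrow> 'x \<Rightarrow> 'x set) \<Rightarrow> (nat \<Rightarrow> 'x \<Rightarrow> 'x set) \<Rightarrow> nat \<Rightarrow> 'x \<Rightarrow> 'x set" where
  "sweep_split O1 T1 J X = Set.bind (sweep_all O1 J X) (T1 J)"

text \<open>\<open>J\<close> counts the completed splits, so step \<open>J\<close> here is the pass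
  numbered \<open>Suc J\<close> of \<open>butterfly\<close>, and the sweep before the first split is
  empty.\<close>

definition process :: "(nat \<Rightarrow> nat \<Rightarrow> 'x \<Rightarrow> 'x set) \<Rightarrow> (nat \<Rightarrow> 'x \<Rightarrow> 'x set) \<Rightarrow> nat \<Rightarrow> 'x \<Rightarrow> 'x set" where
  "process O1 T1 N X = foldl (\<lambda>S J. Set.bind S (sweep_split O1 T1 J)) {X} [0..<N]"

context cuts
begin

text \<open>Contract between the error analysis and the concrete QR steps, as
  \<open>split_ok\<close> is for the two-factor steps. Stated for arbitrary labels, both can be met
  by the forward algorithm and, in the mirrored levels, by the backward one.\<close>

definition ortho_ok :: "(nat \<Rightarrow> nat \<Rightarrow> (nat \<Rightarrow> complex mat) \<Rightarrow> (nat \<Rightarrow> complex mat) set) \<Rightarrow> bool" where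
  "ortho_ok O1 \<longleftrightarrow> (\<forall>J k X. 1 \<le> k \<and> k \<le> J \<and> J < L \<and> X k \<in> Sg (k - 1) k \<and>
     X (Suc k) \<in> Sg k (if k < J then Suc k else L) \<longrightarrow>
     O1 J k X \<noteq> {} \<and> (\<forall>Z\<in>O1 J k X. \<exists>Q D. Z = X(k := Q, Suc k := D * X (Suc k)) \<and>
       Q \<in> Sg (k - 1) k \<and> colorth k Q \<and> D \<in> Sg k k \<and> X k = Q * D))"

definition split_ok :: "(nat \<Rightarrow> (nat \<Rightarrow> complex mat) \<Rightarrow> (nat \<Rightarrow> complex mat) set) \<Rightarrow> bool" where
  "split_ok T1 \<longleftrightarrow> (\<forall>J X. Suc J < L \<and> X (Suc J) \<in> carrier_mat (n J) (n L) \<longrightarrow>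
     T1 J X \<noteq> {} \<and> (\<forall>Z\<in>T1 J X. \<exists>H K. Z = X(Suc J := H, Suc (Suc J) := K) \<and>
       H \<in> Sg J (Suc J) \<and> K \<in> Sg (Suc J) L \<and>
       (\<forall>H' K'. H' \<in> Sg J (Suc J) \<longrightarrow> K' \<in> Sg (Suc J) L \<longrightarrow>
          frob (X (Suc J) - H * K) \<le> frob (X (Suc J) - H' * K'))))"

lemma sweep_all_after_sweep:
  assumes A: "A \<in> carrier_mat (n 0) (n L)" and O1: "ortho_ok O1" and J: "1 \<le> J" "J < L"
    and X: "after_split A J X"
  shows "sweep_all O1 J X \<noteq> {} \<and> (\<forall>Z\<in>sweep_all O1 J X. after_sweep A J Z)"
proof -
  have Xi: "\<And>i. 1 \<le> i \<Longrightarrow> i \<le> J \<Longrightarrow> X i \<in> Sg (i - 1) i" and XJ: "X (Suc J) \<in> Sg J L"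
    and Xc: "\<And>i. 1 \<le> i \<Longrightarrow> i < J \<Longrightarrow> colorth i (X i)"
    using X by (auto simp: after_split_def)
  \<comment> \<open>The transfer matrix stays unitary while only factors before \<open>X J\<close>
    have been decomposed. \<open>X J\<close> itself need not be orthonormal, so the final step
    trades unitarity for \<open>after_sweep\<close>.\<close>
  define I where "I k Z \<longleftrightarrow> (\<exists>D. swept (k - 1) X Z D \<and> (k \<le> J \<longrightarrow> unitary_mat (k - 1) D)) \<and>
    (k = Suc J \<longrightarrow> after_sweep A J Z)" for k Z
  have "sweep_all O1 J X \<noteq> {} \<and> (\<forall>Z\<in>sweep_all O1 J X. I (Suc J) Z)"
    unfolding sweep_all_def
  proof (rule foldl_bind_invariant)
    show "I 1 Z" if "Z \<in> {X}" for Z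
      using that J swept_0[of X "n 1"] Xi[of 1] unitary_mat_one[of 0] by (auto simp: I_def)
    fix k Z assume k: "1 \<le> k" "k < Suc J" and "I k Z"
    then obtain D where sw: "swept (k - 1) X Z D" and un: "unitary_mat (k - 1) D" by (auto simp: I_def)
    have D: "D \<in> Sg (k - 1) (k - 1)" using un by (simp add: unitary_mat_def)
    have Zk: "Z k \<in> Sg (k - 1) k"
      using sw k Sg_mult[OF D Xi[of k]] J by (simp add: swept_def)
    have Zk1: "Z (Suc k) = X (Suc k)" using sw k by (auto simp: swept_def)
    have "X (Suc k) \<in> Sg k (if k < J then Suc k else L)"
    proof (cases "k < J")
      case True
      then show ?thesis using Xi[of "Suc k"] by simp
    next
      case False
      then show ?thesis using XJ k by (simp add: less_Suc_eq)
    qed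
    then have ne: "O1 J k Z \<noteq> {}" and sp: "\<And>Y. Y \<in> O1 J k Z \<Longrightarrow> \<exists>Q D. Y = Z(k := Q, Suc k := D * Z (Suc k)) \<and>
       Q \<in> Sg (k - 1) k \<and> colorth k Q \<and> D \<in> Sg k k \<and> Z k = Q * D"
      using O1[unfolded ortho_ok_def, rule_format, of k J Z] k J Zk Zk1 by auto
    have "I (Suc k) Y" if YO: "Y \<in> O1 J k Z" for Y
    proof -
      obtain Q R where Y: "Y = Z(k := Q, Suc k := R * Z (Suc k))" and Q: "Q \<in> Sg (k - 1) k" "colorth k Q"
        and R: "R \<in> Sg k k" and QR: "Z k = Q * R" using sp[OF YO] by blast
      have k1: "Suc (k - 1) = k" using k by simp
      have sw2: "swept k X Y R" and un2: "colorth k (X k) \<Longrightarrow> unitary_mat k R"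
        using swept_step[of "k - 1" X Z D Q R, unfolded k1, OF sw Xi[OF k(1)] _ Q R QR] k J un
        by (auto simp: Y)
      have "unitary_mat k R" if "Suc k \<le> J" using un2 Xc[of k] k that by auto
      moreover have "after_sweep A J Y" if "k = J"
        using sweep_end[OF A J(1) _ X _ _ sw2[unfolded that], of Z D] sw un that J Y by auto
      ultimately show ?thesis using sw2 by (auto simp: I_def)
    qed
    then show "O1 J k Z \<noteq> {} \<and> (\<forall>Y\<in>O1 J k Z. I (Suc k) Y)" using ne by blast
  qed (use J in auto)
  then show ?thesis by (auto simp: I_def)
qed

lemma process_after_split:
  assumes A: "A \<in> carrier_mat (n 0) (n L)" and O1: "ortho_ok O1" and T1: "split_ok T1" and L: "2 \<le> L"
  shows "process O1 T1 (L - 1) (\<lambda>_. A) \<noteq> {} \<and>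
    (\<forall>X\<in>process O1 T1 (L - 1) (\<lambda>_. A). after_split A (L - 1) X)"
proof -
  \<comment> \<open>Before any split the sole factor is \<open>A\<close>, found at index 1; the
    constant assignment supplies a default at the other indices.\<close>
  define I where "I J X \<longleftrightarrow> (if J = 0 then X = (\<lambda>_. A) else after_split A J X)" for J :: nat and X
  have "process O1 T1 (L - 1) (\<lambda>_. A) \<noteq> {} \<and> (\<forall>X\<in>process O1 T1 (L - 1) (\<lambda>_. A). I (L - 1) X)"
    unfolding process_def
  proof (rule foldl_bind_invariant)
    show "I 0 X" if "X \<in> {\<lambda>_. A}" for X using that by (simp add: I_def)
    fix J X assume J: "J < L - 1" and I: "I J X"
    have sw: "sweep_all O1 J X \<noteq> {} \<and> (\<forall>Z\<in>sweep_all O1 J X. if J = 0 then Z = (\<lambda>_. A) else after_sweep A J Z)"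
    proof (cases "J = 0")
      case True
      then show ?thesis using I by (simp add: I_def sweep_all_def)
    next
      case False
      then show ?thesis using sweep_all_after_sweep[OF A O1, of J X] I J by (simp add: I_def)
    qed
    have sp: "T1 J Z \<noteq> {} \<and> (\<forall>Y\<in>T1 J Z. I (Suc J) Y)" if "Z \<in> sweep_all O1 J X" for Z
    proof -
      have Z: "if J = 0 then Z = (\<lambda>_. A) else after_sweep A J Z" using sw that by blast
      then have "Z (Suc J) \<in> carrier_mat (n J) (n L)"
        using A by (auto simp: after_sweep_def split: if_splits)
      then have ne: "T1 J Z \<noteq> {}" and T: "\<And>Y. Y \<in> T1 J Z \<Longrightarrow> \<exists>H K. Y = Z(Suc J := H, Suc (Suc J) := K) \<and>
          H \<in> Sg J (Suc J) \<and> K \<in> Sg (Suc J) L \<and>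
          (\<forall>H' K'. H' \<in> Sg J (Suc J) \<longrightarrow> K' \<in> Sg (Suc J) L \<longrightarrow>
          frob (Z (Suc J) - H * K) \<le> frob (Z (Suc J) - H' * K'))"
        using T1[unfolded split_ok_def, rule_format, of J Z] J by auto
      have "I (Suc J) Y" if YT: "Y \<in> T1 J Z" for Y
      proof -
        obtain H K where Y: "Y = Z(Suc J := H, Suc (Suc J) := K)" and H: "H \<in> Sg J (Suc J)"
          and K: "K \<in> Sg (Suc J) L" and min: "\<And>H' K'. H' \<in> Sg J (Suc J) \<Longrightarrow> K' \<in> Sg (Suc J) L
            \<Longrightarrow> frob (Z (Suc J) - H * K) \<le> frob (Z (Suc J) - H' * K')"
          using T[OF YT] by blast
        show ?thesis
        proof (cases "J = 0")
          case True
          then have "after_split A 1 Y"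
            using Z Y H K min L by (intro first_split[OF A]) (auto simp: numeral_2_eq_2)
          then show ?thesis using True by (simp add: I_def)
        next
          case False
          then have "after_sweep A J Z" using Z by simp
          then have "after_split A (Suc J) (Z(Suc J := H, Suc (Suc J) := K))"
            using J H K min by (intro split_step[OF A]) auto
          then show ?thesis using Y by (simp add: I_def)
        qed
      qed
      then show ?thesis using ne by blast
    qed
    obtain Z where Z: "Z \<in> sweep_all O1 J X" using sw by blast
    then obtain Y where "Y \<in> T1 J Z" using sp by blast
    then have "Y \<in> sweep_split O1 T1 J X" using Z by (auto simp: sweep_split_def Set.bind_def)
    moreover have "\<forall>Y\<in>sweep_split O1 T1 J X. I (Suc J) Y"
      using sp by (auto simp: sweep_split_def Set.bind_def)
    ultimately show "sweep_split O1 T1 J X \<noteq> {} \<and> (\<forall>Y\<in>sweep_split O1 T1 J X. I (Suc J) Y)" by blast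
  qed (use L in auto)
  then show ?thesis using L by (simp add: I_def)
qed

section \<open>Reversal of the levels\<close>

lemma cuts_mirror: "cuts L (\<lambda>l. n (L - l)) (\<lambda>s l. V (L - s) (L - l)) (\<lambda>t l. U (L - t) (L - l))"
proof
  fix s t l l' i j
  assume "s \<le> t" "t \<le> l" "t \<le> l'" "l \<le> L" "l' \<le> L" "i < n (L - l)" "j < n (L - l')"
    "V (L - t) (L - l) i = V (L - t) (L - l') j"
  then show "V (L - s) (L - l) i = V (L - s) (L - l') j"
    using V_mono[of "L - t" "L - s" "L - l" "L - l'" i j] by auto
next
  fix t u l l' i j
  assume "t \<le> u" "u \<le> L" "l \<le> t" "l' \<le> t" "i < n (L - l)" "j < n (L - l')"
    "U (L - t) (L - l) i = U (L - t) (L - l') j"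
  then show "U (L - u) (L - l) i = U (L - u) (L - l') j"
    using U_mono[of "L - u" "L - t" "L - l" "L - l'" i j] by auto
qed

end

text \<open>Transposing all factors and reversing the levels exchanges \<open>U\<close> and \<open>V\<close>; this reduces the
  splitting order \<open>(L-1,\<dots>,1)\<close> to the order \<open>(1,\<dots>,L-1)\<close>. Architectures themselves are not
  closed under transposition: it would require \<open>a\<^sub>2\<close> to divide \<open>a\<^sub>1\<close>.\<close>
locale mirrored_cuts = cuts +
  fixes n' :: "nat \<Rightarrow> nat" and U' V' :: "nat \<Rightarrow> nat \<Rightarrow> nat \<Rightarrow> nat"
  assumes n': "n' = (\<lambda>l. n (L - l))" and U': "U' = (\<lambda>s l. V (L - s) (L - l))"
    and V': "V' = (\<lambda>t l. U (L - t) (L - l))"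
begin

sublocale mir: cuts L n' U' V'
  unfolding n' U' V' by (rule cuts_mirror)

lemma mir_Sg: "X \<in> mir.Sg s t \<longleftrightarrow> transpose_mat X \<in> Sg (L - t) (L - s)"
proof
  assume "X \<in> mir.Sg s t"
  then show "transpose_mat X \<in> Sg (L - t) (L - s)"
    using mir.Sg_carrier[of X s t] mir.SgD[of X s t] by (intro SgI) (auto simp: n' U' V')
next
  assume X: "transpose_mat X \<in> Sg (L - t) (L - s)"
  then have c: "X \<in> carrier_mat (n' s) (n' t)"
    using Sg_carrier[OF X] unfolding transpose_carrier_mat n' by blast
  show "X \<in> mir.Sg s t"
  proof (rule mir.SgI[OF c])
    fix i j assume "i < n' s" "j < n' t" "X $$ (i,j) \<noteq> 0"
    then show "U' s s i = U' s t j \<and> V' t s i = V' t t j"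
      using SgD[OF X, of j i] c unfolding n' U' V' by auto
  qed
qed

lemma mir_Sg_transpose: "transpose_mat X \<in> mir.Sg s t \<longleftrightarrow> X \<in> Sg (L - t) (L - s)"
  unfolding mir_Sg transpose_transpose ..

text \<open>Transposition exchanges the two factors of a competitor, so the mirrored cut
  \<open>k\<close> is the original cut \<open>L - k\<close>.\<close>

lemma mir_Ecut:
  assumes A: "A \<in> carrier_mat (n 0) (n L)" and k: "k \<le> L"
  shows "mir.Ecut (transpose_mat A) k = Ecut A (L - k)"
proof -
  have fr: "frob (transpose_mat A - transpose_mat Y * transpose_mat X) = frob (A - X * Y)"
    if "X \<in> Sg 0 (L - k)" "Y \<in> Sg (L - k) L" for X Y
  proof -
    have c: "X \<in> carrier_mat (n 0) (n (L - k))" "Y \<in> carrier_mat (n (L - k)) (n L)" using that by auto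
    have "transpose_mat A - transpose_mat Y * transpose_mat X = transpose_mat (A - X * Y)"
      unfolding transpose_minus[OF A mult_carrier_mat[OF c]] transpose_mult[OF c] ..
    then show ?thesis by (simp add: frob_transpose)
  qed
  have "{frob (transpose_mat A - X * Y) |X Y. X \<in> mir.Sg 0 k \<and> Y \<in> mir.Sg k L}
      = {frob (A - X * Y) |X Y. X \<in> Sg 0 (L - k) \<and> Y \<in> Sg (L - k) L}" (is "?l = ?r")
  proof (intro equalityI subsetI)
    fix z assume "z \<in> ?l"
    then obtain X Y where XY: "z = frob (transpose_mat A - X * Y)" "X \<in> mir.Sg 0 k" "Y \<in> mir.Sg k L" by blast
    then have t: "transpose_mat Y \<in> Sg 0 (L - k)" "transpose_mat X \<in> Sg (L - k) L"
      unfolding mir_Sg by simp_all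
    then have "z = frob (A - transpose_mat Y * transpose_mat X)" using fr[OF t] XY(1) by simp
    then show "z \<in> ?r" using t by blast
  next
    fix z assume "z \<in> ?r"
    then obtain X Y where XY: "z = frob (A - X * Y)" "X \<in> Sg 0 (L - k)" "Y \<in> Sg (L - k) L" by blast
    then have "transpose_mat Y \<in> mir.Sg 0 k" "transpose_mat X \<in> mir.Sg k L"
      unfolding mir_Sg_transpose by simp_all
    moreover have "z = frob (transpose_mat A - transpose_mat Y * transpose_mat X)"
      using fr[OF XY(2,3)] XY(1) by simp
    ultimately show "z \<in> ?l" by blast
  qed
  then show ?thesis unfolding mir.Ecut_def Ecut_def by (rule arg_cong)
qed

end

section \<open>Supports of chainable architectures\<close>

lemma pattern_collapse: "\<pi> = (pa \<pi>, pb \<pi>, pc \<pi>, pd \<pi>)"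
  by (cases \<pi>) (simp add: pa_def pb_def pc_def pd_def)

lemma pattern_sel [simp]: "pa (a,b,c,d) = a" "pb (a,b,c,d) = b" "pc (a,b,c,d) = c" "pd (a,b,c,d) = d"
  by (simp_all add: pa_def pb_def pc_def pd_def)

lemma S_pat_carrier: "S_pat \<pi> \<in> carrier_mat (nrows \<pi>) (ncols \<pi>)"
  by (simp add: S_pat_def kron_def ones_mat_def nrows_def ncols_def)

text \<open>A row index has three Kronecker digits: the quotient by \<open>b * d\<close>, a middle
  digit, and the remainder modulo \<open>d\<close>. The two identity matrices compare the outer
  digits and the block of ones leaves the middle digit free. These outer digits become the labels
  \<open>UU\<close> and \<open>VV\<close>.\<close>

lemma S_pat_index:
  assumes i: "i < nrows \<pi>" and j: "j < ncols \<pi>"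
  shows "S_pat \<pi> $$ (i,j) = (if i div (pb \<pi> * pd \<pi>) = j div (pc \<pi> * pd \<pi>) \<and> i mod pd \<pi> = j mod pd \<pi> then 1 else 0)"
proof -
  define a b c d where "a = pa \<pi>" "b = pb \<pi>" "c = pc \<pi>" "d = pd \<pi>"
  note defs = this
  have ij: "i < a * b * d" "j < a * c * d" using i j by (auto simp: nrows_def ncols_def defs)
  then have d: "d > 0" "b > 0" "c > 0" by (auto intro!: Nat.gr0I)
  have 1: "i div d < a * b" "j div d < a * c" using ij d by (auto simp: less_mult_imp_div_less)
  then have 2: "i div d div b < a" "j div d div c < a" using d by (auto simp: less_mult_imp_div_less)
  have e: "i div d div b = i div (b * d)" "j div d div c = j div (c * d)"
    by (simp_all add: div_mult2_eq[symmetric] mult.commute)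
  have "S_pat \<pi> $$ (i,j) = (kron (1\<^sub>m a) (ones_mat b c)) $$ (i div d, j div d) * 1\<^sub>m d $$ (i mod d, j mod d)"
    using ij by (simp add: S_pat_def defs kron_def ones_mat_def)
  also have "kron (1\<^sub>m a) (ones_mat b c) $$ (i div d, j div d) = (if i div d div b = j div d div c then 1 else 0)"
    using 1 2 d by (simp add: kron_def ones_mat_def)
  finally show ?thesis using d unfolding e by (simp add: defs)
qed

lemma S_pat_col_nonzero:
  assumes "is_pattern \<pi>" and j: "j < ncols \<pi>"
  obtains i where "i < nrows \<pi>" "S_pat \<pi> $$ (i,j) \<noteq> 0"
proof -
  define a b c d where "a = pa \<pi>" "b = pb \<pi>" "c = pc \<pi>" "d = pd \<pi>"
  note defs = this
  have pos: "b > 0" "d > 0" using assms by (auto simp: is_pattern_def defs)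
  define u where "u = j div (c * d)"
  \<comment> \<open>The row with the same outer digits as column \<open>j\<close> and middle digit
    0.\<close>
  define i where "i = u * (b * d) + j mod d"
  have lt: "j mod d < b * d" using pos by (metis mod_less_divisor less_le_trans mult.commute mult_le_mono1 mult_1 Suc_leI One_nat_def)
  have "u < a" using j by (simp add: ncols_def defs u_def less_mult_imp_div_less mult.assoc)
  then have "Suc u * (b * d) \<le> a * (b * d)" by (intro mult_le_mono1) simp
  then have i: "i < nrows \<pi>" using lt by (simp add: i_def nrows_def defs mult.assoc)
  have "i div (b * d) = u" using lt pos by (simp add: i_def)
  moreover have "i mod d = j mod d" by (simp add: i_def mult.assoc[symmetric])
  ultimately have "S_pat \<pi> $$ (i,j) \<noteq> 0" using S_pat_index[OF i j] by (simp add: defs u_def)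
  then show ?thesis using that i by blast
qed

lemma S_pat_row_nonzero:
  assumes "is_pattern \<pi>" and i: "i < nrows \<pi>"
  obtains j where "j < ncols \<pi>" "S_pat \<pi> $$ (i,j) \<noteq> 0"
proof -
  \<comment> \<open>Exchanging \<open>b\<close> and \<open>c\<close> transposes the support matrix,
    which reduces rows to columns.\<close>
  let ?\<rho> = "(pa \<pi>, pc \<pi>, pb \<pi>, pd \<pi>)"
  have r: "is_pattern ?\<rho>" "nrows ?\<rho> = ncols \<pi>" "ncols ?\<rho> = nrows \<pi>"
    using assms by (auto simp: is_pattern_def nrows_def ncols_def)
  obtain j where j: "j < ncols \<pi>" "S_pat ?\<rho> $$ (j,i) \<noteq> 0"
    using S_pat_col_nonzero[OF r(1), of i] r i by auto
  then have "S_pat \<pi> $$ (i,j) \<noteq> 0"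
    using S_pat_index[of j ?\<rho> i] S_pat_index[of i \<pi> j] i r by (auto split: if_splits)
  then show ?thesis using that j by blast
qed

section \<open>Levels and labels of an architecture\<close>

locale arch =
  fixes \<beta> :: "pattern list"
  assumes arch: "architecture \<beta>" and chain: "chainable_arch \<beta>" and nonred: "\<not> redundant_arch \<beta>"
    and depth: "length \<beta> \<ge> 2"
begin

definition nn :: "nat \<Rightarrow> nat" where
  "nn l = (if l = 0 then nrows (pat \<beta> 1) else ncols (pat \<beta> l))"
text \<open>The value at the last level prolongs the divisibility chain of the \<open>a\<close>
  parameters and makes \<open>UU\<close> the identity label there. In the same way \<open>dd\<close>
  is set to \<open>nn 0\<close> at level 0, where \<open>VV\<close> then separates all valid
  indices.\<close>

definition aa :: "nat \<Rightarrow> nat" where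
  "aa s = (if s < length \<beta> then pa (pat \<beta> (Suc s)) else nn (length \<beta>))"
definition dd :: "nat \<Rightarrow> nat" where
  "dd t = (if t = 0 then nn 0 else pd (pat \<beta> t))"
definition UU :: "nat \<Rightarrow> nat \<Rightarrow> nat \<Rightarrow> nat" where
  "UU s l i = i div (nn l div aa s)"
definition VV :: "nat \<Rightarrow> nat \<Rightarrow> nat \<Rightarrow> nat" where
  "VV t l i = i mod dd t"

lemma pat_pos: "1 \<le> l \<Longrightarrow> l \<le> length \<beta> \<Longrightarrow> is_pattern (pat \<beta> l)"
  using arch by (auto simp: architecture_def pat_def)

lemma chain_step:
  assumes "1 \<le> l" "l < length \<beta>"
  shows "pa (pat \<beta> (Suc l)) dvd pa (pat \<beta> l) * pc (pat \<beta> l)"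
    "pa (pat \<beta> l) dvd pa (pat \<beta> (Suc l))" "pd (pat \<beta> (Suc l)) dvd pd (pat \<beta> l)"
    "ncols (pat \<beta> l) = nrows (pat \<beta> (Suc l))"
    "r_pat (pat \<beta> l) (pat \<beta> (Suc l)) < pb (pat \<beta> l)" "r_pat (pat \<beta> l) (pat \<beta> (Suc l)) < pc (pat \<beta> (Suc l))"
  using assms arch chain nonred
  by (auto simp: architecture_def chainable_arch_def chainable_def redundant_arch_def redundant_pair_def not_le)

lemma nn_rows: "s < length \<beta> \<Longrightarrow> nn s = nrows (pat \<beta> (Suc s))"
  using chain_step(4)[of s] by (cases s) (auto simp: nn_def)

lemma nn_cols: "1 \<le> t \<Longrightarrow> nn t = ncols (pat \<beta> t)"
  by (simp add: nn_def)

lemma nn_pos: "l \<le> length \<beta> \<Longrightarrow> nn l > 0"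
  using pat_pos[of 1] pat_pos[of l] depth by (auto simp: nn_def nrows_def ncols_def is_pattern_def)

lemma aa_step: "s < length \<beta> \<Longrightarrow> aa s dvd aa (Suc s)"
  using chain_step(2)[of "Suc s"] by (cases "Suc s < length \<beta>") (auto simp: aa_def nn_def ncols_def not_less intro: dvd_mult2 dest!: le_antisym[OF Suc_leI])

lemma aa_dvd: "s \<le> t \<Longrightarrow> t \<le> length \<beta> \<Longrightarrow> aa s dvd aa t"
proof (induction t rule: dec_induct)
  case (step t)
  then have "aa s dvd aa t" "aa t dvd aa (Suc t)" using aa_step[of t] by auto
  then show ?case by (rule dvd_trans)
qed simp

lemma dd_step: "t < length \<beta> \<Longrightarrow> dd (Suc t) dvd dd t"
  using chain_step(3)[of t] by (cases t) (auto simp: dd_def nn_def nrows_def)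

lemma dd_dvd: "t \<le> u \<Longrightarrow> u \<le> length \<beta> \<Longrightarrow> dd u dvd dd t"
proof (induction u rule: dec_induct)
  case (step u)
  then have "dd (Suc u) dvd dd u" "dd u dvd dd t" using dd_step[of u] by auto
  then show ?case by (rule dvd_trans)
qed simp

lemma aa_dvd_nn: "s \<le> l \<Longrightarrow> l \<le> length \<beta> \<Longrightarrow> aa s dvd nn l"
proof -
  assume l: "s \<le> l" "l \<le> length \<beta>"
  have "aa l dvd nn l" using l nn_rows[of l] by (auto simp: aa_def nrows_def)
  then show ?thesis using aa_dvd[OF l] dvd_trans by blast
qed

lemma aa_pos: "s \<le> length \<beta> \<Longrightarrow> aa s > 0"
  using pat_pos[of "Suc s"] nn_pos[of "length \<beta>"] by (auto simp: aa_def is_pattern_def)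

text \<open>Both monotonicity laws come from the divisibility chains: dividing the finer quotient by
  \<open>aa t div aa s\<close> gives the coarser one, and a remainder modulo \<open>dd t\<close>
  determines the remainder modulo its divisor \<open>dd u\<close>.\<close>

sublocale cuts "length \<beta>" nn UU VV
proof
  fix s t l l' i j
  assume a: "s \<le> t" "t \<le> l" "t \<le> l'" "l \<le> length \<beta>" "l' \<le> length \<beta>" "UU t l i = UU t l' j"
  have "UU s m x = UU t m x div (aa t div aa s)" if m: "t \<le> m" "m \<le> length \<beta>" for m x
  proof -
    have "nn m div aa s = (nn m div aa t) * (aa t div aa s)"
      using aa_dvd_nn[OF m] aa_dvd[OF a(1), OF order_trans[OF m]] by (metis dvd_mult_div_cancel div_mult_swap mult.commute)
    then show ?thesis by (simp add: UU_def div_mult2_eq)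
  qed
  then show "UU s l i = UU s l' j" using a by metis
next
  fix t u l l' i j
  assume "t \<le> u" "u \<le> length \<beta>" "VV t l i = VV t l' j"
  then show "VV u l i = VV u l' j" unfolding VV_def by (metis dd_dvd mod_mod_cancel)
qed

text \<open>The product telescopes: the inner parameters cancel because each division by a
  \<open>d\<close> parameter is exact, and only the two end patterns remain.\<close>

lemma pint_closed:
  assumes "1 \<le> p" "p \<le> q" "q \<le> length \<beta>"
  shows "pint \<beta> p q = (pa (pat \<beta> p), pb (pat \<beta> p) * pd (pat \<beta> p) div pd (pat \<beta> q),
     pa (pat \<beta> q) * pc (pat \<beta> q) div pa (pat \<beta> p), pd (pat \<beta> q))"
  using assms(2,3)
proof (induction q rule: dec_induct)
  case base
  have "pint \<beta> p p = pat \<beta> p" by (simp add: pint_def)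
  then show ?case using pat_pos[of p] assms pattern_collapse[of "pat \<beta> p"] by (simp add: is_pattern_def)
next
  case (step q)
  have "dd q dvd dd p" using dd_dvd[of p q] step by simp
  then have d: "pd (pat \<beta> q) dvd pb (pat \<beta> p) * pd (pat \<beta> p)" using assms step by (simp add: dd_def)
  have "pint \<beta> p (Suc q) = pstar (pint \<beta> p q) (pat \<beta> (Suc q))"
    using step.hyps by (simp add: pint_def)
  then show ?case using step d by (simp add: pstar_def)
qed

lemma pint_level:
  assumes "s < t" "t \<le> length \<beta>"
  defines "\<pi> \<equiv> pint \<beta> (Suc s) t"
  shows "pb \<pi> * pd \<pi> = nn s div aa s" "pc \<pi> * pd \<pi> = nn t div aa s" "pd \<pi> = dd t"
    "pa \<pi> = aa s" "nrows \<pi> = nn s" "ncols \<pi> = nn t" "is_pattern \<pi>"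
proof -
  let ?p = "pat \<beta> (Suc s)" and ?q = "pat \<beta> t"
  have pp: "is_pattern ?p" "is_pattern ?q" using pat_pos assms by auto
  have \<pi>: "\<pi> = (pa ?p, pb ?p * pd ?p div pd ?q, pa ?q * pc ?q div pa ?p, pd ?q)"
    unfolding \<pi>_def using assms by (intro pint_closed) auto
  have s: "nn s = pa ?p * pb ?p * pd ?p" using nn_rows[of s] assms by (simp add: nrows_def)
  have t: "nn t = pa ?q * pc ?q * pd ?q" using nn_cols[of t] assms by (simp add: ncols_def)
  have a: "aa s = pa ?p" using assms by (simp add: aa_def)
  have "dd t dvd dd (Suc s)" using dd_dvd assms by simp
  then have d: "pd ?q dvd pb ?p * pd ?p" using assms by (simp add: dd_def)
  have "aa s dvd aa (t - 1)" using aa_dvd assms by simp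
  then have ad: "pa ?p dvd pa ?q * pc ?q" using assms by (cases t) (auto simp: aa_def)
  show 1: "pb \<pi> * pd \<pi> = nn s div aa s" using d s a pp by (simp add: \<pi> is_pattern_def)
  have "nn t = pa ?p * (pc \<pi> * pd \<pi>)" using ad t by (simp add: \<pi> mult.assoc[symmetric])
  then show 2: "pc \<pi> * pd \<pi> = nn t div aa s" using a pp by (simp add: is_pattern_def)
  show "pd \<pi> = dd t" "pa \<pi> = aa s" using assms(1) a by (simp_all add: \<pi> dd_def)
  show "nrows \<pi> = nn s" using d s by (simp add: nrows_def \<pi> mult.assoc)
  show "ncols \<pi> = nn t" using ad t by (simp add: ncols_def \<pi>)
  moreover have "nrows \<pi> > 0" using \<open>nrows \<pi> = nn s\<close> nn_pos[of s] assms(1,2) by simp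
  moreover have "nn t > 0" using nn_pos assms(2) by blast
  ultimately show "is_pattern \<pi>" by (cases "pc \<pi>") (simp_all add: is_pattern_def nrows_def ncols_def)
qed

lemma S_pint_index:
  assumes "s < t" "t \<le> length \<beta>" "i < nn s" "j < nn t"
  shows "S_pat (pint \<beta> (Suc s) t) $$ (i,j) = (if UU s s i = UU s t j \<and> VV t s i = VV t t j then 1 else 0)"
  using S_pat_index[of i "pint \<beta> (Suc s) t" j] pint_level[OF assms(1,2)] assms(3,4)
  by (simp add: UU_def VV_def)

lemma Supp_S_pat: "Supp (S_pat \<pi>) = Sigma_pat \<pi>"
  using S_pat_carrier[of \<pi>] by (auto simp: Supp_def Sigma_pat_def)

lemma Sigma_pint:
  assumes "s < t" "t \<le> length \<beta>"
  shows "Sigma_pat (pint \<beta> (Suc s) t) = Sg s t"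
  unfolding Sigma_pat_def Sg_def pint_level(5,6)[OF assms] using S_pint_index[OF assms] by auto

text \<open>Sharing row \<open>p\<close> forces equal \<open>VV k\<close> labels at level
  \<open>k\<close>, and sharing column \<open>q\<close> forces equal \<open>UU k\<close> labels.
  These determine the coarser labels, hence the whole column of the left support and the whole row
  of the right one.\<close>

lemma block_pair_pint:
  assumes "s < k" "k < t" "t \<le> length \<beta>"
  shows "block_pair (S_pat (pint \<beta> (Suc s) k)) (S_pat (pint \<beta> (Suc k) t)) (nn s) (nn k) (nn t)"
proof -
  have sk: "s < k" "k \<le> length \<beta>" and kt: "k < t" "t \<le> length \<beta>" using assms by auto
  let ?L = "S_pat (pint \<beta> (Suc s) k)" and ?R = "S_pat (pint \<beta> (Suc k) t)"
  have Lc: "?L \<in> carrier_mat (nn s) (nn k)" and Rc: "?R \<in> carrier_mat (nn k) (nn t)"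
    using S_pat_carrier pint_level(5,6)[OF sk] pint_level(5,6)[OF kt] by metis+
  show ?thesis
  proof
    show "?L \<in> carrier_mat (nn s) (nn k)" "?R \<in> carrier_mat (nn k) (nn t)" by (fact Lc Rc)+
    show "\<exists>p<nn s. ?L $$ (p,x) \<noteq> 0" if "x < nn k" for x
      using S_pat_col_nonzero[of "pint \<beta> (Suc s) k" x] pint_level[OF sk] that by auto
    show "\<exists>q<nn t. ?R $$ (x,q) \<noteq> 0" if "x < nn k" for x
      using S_pat_row_nonzero[of "pint \<beta> (Suc k) t" x] pint_level[OF kt] that by auto
    fix x y p q
    assume xy: "x < nn k" "y < nn k" and pq: "p < nn s" "q < nn t"
      and nz: "?L $$ (p,x) \<noteq> 0" "?L $$ (p,y) \<noteq> 0" "?R $$ (x,q) \<noteq> 0" "?R $$ (y,q) \<noteq> 0"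
    have lab: "UU s k x = UU s k y" "VV k k x = VV k k y" "UU k k x = UU k k y" "VV t k x = VV t k y"
      using nz S_pint_index[OF sk pq(1) xy(1)] S_pint_index[OF sk pq(1) xy(2)]
        S_pint_index[OF kt xy(1) pq(2)] S_pint_index[OF kt xy(2) pq(2)] by (auto split: if_splits)
    have "?L $$ (i,x) = ?L $$ (i,y)" if "i < nn s" for i
      using S_pint_index[OF sk that xy(1)] S_pint_index[OF sk that xy(2)] lab by simp
    moreover have "?R $$ (x,j) = ?R $$ (y,j)" if "j < nn t" for j
      using S_pint_index[OF kt xy(1) that] S_pint_index[OF kt xy(2) that] lab by simp
    ultimately show "Umat ?L ?R x = Umat ?L ?R y" using Lc Rc by (intro eq_matI) (auto simp: Umat_def)
  qed
qed

text \<open>The partition of the inner indices depends on the level \<open>k\<close> only and not on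
  the outer levels \<open>s\<close> and \<open>t\<close>. This is why the \<open>D\<close> of a QR
  step belongs to \<open>Sg k k\<close> for factors of any length.\<close>

lemma Umat_eq_iff:
  assumes "s < k" "k < t" "t \<le> length \<beta>" "x < nn k" "y < nn k"
  shows "Umat (S_pat (pint \<beta> (Suc s) k)) (S_pat (pint \<beta> (Suc k) t)) x
      = Umat (S_pat (pint \<beta> (Suc s) k)) (S_pat (pint \<beta> (Suc k) t)) y
    \<longleftrightarrow> UU k k x = UU k k y \<and> VV k k x = VV k k y" (is "Umat ?L ?R x = _ \<longleftrightarrow> _")
proof -
  have sk: "s < k" "k \<le> length \<beta>" and kt: "k < t" "t \<le> length \<beta>" using assms by auto
  interpret B: block_pair ?L ?R "nn s" "nn k" "nn t" by (rule block_pair_pint[OF assms(1-3)])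
  \<comment> \<open>One support position of the contribution of \<open>x\<close> decides: by
    \<open>share\<close>, \<open>y\<close> lies in the class of \<open>x\<close> iff its
    contribution is nonzero there too.\<close>
  obtain p q where p: "p < nn s" "?L $$ (p,x) \<noteq> 0" and q: "q < nn t" "?R $$ (x,q) \<noteq> 0"
    using B.Lnz B.Rnz assms by blast
  have lx: "UU s s p = UU s k x" "VV k s p = VV k k x" "UU k k x = UU k t q" "VV t k x = VV t t q"
    using p q S_pint_index[OF sk p(1) assms(4)] S_pint_index[OF kt assms(4) q(1)] by (auto split: if_splits)
  have share: "Umat ?L ?R x = Umat ?L ?R y \<longleftrightarrow> ?L $$ (p,y) \<noteq> 0 \<and> ?R $$ (y,q) \<noteq> 0"
    using B.share[of x y p q] B.Umat_nz[OF p(1) q(1), of x] B.Umat_nz[OF p(1) q(1), of y] p q assms by metis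
  have "?L $$ (p,y) \<noteq> 0 \<longleftrightarrow> UU s k x = UU s k y \<and> VV k k x = VV k k y"
    "?R $$ (y,q) \<noteq> 0 \<longleftrightarrow> UU k k y = UU k k x \<and> VV t k y = VV t k x"
    using lx S_pint_index[OF sk p(1) assms(5)] S_pint_index[OF kt assms(5) q(1)] by auto
  moreover have "UU k k x = UU k k y \<Longrightarrow> UU s k x = UU s k y"
    using U_mono[of s k k k x y] assms by auto
  moreover have "VV k k x = VV k k y \<Longrightarrow> VV t k x = VV t k y"
    using V_mono[of k t k k x y] assms by auto
  ultimately show ?thesis using share by auto
qed

end

section \<open>Transposed blocks\<close>

lemma transpose_subm: "transpose_mat (subm X I J) = subm (transpose_mat X) J I"
  if "X \<in> carrier_mat m n" "I \<subseteq> {..<m}" "J \<subseteq> {..<n}"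
proof (rule eq_matI)
  fix i j assume "i < dim_row (subm (transpose_mat X) J I)" "j < dim_col (subm (transpose_mat X) J I)"
  then have ij: "i < card J" "j < card I" by auto
  have f: "finite I" "finite J" using that finite_subset by auto
  have "sorted_list_of_set I ! j < m" "sorted_list_of_set J ! i < n"
    using pos_sorted_list_nth(2)[OF f(1) ij(2)] pos_sorted_list_nth(2)[OF f(2) ij(1)] that by auto
  then show "transpose_mat (subm X I J) $$ (i,j) = subm (transpose_mat X) J I $$ (i,j)"
    using ij that by (simp add: subm_def)
qed auto

lemma transpose_assemble:
  assumes "\<And>P. P \<in> Ps \<Longrightarrow> finite (RI P) \<and> finite (CI P) \<and> B P \<in> carrier_mat (card (RI P)) (card (CI P))"
    and B': "\<And>P. P \<in> Ps \<Longrightarrow> B' P = transpose_mat (B P)"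
  shows "transpose_mat (assemble m n Ps RI CI B) = assemble n m Ps CI RI B'"
proof (rule eq_matI)
  fix i j assume "i < dim_row (assemble n m Ps CI RI B')" "j < dim_col (assemble n m Ps CI RI B')"
  then have ij: "i < n" "j < m" by (auto simp: assemble_def)
  show "transpose_mat (assemble m n Ps RI CI B) $$ (i,j) = assemble n m Ps CI RI B' $$ (i,j)"
  proof (cases "\<exists>P\<in>Ps. j \<in> RI P \<and> i \<in> CI P")
    case True
    define P where "P = (SOME P. P \<in> Ps \<and> j \<in> RI P \<and> i \<in> CI P)"
    have P: "P \<in> Ps \<and> j \<in> RI P \<and> i \<in> CI P" unfolding P_def by (rule someI_ex) (use True in blast)
    have P': "P = (SOME P. P \<in> Ps \<and> i \<in> CI P \<and> j \<in> RI P)" 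
      unfolding P_def by (rule arg_cong[where f = Eps], rule ext, blast)
    have "pos (RI P) j < card (RI P)" "pos (CI P) i < card (CI P)"
      using P assms(1)[of P] sorted_list_nth_pos(2) by auto
    then have "B P $$ (pos (RI P) j, pos (CI P) i) = B' P $$ (pos (CI P) i, pos (RI P) j)"
      using assms(1)[of P] B'[of P] P by auto
    moreover have "\<exists>P\<in>Ps. i \<in> CI P \<and> j \<in> RI P" using True by blast
    ultimately show ?thesis using ij True by (simp add: assemble_def Let_def P_def[symmetric] P'[symmetric])
  next
    case False
    have F: "\<not> (\<exists>P\<in>Ps. i \<in> CI P \<and> j \<in> RI P)" using False by blast
    have "assemble m n Ps RI CI B $$ (j,i) = 0" "assemble n m Ps CI RI B' $$ (i,j) = 0"
      unfolding assemble_def by (simp_all only: index_mat(1) ij split_conv if_not_P[OF False] if_not_P[OF F])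
    moreover have "dim_row (assemble m n Ps RI CI B) = m" "dim_col (assemble m n Ps RI CI B) = n"
      by (simp_all add: assemble_def)
    ultimately show ?thesis using ij by simp
  qed
qed (auto simp: assemble_def)

lemma assemble_cong:
  assumes "\<And>P. P \<in> Ps \<Longrightarrow> RI P = RI' P \<and> CI P = CI' P \<and> B P = B' P"
  shows "assemble m n Ps RI CI B = assemble m n Ps RI' CI' B'"
proof -
  have *: "P \<in> Ps \<and> i \<in> RI P \<and> j \<in> CI P \<longleftrightarrow> P \<in> Ps \<and> i \<in> RI' P \<and> j \<in> CI' P" for P i j
    using assms by auto
  have "(if \<exists>P\<in>Ps. i \<in> RI P \<and> j \<in> CI P
     then (let P = (SOME P. P \<in> Ps \<and> i \<in> RI P \<and> j \<in> CI P) in B P $$ (pos (RI P) i, pos (CI P) j)) else 0)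
    = (if \<exists>P\<in>Ps. i \<in> RI' P \<and> j \<in> CI' P
     then (let P = (SOME P. P \<in> Ps \<and> i \<in> RI' P \<and> j \<in> CI' P) in B' P $$ (pos (RI' P) i, pos (CI' P) j)) else 0)" for i j
  proof (cases "\<exists>P\<in>Ps. i \<in> RI' P \<and> j \<in> CI' P")
    case True
    then have "(SOME P. P \<in> Ps \<and> i \<in> RI' P \<and> j \<in> CI' P) \<in> Ps" by (metis (mono_tags, lifting) someI_ex)
    moreover have "\<exists>P\<in>Ps. i \<in> RI P \<and> j \<in> CI P" using True * by blast
    ultimately show ?thesis using True assms unfolding * Let_def by simp
  next
    case False
    then have F: "\<not> (\<exists>P\<in>Ps. i \<in> RI P \<and> j \<in> CI P)" using * by blast
    show ?thesis unfolding if_not_P[OF False] if_not_P[OF F] ..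
  qed
  then show ?thesis unfolding assemble_def by presburger
qed

text \<open>Needed when a split detaches the last pattern: non-redundancy then bounds the size of a
  class by the number of columns of its block.\<close>

lemma minimizer_exists_wide:
  assumes M: "M \<in> carrier_mat m n" and k: "k \<le> n"
  obtains H K where "is_minimizer M k H K"
proof -
  obtain H K where HK: "is_minimizer (transpose_mat M) k H K"
    using minimizer_exists[of "transpose_mat M" n m k] M k by auto
  have c: "H \<in> carrier_mat n k" "K \<in> carrier_mat k m" using HK M by (auto simp: is_minimizer_def)
  have tr: "frob (transpose_mat M - Y * X) = frob (M - transpose_mat X * transpose_mat Y)"
    if X: "X \<in> carrier_mat k m" and Y: "Y \<in> carrier_mat n k" for X Y
  proof -
    have "transpose_mat (transpose_mat M - Y * X) = M - transpose_mat X * transpose_mat Y"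
      using transpose_minus[of "transpose_mat M" n m "Y * X"] transpose_mult[OF Y X] M X Y by simp
    then show ?thesis by (metis frob_transpose)
  qed
  have "is_minimizer M k (transpose_mat K) (transpose_mat H)"
    unfolding is_minimizer_def
  proof (intro conjI allI impI)
    show "transpose_mat K \<in> carrier_mat (dim_row M) k" "transpose_mat H \<in> carrier_mat k (dim_col M)"
      using c M by auto
    fix H' K' :: "complex mat" assume a: "H' \<in> carrier_mat (dim_row M) k" "K' \<in> carrier_mat k (dim_col M)"
    then have b: "transpose_mat K' \<in> carrier_mat n k" "transpose_mat H' \<in> carrier_mat k m" using M by auto
    then have "frob (transpose_mat M - H * K) \<le> frob (transpose_mat M - transpose_mat K' * transpose_mat H')"
      using HK M unfolding is_minimizer_def by auto
    then show "frob (M - transpose_mat K * transpose_mat H) \<le> frob (M - H' * K')"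
      using tr[OF c(2,1)] tr[OF b(2,1)] by simp
  qed
  then show ?thesis using that by blast
qed

context block_pair
begin

lemma Umat_transpose: "Umat (transpose_mat Rm) (transpose_mat Lm) k = transpose_mat (Umat Lm Rm k)" if "k < n"
  using that Lc Rc by (intro eq_matI) (auto simp: Umat_def mult.commute)

lemma block_pair_transpose: "block_pair (transpose_mat Rm) (transpose_mat Lm) q n m"
proof
  show "transpose_mat Rm \<in> carrier_mat q n" "transpose_mat Lm \<in> carrier_mat n m" using Lc Rc by auto
  show "\<exists>p<q. transpose_mat Rm $$ (p,k) \<noteq> 0" if "k < n" for k
    using Rnz[OF that] that Rc by auto
  show "\<exists>p<m. transpose_mat Lm $$ (k,p) \<noteq> 0" if "k < n" for k
    using Lnz[OF that] that Lc by auto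
  fix k k' p x
  assume a: "k < n" "k' < n" "p < q" "x < m" "transpose_mat Rm $$ (p,k) \<noteq> 0" "transpose_mat Rm $$ (p,k') \<noteq> 0"
    "transpose_mat Lm $$ (k,x) \<noteq> 0" "transpose_mat Lm $$ (k',x) \<noteq> 0"
  then have "Umat Lm Rm k = Umat Lm Rm k'" using share[of k k' x p] Lc Rc by auto
  then show "Umat (transpose_mat Rm) (transpose_mat Lm) k = Umat (transpose_mat Rm) (transpose_mat Lm) k'"
    using Umat_transpose a by simp
qed

lemma parts_transpose: "parts (transpose_mat Rm) (transpose_mat Lm) = parts Lm Rm"
proof -
  have "Umat (transpose_mat Rm) (transpose_mat Lm) j = Umat (transpose_mat Rm) (transpose_mat Lm) k
      \<longleftrightarrow> Umat Lm Rm j = Umat Lm Rm k" if "j < n" "k < n" for j k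
    using Umat_transpose[OF that(1)] Umat_transpose[OF that(2)] by (metis transpose_transpose)
  then have "{j. j < n \<and> Umat (transpose_mat Rm) (transpose_mat Lm) j = Umat (transpose_mat Rm) (transpose_mat Lm) k}
      = {j. j < n \<and> Umat Lm Rm j = Umat Lm Rm k}" if "k < n" for k
    using that by blast
  then show ?thesis unfolding parts_def using dims by auto
qed

lemma RP_transpose:
  assumes "P \<in> parts Lm Rm"
  shows "RP (transpose_mat Rm) (transpose_mat Lm) P = CP Lm Rm P"
    and "CP (transpose_mat Rm) (transpose_mat Lm) P = RP Lm Rm P"
proof -
  obtain k where k: "k < n" "P = cls k" using assms by (auto simp: parts_eq)
  have "repr P \<in> P" unfolding k repr_def by (metis in_cls k(1) someI_ex)
  then have r: "repr P < n" using k cls_less by blast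
  show "RP (transpose_mat Rm) (transpose_mat Lm) P = CP Lm Rm P"
    "CP (transpose_mat Rm) (transpose_mat Lm) P = RP Lm Rm P"
    using r Lc Rc unfolding RP_def CP_def by (auto simp: Umat_def)
qed

lemma part_sub:
  assumes "P \<in> parts Lm Rm"
  shows "P \<subseteq> {..<n}" "RP Lm Rm P \<subseteq> {..<m}" "CP Lm Rm P \<subseteq> {..<q}"
  using assms dims by (auto simp: parts_def RP_def CP_def)

lemma part_finite:
  assumes "P \<in> parts Lm Rm"
  shows "finite P" "finite (RP Lm Rm P)" "finite (CP Lm Rm P)"
  using part_sub[OF assms] finite_subset by blast+

lemma SuppL_transpose: "X \<in> Supp Lm \<Longrightarrow> transpose_mat X \<in> Supp (transpose_mat Lm)"
  using Lc by (auto simp: Supp_def)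

lemma SuppR_transpose: "Y \<in> Supp Rm \<Longrightarrow> transpose_mat Y \<in> Supp (transpose_mat Rm)"
  using Rc by (auto simp: Supp_def)

text \<open>A row step is a column step for the transposed pair, which has the same classes with row
  and column supports exchanged.\<close>

lemma assemble_qr_row:
  assumes X: "X \<in> Supp Lm" and Y: "Y \<in> Supp Rm"
    and QR: "\<And>P. P \<in> parts Lm Rm \<Longrightarrow> is_qr (transpose_mat (subm Y P (CP Lm Rm P))) (fst (QR P)) (snd (QR P))"
  defines "X' \<equiv> assemble m n (parts Lm Rm) (RP Lm Rm) id (\<lambda>P. subm X (RP Lm Rm P) P * transpose_mat (snd (QR P)))"
    and "Y' \<equiv> assemble n q (parts Lm Rm) id (CP Lm Rm) (\<lambda>P. transpose_mat (fst (QR P)))"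
  obtains D where "D \<in> carrier_mat n n"
    "\<And>i j. i < n \<Longrightarrow> j < n \<Longrightarrow> D $$ (i,j) \<noteq> 0 \<Longrightarrow> Umat Lm Rm i = Umat Lm Rm j"
    "transpose_mat Y = transpose_mat Y' * D" "transpose_mat X' = D * transpose_mat X"
    "\<And>i j. i < n \<Longrightarrow> j < n \<Longrightarrow> Umat Lm Rm i = Umat Lm Rm j
      \<Longrightarrow> (cadj (transpose_mat Y') * transpose_mat Y') $$ (i,j) = (if i = j then 1 else 0)"
proof -
  interpret T: block_pair "transpose_mat Rm" "transpose_mat Lm" q n m by (rule block_pair_transpose)
  let ?Ps = "parts Lm Rm"
  let ?R = "RP (transpose_mat Rm) (transpose_mat Lm)" and ?C = "CP (transpose_mat Rm) (transpose_mat Lm)"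
  have Xc: "X \<in> carrier_mat m n" and Yc: "Y \<in> carrier_mat n q"
    using SuppL_carrier[OF X] SuppR_carrier[OF Y] by auto
  have qc: "fst (QR P) \<in> carrier_mat (card (CP Lm Rm P)) (card P)" "snd (QR P) \<in> carrier_mat (card P) (card P)"
    if "P \<in> ?Ps" for P using QR[OF that] by (auto simp: is_qr_def)
  have qr: "is_qr (subm (transpose_mat Y) (?R P) P) (fst (QR P)) (snd (QR P))"
    if "P \<in> parts (transpose_mat Rm) (transpose_mat Lm)" for P
  proof -
    have P: "P \<in> ?Ps" using that parts_transpose by simp
    show ?thesis using QR[OF P] unfolding RP_transpose[OF P] transpose_subm[OF Yc part_sub(1,3)[OF P]] .
  qed
  have Y't: "transpose_mat Y' = assemble q n (parts (transpose_mat Rm) (transpose_mat Lm)) ?R id (\<lambda>P. fst (QR P))"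
  proof -
    have "transpose_mat Y' = assemble q n ?Ps (CP Lm Rm) id (\<lambda>P. fst (QR P))"
      unfolding Y'_def using part_finite qc by (intro transpose_assemble) auto
    also have "\<dots> = assemble q n ?Ps ?R id (\<lambda>P. fst (QR P))"
      by (rule assemble_cong) (auto simp: RP_transpose)
    finally show ?thesis by (simp add: parts_transpose)
  qed
  have X't: "transpose_mat X' = assemble n m (parts (transpose_mat Rm) (transpose_mat Lm)) id ?C
      (\<lambda>P. snd (QR P) * subm (transpose_mat X) P (?C P))"
  proof -
    have "transpose_mat X' = assemble n m ?Ps id (RP Lm Rm) (\<lambda>P. snd (QR P) * subm (transpose_mat X) P (RP Lm Rm P))"
      unfolding X'_def
    proof (intro transpose_assemble conjI)
      fix P assume P: "P \<in> ?Ps"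
      show "snd (QR P) * subm (transpose_mat X) P (RP Lm Rm P)
          = transpose_mat (subm X (RP Lm Rm P) P * transpose_mat (snd (QR P)))"
        using transpose_mult[OF subm_carrier, of "transpose_mat (snd (QR P))" P "card P" X "RP Lm Rm P"] qc(2)[OF P]
          transpose_subm[OF Xc part_sub(2,1)[OF P]] by simp
      show "subm X (RP Lm Rm P) P * transpose_mat (snd (QR P)) \<in> carrier_mat (card (RP Lm Rm P)) (card (id P))"
        using qc(2)[OF P] by (intro mult_carrier_mat[OF subm_carrier]) auto
    qed (use part_finite in auto)
    also have "\<dots> = assemble n m ?Ps id ?C (\<lambda>P. snd (QR P) * subm (transpose_mat X) P (?C P))"
      by (rule assemble_cong) (auto simp: RP_transpose)
    finally show ?thesis by (simp add: parts_transpose)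
  qed
  have Ueq: "Umat (transpose_mat Rm) (transpose_mat Lm) i = Umat (transpose_mat Rm) (transpose_mat Lm) j
      \<longleftrightarrow> Umat Lm Rm i = Umat Lm Rm j" if "i < n" "j < n" for i j
    using Umat_transpose[OF that(1)] Umat_transpose[OF that(2)] by (metis transpose_transpose)
  obtain D where "D \<in> carrier_mat n n"
    "\<And>i j. i < n \<Longrightarrow> j < n \<Longrightarrow> D $$ (i,j) \<noteq> 0 \<Longrightarrow> Umat (transpose_mat Rm) (transpose_mat Lm) i = Umat (transpose_mat Rm) (transpose_mat Lm) j"
    "transpose_mat Y = transpose_mat Y' * D" "transpose_mat X' = D * transpose_mat X"
    "\<And>i j. i < n \<Longrightarrow> j < n \<Longrightarrow> Umat (transpose_mat Rm) (transpose_mat Lm) i = Umat (transpose_mat Rm) (transpose_mat Lm) j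
      \<Longrightarrow> (cadj (transpose_mat Y') * transpose_mat Y') $$ (i,j) = (if i = j then 1 else 0)"
    using T.assemble_qr[OF SuppR_transpose[OF Y] SuppL_transpose[OF X] qr] unfolding Y't X't by blast
  then show ?thesis using that Ueq by blast
qed

end

section \<open>Orthonormalisation and two-factor steps\<close>

text \<open>Write \<open>y\<close> with outer digits \<open>e\<close>, \<open>v\<close> and middle
  digit \<open>z < r\<close>. Keeping \<open>z\<close> and replacing the outer digits by
  \<open>u\<close>, \<open>v'\<close> is injective, and it lands in the target since
  \<open>r \<le> m\<close>.\<close>

lemma residue_class_card_le:
  fixes r d m d' u v' :: nat
  assumes d: "d > 0" and r: "r > 0" "r \<le> m" and v': "v' < d'" and M: "Suc u * (m * d') \<le> M"
  shows "card {y. y < N \<and> y div (r * d) = e \<and> y mod d = v} \<le> card {p. p < M \<and> p div (m * d') = u \<and> p mod d' = v'}"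
proof (rule card_inj_on_le)
  let ?z = "\<lambda>y. (y mod (r * d)) div d"
  let ?f = "\<lambda>y. u * (m * d') + (?z y * d' + v')"
  have z: "?z y < r" for y using d r by (simp add: less_mult_imp_div_less)
  have lt: "?z y * d' + v' < m * d'" for y
  proof -
    have "?z y * d' + v' < Suc (?z y) * d'" using v' by simp
    also have "\<dots> \<le> m * d'" using z[of y] r by (intro mult_le_mono1) simp
    finally show ?thesis .
  qed
  show "inj_on ?f {y. y < N \<and> y div (r * d) = e \<and> y mod d = v}"
  proof (rule inj_onI)
    fix x y assume x: "x \<in> {y. y < N \<and> y div (r * d) = e \<and> y mod d = v}"
      and y: "y \<in> {y. y < N \<and> y div (r * d) = e \<and> y mod d = v}" and "?f x = ?f y"
    then have "?z x = ?z y" using v' by simp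
    moreover have "x mod (r * d) mod d = y mod (r * d) mod d"
      using x y by (simp add: mod_mod_cancel)
    ultimately have "x mod (r * d) = y mod (r * d)" by (metis div_mod_decomp)
    then show "x = y" using x y by (metis (mono_tags, lifting) div_mod_decomp mem_Collect_eq)
  qed
  show "?f ` {y. y < N \<and> y div (r * d) = e \<and> y mod d = v} \<subseteq> {p. p < M \<and> p div (m * d') = u \<and> p mod d' = v'}"
  proof (intro image_subsetI CollectI conjI)
    fix y
    show "?f y < M" using lt[of y] M by simp
    have "(u * h + z) div h = u" if "z < h" for h z :: nat using that by simp
    from this[OF lt[of y]] show "?f y div (m * d') = u" .
    show "?f y mod d' = v'" using v' by (simp flip: mult.assoc)
  qed
qed simp

context arch
begin

sublocale mirrored_cuts "length \<beta>" nn UU VV "\<lambda>l. nn (length \<beta> - l)"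
  "\<lambda>s l. VV (length \<beta> - s) (length \<beta> - l)" "\<lambda>t l. UU (length \<beta> - t) (length \<beta> - l)"
  by unfold_locales auto

lemma ortho_column_spec:
  assumes skt: "s < k" "k < t" "t \<le> length \<beta>" and X: "X \<in> Sg s k" and Y: "Y \<in> Sg k t"
    and Z: "Z \<in> ortho (pint \<beta> (Suc s) k) (pint \<beta> (Suc k) t) X Y Column"
  shows "\<exists>D. fst Z \<in> Sg s k \<and> colorth k (fst Z) \<and> D \<in> Sg k k \<and> X = fst Z * D \<and> snd Z = D * Y"
proof -
  let ?L = "S_pat (pint \<beta> (Suc s) k)" and ?R = "S_pat (pint \<beta> (Suc k) t)"
  have sk: "s < k" "k \<le> length \<beta>" and kt: "k < t" "t \<le> length \<beta>" using skt by auto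
  interpret B: block_pair ?L ?R "nn s" "nn k" "nn t" by (rule block_pair_pint[OF skt])
  have "\<exists>QR. Z = (assemble (nn s) (nn k) (parts ?L ?R) (RP ?L ?R) id (\<lambda>P. fst (QR P)),
      assemble (nn k) (nn t) (parts ?L ?R) id (CP ?L ?R) (\<lambda>P. snd (QR P) * subm Y P (CP ?L ?R P)))
      \<and> (\<forall>P\<in>parts ?L ?R. is_qr (subm X (RP ?L ?R P) P) (fst (QR P)) (snd (QR P)))"
    using Z unfolding ortho_def Let_def pint_level(5,6)[OF sk] pint_level(5,6)[OF kt] by simp
  then obtain QR where Z': "Z = (assemble (nn s) (nn k) (parts ?L ?R) (RP ?L ?R) id (\<lambda>P. fst (QR P)),
      assemble (nn k) (nn t) (parts ?L ?R) id (CP ?L ?R) (\<lambda>P. snd (QR P) * subm Y P (CP ?L ?R P)))"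
    and QR: "\<And>P. P \<in> parts ?L ?R \<Longrightarrow> is_qr (subm X (RP ?L ?R P) P) (fst (QR P)) (snd (QR P))" by blast
  have fZ: "fst Z = assemble (nn s) (nn k) (parts ?L ?R) (RP ?L ?R) id (\<lambda>P. fst (QR P))"
    and sZ: "snd Z = assemble (nn k) (nn t) (parts ?L ?R) id (CP ?L ?R) (\<lambda>P. snd (QR P) * subm Y P (CP ?L ?R P))"
    unfolding Z' by simp_all
  have XS: "X \<in> Supp ?L" and YS: "Y \<in> Supp ?R"
    using X Y Sigma_pint[OF sk] Sigma_pint[OF kt] by (auto simp: Supp_S_pat)
  obtain D where D: "D \<in> carrier_mat (nn k) (nn k)"
    "\<And>i j. i < nn k \<Longrightarrow> j < nn k \<Longrightarrow> D $$ (i,j) \<noteq> 0 \<Longrightarrow> Umat ?L ?R i = Umat ?L ?R j"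
    "X = fst Z * D" "snd Z = D * Y"
    "\<And>i j. i < nn k \<Longrightarrow> j < nn k \<Longrightarrow> Umat ?L ?R i = Umat ?L ?R j
      \<Longrightarrow> (cadj (fst Z) * fst Z) $$ (i,j) = (if i = j then 1 else 0)"
    using B.assemble_qr[OF XS YS QR] unfolding fZ sZ by blast
  have Q: "fst Z \<in> Sg s k"
    using B.assemble_left_Supp Sigma_pint[OF sk] by (simp add: fZ Supp_S_pat)
  moreover have "colorth k (fst Z)"
    using D(5) Umat_eq_iff[OF skt] by (intro colorth_if_orthonormal_on_classes[OF Q]) blast
  moreover have "D \<in> Sg k k" using D(2) Umat_eq_iff[OF skt] by (intro SgI[OF D(1)]) blast
  ultimately show ?thesis using D(3,4) by blast
qed

lemma ortho_row_spec:
  assumes skt: "s < k" "k < t" "t \<le> length \<beta>" and X: "X \<in> Sg s k" and Y: "Y \<in> Sg k t"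
    and Z: "Z \<in> ortho (pint \<beta> (Suc s) k) (pint \<beta> (Suc k) t) X Y Row"
  defines "Q \<equiv> transpose_mat (snd Z)" and "k' \<equiv> length \<beta> - k" and "t' \<equiv> length \<beta> - t"
  shows "\<exists>D. Q \<in> mir.Sg t' k' \<and> mir.colorth k' Q \<and> D \<in> mir.Sg k' k' \<and>
    transpose_mat Y = Q * D \<and> transpose_mat (fst Z) = D * transpose_mat X"
proof -
  let ?L = "S_pat (pint \<beta> (Suc s) k)" and ?R = "S_pat (pint \<beta> (Suc k) t)"
  have sk: "s < k" "k \<le> length \<beta>" and kt: "k < t" "t \<le> length \<beta>" using skt by auto
  have kk: "length \<beta> - k' = k" "length \<beta> - t' = t" using skt by (auto simp: k'_def t'_def)
  interpret B: block_pair ?L ?R "nn s" "nn k" "nn t" by (rule block_pair_pint[OF skt])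
  have "\<exists>QR. Z = (assemble (nn s) (nn k) (parts ?L ?R) (RP ?L ?R) id
        (\<lambda>P. subm X (RP ?L ?R P) P * transpose_mat (snd (QR P))),
      assemble (nn k) (nn t) (parts ?L ?R) id (CP ?L ?R) (\<lambda>P. transpose_mat (fst (QR P))))
      \<and> (\<forall>P\<in>parts ?L ?R. is_qr (transpose_mat (subm Y P (CP ?L ?R P))) (fst (QR P)) (snd (QR P)))"
    using Z unfolding ortho_def Let_def pint_level(5,6)[OF sk] pint_level(5,6)[OF kt] by simp
  then obtain QR where Z': "Z = (assemble (nn s) (nn k) (parts ?L ?R) (RP ?L ?R) id
        (\<lambda>P. subm X (RP ?L ?R P) P * transpose_mat (snd (QR P))),
      assemble (nn k) (nn t) (parts ?L ?R) id (CP ?L ?R) (\<lambda>P. transpose_mat (fst (QR P))))"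
    and QR: "\<And>P. P \<in> parts ?L ?R \<Longrightarrow>
      is_qr (transpose_mat (subm Y P (CP ?L ?R P))) (fst (QR P)) (snd (QR P))" by blast
  have fZ: "fst Z = assemble (nn s) (nn k) (parts ?L ?R) (RP ?L ?R) id
      (\<lambda>P. subm X (RP ?L ?R P) P * transpose_mat (snd (QR P)))"
    and sZ: "snd Z = assemble (nn k) (nn t) (parts ?L ?R) id (CP ?L ?R) (\<lambda>P. transpose_mat (fst (QR P)))"
    unfolding Z' by simp_all
  have XS: "X \<in> Supp ?L" and YS: "Y \<in> Supp ?R"
    using X Y Sigma_pint[OF sk] Sigma_pint[OF kt] by (auto simp: Supp_S_pat)
  obtain D where D: "D \<in> carrier_mat (nn k) (nn k)"
    "\<And>i j. i < nn k \<Longrightarrow> j < nn k \<Longrightarrow> D $$ (i,j) \<noteq> 0 \<Longrightarrow> Umat ?L ?R i = Umat ?L ?R j"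
    "transpose_mat Y = Q * D" "transpose_mat (fst Z) = D * transpose_mat X"
    "\<And>i j. i < nn k \<Longrightarrow> j < nn k \<Longrightarrow> Umat ?L ?R i = Umat ?L ?R j
      \<Longrightarrow> (cadj Q * Q) $$ (i,j) = (if i = j then 1 else 0)"
    using B.assemble_qr_row[OF XS YS QR] unfolding fZ sZ Q_def by blast
  have "snd Z \<in> Sg k t"
    using B.assemble_right_Supp Sigma_pint[OF kt] by (simp add: sZ Supp_S_pat)
  then have Q: "Q \<in> mir.Sg t' k'" unfolding Q_def mir_Sg_transpose kk .
  moreover have "mir.colorth k' Q"
    by (rule mir.colorth_if_orthonormal_on_classes[OF Q])
      (use D(5) Umat_eq_iff[OF skt] in \<open>unfold kk, blast\<close>)
  moreover have "D \<in> mir.Sg k' k'"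
    by (rule mir.SgI) (use D(1,2) Umat_eq_iff[OF skt] in \<open>unfold kk, blast+\<close>)
  ultimately show ?thesis using D(3,4) by blast
qed

lemma two_factor_spec:
  assumes skt: "s < k" "k < t" "t \<le> length \<beta>" and M: "M \<in> carrier_mat (nn s) (nn t)"
    and Z: "Z \<in> two_factor M (pint \<beta> (Suc s) k) (pint \<beta> (Suc k) t)"
  shows "fst Z \<in> Sg s k" "snd Z \<in> Sg k t"
    and "\<And>H K. H \<in> Sg s k \<Longrightarrow> K \<in> Sg k t \<Longrightarrow> frob (M - fst Z * snd Z) \<le> frob (M - H * K)"
proof -
  let ?L = "S_pat (pint \<beta> (Suc s) k)" and ?R = "S_pat (pint \<beta> (Suc k) t)"
  have sk: "s < k" "k \<le> length \<beta>" and kt: "k < t" "t \<le> length \<beta>" using skt by auto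
  interpret B: block_pair ?L ?R "nn s" "nn k" "nn t" by (rule block_pair_pint[OF skt])
  have "\<exists>HK. Z = (assemble (nn s) (nn k) (parts ?L ?R) (RP ?L ?R) id (\<lambda>P. fst (HK P)),
      assemble (nn k) (nn t) (parts ?L ?R) id (CP ?L ?R) (\<lambda>P. snd (HK P)))
      \<and> (\<forall>P\<in>parts ?L ?R. is_minimizer (subm M (RP ?L ?R P) (CP ?L ?R P)) (card P) (fst (HK P)) (snd (HK P)))"
    using Z unfolding two_factor_def Let_def pint_level(5,6)[OF sk] pint_level(5,6)[OF kt] by simp
  then obtain HK where Z': "Z = (assemble (nn s) (nn k) (parts ?L ?R) (RP ?L ?R) id (\<lambda>P. fst (HK P)),
      assemble (nn k) (nn t) (parts ?L ?R) id (CP ?L ?R) (\<lambda>P. snd (HK P)))"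
    and HK: "\<And>P. P \<in> parts ?L ?R \<Longrightarrow>
      is_minimizer (subm M (RP ?L ?R P) (CP ?L ?R P)) (card P) (fst (HK P)) (snd (HK P))" by blast
  have fZ: "fst Z = assemble (nn s) (nn k) (parts ?L ?R) (RP ?L ?R) id (\<lambda>P. fst (HK P))"
    and sZ: "snd Z = assemble (nn k) (nn t) (parts ?L ?R) id (CP ?L ?R) (\<lambda>P. snd (HK P))"
    unfolding Z' by simp_all
  show "fst Z \<in> Sg s k" using B.assemble_left_Supp Sigma_pint[OF sk] by (simp add: fZ Supp_S_pat)
  show "snd Z \<in> Sg k t" using B.assemble_right_Supp Sigma_pint[OF kt] by (simp add: sZ Supp_S_pat)
  fix H K assume "H \<in> Sg s k" "K \<in> Sg k t"
  then have "H \<in> Supp ?L" "K \<in> Supp ?R" using Sigma_pint[OF sk] Sigma_pint[OF kt] by (auto simp: Supp_S_pat)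
  then show "frob (M - fst Z * snd Z) \<le> frob (M - H * K)"
    unfolding fZ sZ using B.assemble_minimizers[OF M, of HK H K] HK by blast
qed

text \<open>Indices of level \<open>k\<close> with one \<open>UU k\<close> label form an interval of
  length \<open>r * dd k\<close>, so fixing the remainder modulo \<open>dd k\<close> as well leaves
  \<open>r\<close> indices: \<open>r_pat\<close> is the size of each class.\<close>

lemma level_width:
  assumes k: "1 \<le> k" "k < length \<beta>"
  shows "nn k div aa k = r_pat (pat \<beta> k) (pat \<beta> (Suc k)) * dd k" "r_pat (pat \<beta> k) (pat \<beta> (Suc k)) > 0"
proof -
  have n: "nn k = pa (pat \<beta> k) * pc (pat \<beta> k) * pd (pat \<beta> k)" using k by (simp add: nn_def ncols_def)
  have a: "aa k = pa (pat \<beta> (Suc k))" "dd k = pd (pat \<beta> k)" using k by (auto simp: aa_def dd_def)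
  show e: "nn k div aa k = r_pat (pat \<beta> k) (pat \<beta> (Suc k)) * dd k"
    unfolding n a r_pat_def using dvd_div_mult[OF chain_step(1)[OF k]] by simp
  have "nn k div aa k > 0"
    using aa_dvd_nn[of k k] nn_pos[of k] k aa_pos[of k] by (simp add: div_greater_zero_iff dvd_imp_le)
  then show "r_pat (pat \<beta> k) (pat \<beta> (Suc k)) > 0" using e by (auto intro!: Nat.gr0I)
qed

lemma dd_pos: "t \<le> length \<beta> \<Longrightarrow> dd t > 0"
  using pat_pos[of t] nn_pos[of 0] by (auto simp: dd_def is_pattern_def)

text \<open>Non-redundancy enters here. A class has \<open>r\<close> indices; its block has
  \<open>b\<close> rows when the left factor is a single pattern and \<open>c\<close> columns when
  the right factor is. In either splitting order, every sweep or split step has a single pattern on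
  the appropriate side.\<close>

lemma class_card_le:
  assumes skt: "s < k" "k < t" "t \<le> length \<beta>"
    and P: "P \<in> parts (S_pat (pint \<beta> (Suc s) k)) (S_pat (pint \<beta> (Suc k) t))"
  defines "L \<equiv> S_pat (pint \<beta> (Suc s) k)" and "R \<equiv> S_pat (pint \<beta> (Suc k) t)"
  shows "k = Suc s \<Longrightarrow> card P \<le> card (RP L R P)" and "t = Suc k \<Longrightarrow> card P \<le> card (CP L R P)"
proof -
  have sk: "s < k" "k \<le> length \<beta>" and kt: "k < t" "t \<le> length \<beta>" using skt by auto
  have k: "1 \<le> k" "k < length \<beta>" using skt by auto
  interpret B: block_pair L R "nn s" "nn k" "nn t" unfolding L_def R_def by (rule block_pair_pint[OF skt])
  obtain x where x: "x < nn k" "P = B.cls x" using P B.parts_eq by (auto simp: L_def R_def)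
  let ?r = "r_pat (pat \<beta> k) (pat \<beta> (Suc k))"
  have cls: "P = {y. y < nn k \<and> y div (?r * dd k) = UU k k x \<and> y mod dd k = VV k k x}"
    unfolding x(2) B.cls_def using Umat_eq_iff[OF skt _ x(1)] level_width(1)[OF k]
    by (auto simp: L_def R_def UU_def VV_def)
  show "card P \<le> card (RP L R P)" if "k = Suc s"
  proof -
    have pl: "nn s div aa s = pb (pat \<beta> k) * dd k" "nn s = aa s * (pb (pat \<beta> k) * dd k)"
      using nn_rows[of s] that k aa_pos[of s] by (auto simp: nrows_def aa_def dd_def)
    have u: "UU s k x < aa s"
      using x(1) aa_dvd_nn[of s k] sk by (simp add: UU_def less_mult_imp_div_less)
    then have "Suc (UU s k x) * (pb (pat \<beta> k) * dd k) \<le> nn s" unfolding pl(2) by (intro mult_le_mono1) simp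
    then have "card P \<le> card {p. p < nn s \<and> p div (pb (pat \<beta> k) * dd k) = UU s k x \<and> p mod dd k = x mod dd k}"
      unfolding cls using dd_pos[of k] level_width(2)[OF k] chain_step(5)[OF k] k
      by (intro residue_class_card_le) auto
    also have "{p. p < nn s \<and> p div (pb (pat \<beta> k) * dd k) = UU s k x \<and> p mod dd k = x mod dd k} = B.Rr x"
      unfolding B.Rr_def using S_pint_index[OF sk _ x(1), folded L_def] pl(1)
      by (auto simp: UU_def[of s s] VV_def split: if_splits)
    finally show ?thesis using B.RP_cls[OF x(1)] x(2) by simp
  qed
  show "card P \<le> card (CP L R P)" if "t = Suc k"
  proof -
    let ?q = "pat \<beta> (Suc k)"
    have q: "is_pattern ?q" using pat_pos k by simp
    have pl: "nn t div aa k = pc ?q * dd t" "nn t = aa k * (pc ?q * dd t)"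
      using that k q by (auto simp: nn_def ncols_def aa_def dd_def is_pattern_def)
    have u: "UU k k x < aa k"
      using x(1) aa_dvd_nn[of k k] k by (simp add: UU_def less_mult_imp_div_less)
    then have "Suc (UU k k x) * (pc ?q * dd t) \<le> nn t" unfolding pl(2) by (intro mult_le_mono1) simp
    then have "card P \<le> card {p. p < nn t \<and> p div (pc ?q * dd t) = UU k k x \<and> p mod dd t = x mod dd t}"
      unfolding cls using dd_pos[of k] dd_pos[of t] level_width(2)[OF k] chain_step(6)[OF k] k kt
      by (intro residue_class_card_le) auto
    also have "{p. p < nn t \<and> p div (pc ?q * dd t) = UU k k x \<and> p mod dd t = x mod dd t} = B.Cc x"
      unfolding B.Cc_def using S_pint_index[OF kt x(1), folded R_def] pl(1)
      by (auto simp: UU_def[of k t] VV_def split: if_splits)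
    finally show ?thesis using B.CP_cls[OF x(1)] x(2) by simp
  qed
qed

lemma ortho_column_nonempty:
  assumes "k = Suc s" "k < t" "t \<le> length \<beta>"
  shows "ortho (pint \<beta> (Suc s) k) (pint \<beta> (Suc k) t) X Y Column \<noteq> {}"
proof -
  let ?L = "S_pat (pint \<beta> (Suc s) k)" and ?R = "S_pat (pint \<beta> (Suc k) t)"
  have "\<exists>z. is_qr (subm X (RP ?L ?R P) P) (fst z) (snd z)" if "P \<in> parts ?L ?R" for P
  proof -
    have c: "card P \<le> card (RP ?L ?R P)" using class_card_le(1)[OF _ assms(2,3) that] assms by simp
    show ?thesis by (rule qr_exists[OF subm_carrier c]) auto
  qed
  then obtain QR where "\<forall>P\<in>parts ?L ?R. is_qr (subm X (RP ?L ?R P) P) (fst (QR P)) (snd (QR P))" by metis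
  then show ?thesis unfolding ortho_def Let_def by auto
qed

lemma ortho_row_nonempty:
  assumes "s < k" "t = Suc k" "t \<le> length \<beta>"
  shows "ortho (pint \<beta> (Suc s) k) (pint \<beta> (Suc k) t) X Y Row \<noteq> {}"
proof -
  let ?L = "S_pat (pint \<beta> (Suc s) k)" and ?R = "S_pat (pint \<beta> (Suc k) t)"
  have "\<exists>z. is_qr (transpose_mat (subm Y P (CP ?L ?R P))) (fst z) (snd z)" if "P \<in> parts ?L ?R" for P
  proof -
    have c: "card P \<le> card (CP ?L ?R P)" using class_card_le(2)[OF assms(1) _ assms(3) that] assms by simp
    have "transpose_mat (subm Y P (CP ?L ?R P)) \<in> carrier_mat (card (CP ?L ?R P)) (card P)" by simp
    then show ?thesis by (rule qr_exists[OF _ c]) auto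
  qed
  then obtain QR where "\<forall>P\<in>parts ?L ?R. is_qr (transpose_mat (subm Y P (CP ?L ?R P))) (fst (QR P)) (snd (QR P))" by metis
  then show ?thesis unfolding ortho_def Let_def by auto
qed

lemma two_factor_nonempty:
  assumes "s < k" "k < t" "t \<le> length \<beta>" and "k = Suc s \<or> t = Suc k"
  shows "two_factor M (pint \<beta> (Suc s) k) (pint \<beta> (Suc k) t) \<noteq> {}"
proof -
  let ?L = "S_pat (pint \<beta> (Suc s) k)" and ?R = "S_pat (pint \<beta> (Suc k) t)"
  have "\<exists>z. is_minimizer (subm M (RP ?L ?R P) (CP ?L ?R P)) (card P) (fst z) (snd z)" if "P \<in> parts ?L ?R" for P
  proof -
    have "card P \<le> card (RP ?L ?R P) \<or> card P \<le> card (CP ?L ?R P)"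
      using class_card_le[OF assms(1-3) that] assms(4) by blast
    then show ?thesis
      using minimizer_exists[OF subm_carrier, of "card P" "RP ?L ?R P" M "CP ?L ?R P"]
        minimizer_exists_wide[OF subm_carrier, of "card P" "CP ?L ?R P" M "RP ?L ?R P"] by (metis fst_conv snd_conv)
  qed
  then obtain HK where "\<forall>P\<in>parts ?L ?R. is_minimizer (subm M (RP ?L ?R P) (CP ?L ?R P)) (card P) (fst (HK P)) (snd (HK P))"
    by metis
  then show ?thesis unfolding two_factor_def Let_def by auto
qed

end

section \<open>Splitting from left to right\<close>

lemma seq_steps_image:
  assumes "\<And>k x. 1 \<le> k \<Longrightarrow> k \<le> J \<Longrightarrow> f k (e x) = e ` g k x"
  shows "seq_steps f [1..<Suc J] (e X) = e ` foldl (\<lambda>S k. Set.bind S (g k)) {X} [1..<Suc J]"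
  unfolding seq_steps_def using foldl_bind_image[of 1 "Suc J" f "\<lambda>_. e" g "{X}"] assms by simp

lemma seq_steps_Nil: "seq_steps f [] st = {st}"
  by (simp add: seq_steps_def)

lemma bind_one: "Set.bind {x} f = f x"
  by (auto simp: Set.bind_def)

lemma UN_one: "(\<Union>j\<in>{a}. f j) = f a"
  by simp

lemma bind_image: "Set.bind (e ` S) f = (\<Union>x\<in>S. f (e x))"
  by (auto simp: Set.bind_def)

lemma mat_list_prod_snoc: "xs \<noteq> [] \<Longrightarrow> mat_list_prod (xs @ [x]) = mat_list_prod xs * x"
  by (cases xs) (simp_all add: mat_list_prod_def)

context arch
begin

text \<open>Translates an assignment of factors, numbered from 1, into the list state after
  \<open>J\<close> splits from the left, whose positions start at 0.\<close>

definition enc :: "nat \<Rightarrow> (nat \<Rightarrow> complex mat) \<Rightarrow> bstate" where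
  "enc J X = map (\<lambda>p. ((Suc p, if p < J then Suc p else length \<beta>), X (Suc p))) [0..<Suc J]"

definition ortho_fwd :: "nat \<Rightarrow> nat \<Rightarrow> (nat \<Rightarrow> complex mat) \<Rightarrow> (nat \<Rightarrow> complex mat) set" where
  "ortho_fwd J k X = (\<lambda>z. X(k := fst z, Suc k := snd z)) `
     ortho (pint \<beta> k k) (pint \<beta> (Suc k) (if k < J then Suc k else length \<beta>)) (X k) (X (Suc k)) Column"

definition split_fwd :: "nat \<Rightarrow> (nat \<Rightarrow> complex mat) \<Rightarrow> (nat \<Rightarrow> complex mat) set" where
  "split_fwd J X = (\<lambda>z. X(Suc J := fst z, Suc (Suc J) := snd z)) `
     two_factor (X (Suc J)) (pint \<beta> (Suc J) (Suc J)) (pint \<beta> (Suc (Suc J)) (length \<beta>))"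

lemma ortho_fwd_ok: "ortho_ok ortho_fwd"
  unfolding ortho_ok_def
proof (intro allI impI conjI ballI)
  fix J k X
  assume a: "1 \<le> k \<and> k \<le> J \<and> J < length \<beta> \<and> X k \<in> Sg (k - 1) k \<and>
    X (Suc k) \<in> Sg k (if k < J then Suc k else length \<beta>)"
  define t where "t = (if k < J then Suc k else length \<beta>)"
  have t: "k - 1 < k" "k < t" "t \<le> length \<beta>" "Suc (k - 1) = k" using a by (auto simp: t_def)
  have "ortho (pint \<beta> k k) (pint \<beta> (Suc k) t) (X k) (X (Suc k)) Column \<noteq> {}"
    using ortho_column_nonempty[of k "k - 1" t "X k" "X (Suc k)"] t by simp
  then show "ortho_fwd J k X \<noteq> {}" by (simp add: ortho_fwd_def t_def)
  fix Z assume "Z \<in> ortho_fwd J k X"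
  then obtain z where z: "z \<in> ortho (pint \<beta> k k) (pint \<beta> (Suc k) t) (X k) (X (Suc k)) Column"
    "Z = X(k := fst z, Suc k := snd z)" by (auto simp: ortho_fwd_def t_def)
  obtain D where "fst z \<in> Sg (k - 1) k" "colorth k (fst z)" "D \<in> Sg k k" "X k = fst z * D" "snd z = D * X (Suc k)"
    using ortho_column_spec[OF t(1-3), of "X k" "X (Suc k)" z] a z(1) t by (auto simp: t_def)
  then show "\<exists>Q D. Z = X(k := Q, Suc k := D * X (Suc k)) \<and>
       Q \<in> Sg (k - 1) k \<and> colorth k Q \<and> D \<in> Sg k k \<and> X k = Q * D"
    using z(2) by metis
qed

lemma split_fwd_ok: "split_ok split_fwd"
  unfolding split_ok_def
proof (intro allI impI conjI ballI)
  fix J and X :: "nat \<Rightarrow> complex mat" assume a: "Suc J < length \<beta> \<and> X (Suc J) \<in> carrier_mat (nn J) (nn (length \<beta>))"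
  then have j: "J < Suc J" "Suc J < length \<beta>" "length \<beta> \<le> length \<beta>" by auto
  show "split_fwd J X \<noteq> {}" using two_factor_nonempty[OF j] by (simp add: split_fwd_def)
  fix Z assume "Z \<in> split_fwd J X"
  then obtain z where z: "z \<in> two_factor (X (Suc J)) (pint \<beta> (Suc J) (Suc J)) (pint \<beta> (Suc (Suc J)) (length \<beta>))"
    "Z = X(Suc J := fst z, Suc (Suc J) := snd z)" by (auto simp: split_fwd_def)
  have sp: "fst z \<in> Sg J (Suc J)" "snd z \<in> Sg (Suc J) (length \<beta>)"
    "\<And>H K. H \<in> Sg J (Suc J) \<Longrightarrow> K \<in> Sg (Suc J) (length \<beta>) \<Longrightarrow> frob (X (Suc J) - fst z * snd z) \<le> frob (X (Suc J) - H * K)"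
    using two_factor_spec[OF j _ z(1)] a by blast+
  then show "\<exists>H K. Z = X(Suc J := H, Suc (Suc J) := K) \<and> H \<in> Sg J (Suc J) \<and> K \<in> Sg (Suc J) (length \<beta>) \<and>
     (\<forall>H' K'. H' \<in> Sg J (Suc J) \<longrightarrow> K' \<in> Sg (Suc J) (length \<beta>) \<longrightarrow>
        frob (X (Suc J) - H * K) \<le> frob (X (Suc J) - H' * K'))"
    using z(2) by blast
qed

lemma enc_nth: "p \<le> J \<Longrightarrow> enc J X ! p = ((Suc p, if p < J then Suc p else length \<beta>), X (Suc p))"
  unfolding enc_def by (subst nth_map) (simp_all del: upt_Suc)

lemma enc_length [simp]: "length (enc J X) = Suc J" by (simp add: enc_def)

lemma ortho_step_enc:
  assumes k: "1 \<le> k" "k \<le> J"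
  shows "ortho_step \<beta> Column k (enc J X) = enc J ` ortho_fwd J k X"
proof -
  have 1: "enc J X ! (k - 1) = ((k, k), X k)" using enc_nth[of "k - 1" J X] k by auto
  have 2: "enc J X ! k = ((Suc k, if k < J then Suc k else length \<beta>), X (Suc k))" using enc_nth[of k J X] k by auto
  have 3: "(enc J X)[k - 1 := ((k, k), Q), k := ((Suc k, if k < J then Suc k else length \<beta>), Y)]
      = enc J (X(k := Q, Suc k := Y))" for Q Y
    using k by (intro nth_equalityI) (auto simp: enc_nth nth_list_update less_Suc_eq_le)
  show ?thesis unfolding ortho_step_def 1 2 prod.case Let_def 3
    unfolding ortho_fwd_def ipat_def image_image Setcompr_eq_image fst_conv snd_conv ..
qed

text \<open>In this order the cut always falls into the last interval, so the row sweep is empty and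
  the column sweep runs over all finished factors.\<close>

lemma butterfly_iter_enc:
  assumes J: "J < length \<beta>"
  shows "butterfly_iter \<beta> (Suc J) (Suc J) (enc J X) = enc (Suc J) ` sweep_split ortho_fwd split_fwd J X"
proof -
  have js: "{j. 1 \<le> j \<and> j \<le> length (enc J X) \<and> fst (fst (enc J X ! (j-1))) \<le> Suc J \<and> Suc J \<le> snd (fst (enc J X ! (j-1)))}
      = {Suc J}"
  proof (intro equalityI subsetI)
    fix j assume "j \<in> {j. 1 \<le> j \<and> j \<le> length (enc J X) \<and> fst (fst (enc J X ! (j-1))) \<le> Suc J \<and> Suc J \<le> snd (fst (enc J X ! (j-1)))}"
    then show "j \<in> {Suc J}" using enc_nth[of "j - 1" J X] by (auto split: if_splits)
  qed (use enc_nth[of J J X] J in auto)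
  have sw: "seq_steps (ortho_step \<beta> Column) [1..<Suc J] (enc J X) = enc J ` sweep_all ortho_fwd J X"
    unfolding sweep_all_def by (rule seq_steps_image) (rule ortho_step_enc)
  have ls: "take J (enc J Z) @ [((Suc J, Suc J), H), ((Suc J + 1, length \<beta>), K)] @ drop (Suc J) (enc J Z)
      = enc (Suc J) (Z(Suc J := H, Suc (Suc J) := K))" for Z H K
    by (intro nth_equalityI) (auto simp: enc_nth nth_append nth_Cons' less_Suc_eq)
  have sp: "(let ((q,t), Xj) = enc J Z ! (Suc J - 1) in
          {take (Suc J - 1) (enc J Z) @ [((q,Suc J), fst XY), ((Suc J+1,t), snd XY)] @ drop (Suc J) (enc J Z) | XY.
             XY \<in> two_factor Xj (pint \<beta> q (Suc J)) (pint \<beta> (Suc J+1) t)}) = enc (Suc J) ` split_fwd J Z" for Z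
  proof -
    have J: "Suc J - 1 = J" "enc J Z ! J = ((Suc J, length \<beta>), Z (Suc J))" using enc_nth[of J J Z] by auto
    show ?thesis
      unfolding J Let_def prod.case ls split_fwd_def image_image Setcompr_eq_image by simp
  qed
  have nil: "rev [Suc J + 1..<Suc J + 1] = []" by simp
  have "butterfly_iter \<beta> (Suc J) (Suc J) (enc J X)
      = Set.bind (enc J ` sweep_all ortho_fwd J X) (\<lambda>st. (let ((q,t), Xj) = st ! (Suc J - 1) in
          {take (Suc J - 1) st @ [((q,Suc J), fst XY), ((Suc J+1,t), snd XY)] @ drop (Suc J) st | XY.
             XY \<in> two_factor Xj (pint \<beta> q (Suc J)) (pint \<beta> (Suc J+1) t)}))"
    unfolding butterfly_iter_def js UN_one nil sw seq_steps_Nil bind_one ..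
  also have "\<dots> = enc (Suc J) ` sweep_split ortho_fwd split_fwd J X"
    unfolding bind_image sp sweep_split_def by (auto simp: Set.bind_def)
  finally show ?thesis .
qed

lemma upt_Suc_shift: "[1..<length \<beta>] = map Suc [0..<length \<beta> - 1]"
proof -
  have "Suc (length \<beta> - 1) = length \<beta>" using depth by simp
  from map_Suc_upt[of 0 "length \<beta> - 1", unfolded this] show ?thesis by simp
qed

lemma butterfly_fwd:
  "butterfly A \<beta> [1..<length \<beta>] = (\<lambda>X. map X [1..<Suc (length \<beta>)]) ` process ortho_fwd split_fwd (length \<beta> - 1) (\<lambda>_. A)"
proof -
  have s: "[1..<length \<beta>] ! (Suc J - 1) = Suc J" if "J < length \<beta> - 1" for J using that by simp
  have "foldl (\<lambda>S J. Set.bind S (butterfly_iter \<beta> J ([1..<length \<beta>] ! (J - 1)))) {[((1, length \<beta>), A)]} [1..<length \<beta>]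
      = foldl (\<lambda>S J. Set.bind S (butterfly_iter \<beta> (Suc J) ([1..<length \<beta>] ! (Suc J - 1)))) {[((1, length \<beta>), A)]} [0..<length \<beta> - 1]"
    by (subst (2) upt_Suc_shift) (simp only: foldl_map)
  also have "\<dots> = foldl (\<lambda>S J. Set.bind S (butterfly_iter \<beta> (Suc J) ([1..<length \<beta>] ! (Suc J - 1)))) (enc 0 ` {\<lambda>_. A}) [0..<length \<beta> - 1]"
    by (simp add: enc_def)
  also have "\<dots>
      = enc (length \<beta> - 1) ` process ortho_fwd split_fwd (length \<beta> - 1) (\<lambda>_. A)"
    unfolding process_def
  proof (rule foldl_bind_image)
    fix J X assume J: "J < length \<beta> - 1"
    then have "J < length \<beta>" by simp
    then show "butterfly_iter \<beta> (Suc J) ([1..<length \<beta>] ! (Suc J - 1)) (enc J X)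
        = enc (Suc J) ` sweep_split ortho_fwd split_fwd J X"
      unfolding s[OF J] by (rule butterfly_iter_enc)
  qed simp
  finally have "butterfly A \<beta> [1..<length \<beta>]
      = (\<lambda>st. map snd st) ` enc (length \<beta> - 1) ` process ortho_fwd split_fwd (length \<beta> - 1) (\<lambda>_. A)"
    unfolding butterfly_def by (rule arg_cong)
  moreover have "map snd (enc (length \<beta> - 1) X) = map X [1..<Suc (length \<beta>)]" for X
    using depth by (intro nth_equalityI) (auto simp: enc_nth simp del: upt_Suc)
  ultimately show ?thesis by (simp add: image_image del: upt_Suc)
qed

lemma Ecut_eq: "1 \<le> k \<Longrightarrow> k < length \<beta> \<Longrightarrow> Ecut A k = E_err \<beta> k A"
  unfolding Ecut_def E_err_def using Sigma_pint[of 0 k] Sigma_pint[of k "length \<beta>"] by simp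

lemma Sigma_pat_single: "1 \<le> l \<Longrightarrow> l \<le> length \<beta> \<Longrightarrow> Sigma_pat (pat \<beta> l) = Sg (l - 1) l"
  using Sigma_pint[of "l - 1" l] by (simp add: pint_def)

lemma mat_list_prod_Pr:
  assumes "X 1 \<in> carrier_mat (nn 0) c"
  shows "mat_list_prod (map X [1..<Suc (Suc m)]) = Pr X (Suc m)"
proof (induction m)
  case 0
  then show ?case using assms by (simp add: mat_list_prod_def)
next
  case (Suc m)
  have "mat_list_prod (map X [1..<Suc (Suc (Suc m))]) = mat_list_prod (map X [1..<Suc (Suc m)]) * X (Suc (Suc m))"
    using mat_list_prod_snoc[of "map X [1..<Suc (Suc m)]"] by simp
  then show ?case using Suc by simp
qed

lemma butterfly_bound_fwd:
  assumes A: "A \<in> carrier_mat (nn 0) (nn (length \<beta>))"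
  shows "butterfly A \<beta> [1..<length \<beta>] \<noteq> {} \<and>
    (\<forall>Xs \<in> butterfly A \<beta> [1..<length \<beta>]. length Xs = length \<beta> \<and>
       (\<forall>l. 1 \<le> l \<and> l \<le> length \<beta> \<longrightarrow> Xs ! (l-1) \<in> Sigma_pat (pat \<beta> l)) \<and>
       (frob (A - mat_list_prod Xs))\<^sup>2 \<le> (\<Sum>k = 1..<length \<beta>. (E_err \<beta> k A)\<^sup>2))"
proof -
  let ?L = "length \<beta>"
  have pr: "process ortho_fwd split_fwd (?L - 1) (\<lambda>_. A) \<noteq> {}"
    "\<And>X. X \<in> process ortho_fwd split_fwd (?L - 1) (\<lambda>_. A) \<Longrightarrow> after_split A (?L - 1) X"
    using process_after_split[OF A ortho_fwd_ok split_fwd_ok depth] by auto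
  have L: "Suc (?L - 1) = ?L" using depth by simp
  have "length (map X [1..<Suc ?L]) = ?L \<and>
       (\<forall>l. 1 \<le> l \<and> l \<le> ?L \<longrightarrow> map X [1..<Suc ?L] ! (l-1) \<in> Sigma_pat (pat \<beta> l)) \<and>
       (frob (A - mat_list_prod (map X [1..<Suc ?L])))\<^sup>2 \<le> (\<Sum>k = 1..<?L. (E_err \<beta> k A)\<^sup>2)"
    if X: "after_split A (?L - 1) X" for X
  proof (intro conjI allI impI)
    have Xl: "X l \<in> Sg (l - 1) l" if "1 \<le> l" "l \<le> ?L" for l
      using X that L unfolding after_split_def by (cases "l = ?L") auto
    fix l assume l: "1 \<le> l \<and> l \<le> ?L"
    have "map X [1..<Suc ?L] ! (l-1) = X l"
      using l by (subst nth_map) (auto simp del: upt_Suc)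
    then show "map X [1..<Suc ?L] ! (l-1) \<in> Sigma_pat (pat \<beta> l)" using Xl l Sigma_pat_single by simp
  next
    have "\<forall>i. 1 \<le> i \<and> i \<le> ?L - 1 \<longrightarrow> X i \<in> Sg (i - 1) i" using X unfolding after_split_def by blast
    then have X1: "X 1 \<in> carrier_mat (nn 0) (nn 1)" using Sg_carrier[of "X 1" 0 1] depth by auto
    have "mat_list_prod (map X [1..<Suc ?L]) = Pr X (?L - 1) * X ?L"
      using mat_list_prod_Pr[where X = X, OF X1, of "?L - 1"] L by (metis Pr.simps(2))
    then have "(frob (A - mat_list_prod (map X [1..<Suc ?L])))\<^sup>2 \<le> (\<Sum>k=1..?L - 1. (Ecut A k)\<^sup>2)"
      using X L by (simp add: after_split_def del: upt_Suc)
    also have "\<dots> = (\<Sum>k = 1..<?L. (E_err \<beta> k A)\<^sup>2)"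
      using depth Ecut_eq by (intro sum.cong) auto
    finally show "(frob (A - mat_list_prod (map X [1..<Suc ?L])))\<^sup>2 \<le> (\<Sum>k = 1..<?L. (E_err \<beta> k A)\<^sup>2)" .
  qed (use depth in simp)
  then show ?thesis unfolding butterfly_fwd using pr by blast
qed

end

section \<open>Splitting from right to left\<close>

context arch
begin

text \<open>The factor of level \<open>l\<close> is the transpose of the mirrored factor
  \<open>L + 1 - l\<close>, where \<open>L\<close> is the depth; the unsplit factor
  \<open>X (Suc J)\<close> therefore stands at the head of the list.\<close>

definition enc_rev :: "nat \<Rightarrow> (nat \<Rightarrow> complex mat) \<Rightarrow> bstate" where
  "enc_rev J X = map (\<lambda>p. ((if p = 0 then 1 else length \<beta> - J + p, length \<beta> - J + p),
     transpose_mat (X (Suc J - p)))) [0..<Suc J]"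

definition ortho_bwd :: "nat \<Rightarrow> nat \<Rightarrow> (nat \<Rightarrow> complex mat) \<Rightarrow> (nat \<Rightarrow> complex mat) set" where
  "ortho_bwd J k X = (\<lambda>z. X(k := transpose_mat (snd z), Suc k := transpose_mat (fst z))) `
     ortho (pint \<beta> (if k < J then length \<beta> - k else 1) (length \<beta> - k))
       (pint \<beta> (Suc (length \<beta> - k)) (Suc (length \<beta> - k)))
       (transpose_mat (X (Suc k))) (transpose_mat (X k)) Row"

definition split_bwd :: "nat \<Rightarrow> (nat \<Rightarrow> complex mat) \<Rightarrow> (nat \<Rightarrow> complex mat) set" where
  "split_bwd J X = (\<lambda>z. X(Suc J := transpose_mat (snd z), Suc (Suc J) := transpose_mat (fst z))) `
     two_factor (transpose_mat (X (Suc J))) (pint \<beta> 1 (length \<beta> - Suc J)) (pint \<beta> (Suc (length \<beta> - Suc J)) (length \<beta> - J))"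

lemma ortho_bwd_ok: "mir.ortho_ok ortho_bwd"
  unfolding mir.ortho_ok_def
proof (intro allI impI conjI ballI)
  fix J k and X :: "nat \<Rightarrow> complex mat"
  assume a: "1 \<le> k \<and> k \<le> J \<and> J < length \<beta> \<and> X k \<in> mir.Sg (k - 1) k \<and>
    X (Suc k) \<in> mir.Sg k (if k < J then Suc k else length \<beta>)"
  define k' where "k' = length \<beta> - k"
  define s where "s = length \<beta> - (if k < J then Suc k else length \<beta>)"
  have s: "s < k'" "k' < Suc k'" "Suc k' \<le> length \<beta>" "Suc s = (if k < J then length \<beta> - k else 1)"
    using a by (auto simp: s_def k'_def)
  have kk: "length \<beta> - (k - 1) = Suc k'" "length \<beta> - k' = k" "length \<beta> - Suc k' = k - 1" using a by (auto simp: k'_def)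
  have X: "transpose_mat (X (Suc k)) \<in> Sg s k'" "transpose_mat (X k) \<in> Sg k' (Suc k')"
    using a unfolding mir_Sg kk s_def k'_def[symmetric] by simp_all
  have ob: "ortho_bwd J k X = (\<lambda>z. X(k := transpose_mat (snd z), Suc k := transpose_mat (fst z))) `
     ortho (pint \<beta> (Suc s) k') (pint \<beta> (Suc k') (Suc k')) (transpose_mat (X (Suc k))) (transpose_mat (X k)) Row"
    unfolding ortho_bwd_def s(4) k'_def ..
  show "ortho_bwd J k X \<noteq> {}"
    unfolding ob using ortho_row_nonempty[OF s(1) refl s(3)] by simp
  fix Z assume "Z \<in> ortho_bwd J k X"
  then obtain z where z: "z \<in> ortho (pint \<beta> (Suc s) k') (pint \<beta> (Suc k') (Suc k'))
      (transpose_mat (X (Suc k))) (transpose_mat (X k)) Row"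
    "Z = X(k := transpose_mat (snd z), Suc k := transpose_mat (fst z))" unfolding ob by blast
  obtain D where "transpose_mat (snd z) \<in> mir.Sg (k - 1) k" "mir.colorth k (transpose_mat (snd z))"
    "D \<in> mir.Sg k k" "X k = transpose_mat (snd z) * D" "transpose_mat (fst z) = D * X (Suc k)"
    using ortho_row_spec[OF s(1-3) X z(1)] unfolding kk transpose_transpose by blast
  then show "\<exists>Q D. Z = X(k := Q, Suc k := D * X (Suc k)) \<and>
       Q \<in> mir.Sg (k - 1) k \<and> mir.colorth k Q \<and> D \<in> mir.Sg k k \<and> X k = Q * D"
    using z(2) by metis
qed

lemma frob_transpose_diff_mult:
  assumes M: "M \<in> carrier_mat m n" and H: "H \<in> carrier_mat m k" and K: "K \<in> carrier_mat k n"
  shows "frob (transpose_mat M - transpose_mat K * transpose_mat H) = frob (M - H * K)"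
  using frob_transpose[of "M - H * K"]
  unfolding transpose_minus[OF M mult_carrier_mat[OF H K]] transpose_mult[OF H K] .

lemma split_bwd_ok: "mir.split_ok split_bwd"
  unfolding mir.split_ok_def
proof (intro allI impI conjI ballI)
  fix J and X :: "nat \<Rightarrow> complex mat"
  assume a: "Suc J < length \<beta> \<and> X (Suc J) \<in> carrier_mat (nn (length \<beta> - J)) (nn (length \<beta> - length \<beta>))"
  define k where "k = length \<beta> - Suc J"
  have k: "0 < k" "k < Suc k" "Suc k \<le> length \<beta>" and kk: "length \<beta> - J = Suc k" "length \<beta> - Suc J = k"
    using a by (auto simp: k_def)
  define M where "M = transpose_mat (X (Suc J))"
  have M: "M \<in> carrier_mat (nn 0) (nn (Suc k))" "transpose_mat M = X (Suc J)" using a kk by (auto simp: M_def)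
  have sb: "split_bwd J X = (\<lambda>z. X(Suc J := transpose_mat (snd z), Suc (Suc J) := transpose_mat (fst z))) `
     two_factor M (pint \<beta> (Suc 0) k) (pint \<beta> (Suc k) (Suc k))"
    unfolding split_bwd_def kk M_def by simp
  show "split_bwd J X \<noteq> {}" unfolding sb using two_factor_nonempty[OF k] by simp
  fix Z assume "Z \<in> split_bwd J X"
  then obtain z where z: "z \<in> two_factor M (pint \<beta> (Suc 0) k) (pint \<beta> (Suc k) (Suc k))"
    "Z = X(Suc J := transpose_mat (snd z), Suc (Suc J) := transpose_mat (fst z))" unfolding sb by blast
  note sp = two_factor_spec[OF k M(1) z(1)]
  have Sgs: "Y \<in> mir.Sg J (Suc J) \<longleftrightarrow> transpose_mat Y \<in> Sg k (Suc k)"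
    "Y \<in> mir.Sg (Suc J) (length \<beta>) \<longleftrightarrow> transpose_mat Y \<in> Sg 0 k" for Y
    unfolding mir_Sg kk by simp_all
  have m: "frob (X (Suc J) - transpose_mat (snd z) * transpose_mat (fst z)) \<le> frob (X (Suc J) - H * K)"
    if HK: "H \<in> mir.Sg J (Suc J)" "K \<in> mir.Sg (Suc J) (length \<beta>)" for H K
  proof -
    have t: "transpose_mat H \<in> Sg k (Suc k)" "transpose_mat K \<in> Sg 0 k" using HK unfolding Sgs by auto
    show ?thesis
      using sp(3)[OF t(2,1)] frob_transpose_diff_mult[OF M(1) Sg_carrier[OF sp(1)] Sg_carrier[OF sp(2)]]
        frob_transpose_diff_mult[OF M(1) Sg_carrier[OF t(2)] Sg_carrier[OF t(1)]] unfolding M(2) by simp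
  qed
  have "transpose_mat (snd z) \<in> mir.Sg J (Suc J)" "transpose_mat (fst z) \<in> mir.Sg (Suc J) (length \<beta>)"
    unfolding Sgs using sp(1,2) by simp_all
  then show "\<exists>H K. Z = X(Suc J := H, Suc (Suc J) := K) \<and> H \<in> mir.Sg J (Suc J) \<and> K \<in> mir.Sg (Suc J) (length \<beta>) \<and>
     (\<forall>H' K'. H' \<in> mir.Sg J (Suc J) \<longrightarrow> K' \<in> mir.Sg (Suc J) (length \<beta>) \<longrightarrow>
        frob (X (Suc J) - H * K) \<le> frob (X (Suc J) - H' * K'))"
    using z(2) m by blast
qed

lemma enc_rev_nth:
  "p \<le> J \<Longrightarrow> enc_rev J X ! p = ((if p = 0 then 1 else length \<beta> - J + p, length \<beta> - J + p), transpose_mat (X (Suc J - p)))"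
  unfolding enc_rev_def by (subst nth_map) (simp_all del: upt_Suc)

lemma enc_rev_length [simp]: "length (enc_rev J X) = Suc J" by (simp add: enc_rev_def)

lemma ortho_step_enc_rev:
  assumes k: "1 \<le> k" "k \<le> J" and J: "J < length \<beta>"
  shows "ortho_step \<beta> Row (Suc J - k) (enc_rev J X) = enc_rev J ` ortho_bwd J k X"
proof -
  define a where "a = (if k < J then length \<beta> - k else 1)"
  define l where "l = length \<beta> - k"
  have s: "Suc J - k - 1 = J - k" using k by simp
  have 1: "enc_rev J X ! (J - k) = ((a, l), transpose_mat (X (Suc k)))"
    using enc_rev_nth[of "J - k" J X] k J by (auto simp: a_def l_def Suc_diff_le)
  have 2: "enc_rev J X ! (Suc J - k) = ((Suc l, Suc l), transpose_mat (X k))"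
    using enc_rev_nth[of "Suc J - k" J X] k J by (auto simp: l_def)
  have 3: "(enc_rev J X)[J - k := ((a, l), fst z), Suc J - k := ((Suc l, Suc l), snd z)]
      = enc_rev J (X(k := transpose_mat (snd z), Suc k := transpose_mat (fst z)))" for z
    using k J by (intro nth_equalityI) (auto simp: enc_rev_nth nth_list_update less_Suc_eq_le a_def l_def)
  show ?thesis unfolding ortho_step_def s 1 2 prod.case Let_def 3
    unfolding ortho_bwd_def ipat_def image_image Setcompr_eq_image fst_conv snd_conv a_def l_def ..
qed

text \<open>Now the cut always falls into the first interval: the column sweep is empty and the row
  sweep, read from the right end, is the mirrored column sweep.\<close>

lemma butterfly_iter_enc_rev:
  assumes J: "Suc J < length \<beta>"
  shows "butterfly_iter \<beta> (Suc J) (length \<beta> - Suc J) (enc_rev J X) = enc_rev (Suc J) ` sweep_split ortho_bwd split_bwd J X"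
proof -
  define s where "s = length \<beta> - Suc J"
  have LJ: "length \<beta> - J = s + 1" "s \<ge> 1" using J by (auto simp: s_def)
  have js: "{j. 1 \<le> j \<and> j \<le> length (enc_rev J X) \<and> fst (fst (enc_rev J X ! (j-1))) \<le> s \<and> s \<le> snd (fst (enc_rev J X ! (j-1)))}
      = {1}"
  proof (intro equalityI subsetI)
    fix j assume j: "j \<in> {j. 1 \<le> j \<and> j \<le> length (enc_rev J X) \<and> fst (fst (enc_rev J X ! (j-1))) \<le> s \<and> s \<le> snd (fst (enc_rev J X ! (j-1)))}"
    then show "j \<in> {1}" using enc_rev_nth[of "j - 1" J X] LJ by (auto split: if_splits)
  qed (use enc_rev_nth[of 0 J X] LJ in auto)
  \<comment> \<open>The row sweep visits the positions \<open>Suc J\<close> down to 2, counted from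
    1; mirrored step \<open>k\<close> is the visit to \<open>Suc (Suc J) - k\<close>.\<close>
  have lst: "rev [1 + 1..<Suc J + 1] = map (\<lambda>k. Suc (Suc J) - k) [1..<Suc J]"
    by (intro nth_equalityI) (auto simp: rev_nth simp del: upt_Suc)
  have sw: "seq_steps (\<lambda>k. ortho_step \<beta> Row (k - 1)) (rev [1 + 1..<Suc J + 1]) (enc_rev J X)
      = enc_rev J ` sweep_all ortho_bwd J X"
  proof -
    have "seq_steps (\<lambda>k. ortho_step \<beta> Row (k - 1)) (rev [1 + 1..<Suc J + 1]) (enc_rev J X)
        = seq_steps (\<lambda>k. ortho_step \<beta> Row (Suc (Suc J) - k - 1)) [1..<Suc J] (enc_rev J X)"
      unfolding lst seq_steps_def foldl_map ..
    also have "\<dots> = enc_rev J ` sweep_all ortho_bwd J X"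
      unfolding sweep_all_def
    proof (rule seq_steps_image)
      fix k X assume k: "1 \<le> k" "k \<le> J"
      then have "Suc (Suc J) - k - 1 = Suc J - k" by simp
      then show "ortho_step \<beta> Row (Suc (Suc J) - k - 1) (enc_rev J X) = enc_rev J ` ortho_bwd J k X"
        using ortho_step_enc_rev[OF k] J by simp
    qed
    finally show ?thesis .
  qed
  have ls: "take 0 (enc_rev J Z) @ [((1, s), fst z), ((s + 1, s + 1), snd z)] @ drop 1 (enc_rev J Z)
      = enc_rev (Suc J) (Z(Suc J := transpose_mat (snd z), Suc (Suc J) := transpose_mat (fst z)))" for Z z
  proof (rule nth_equalityI)
    fix i assume "i < length (take 0 (enc_rev J Z) @ [((1, s), fst z), ((s + 1, s + 1), snd z)] @ drop 1 (enc_rev J Z))"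
    then have i: "i < Suc (Suc J)" by simp
    consider "i = 0" | "i = 1" | p where "i = Suc (Suc p)" "p < J" using i by (metis One_nat_def Suc_less_eq not0_implies_Suc)
    then show "(take 0 (enc_rev J Z) @ [((1, s), fst z), ((s + 1, s + 1), snd z)] @ drop 1 (enc_rev J Z)) ! i
        = enc_rev (Suc J) (Z(Suc J := transpose_mat (snd z), Suc (Suc J) := transpose_mat (fst z))) ! i"
    proof cases
      case 3
      then show ?thesis
        using enc_rev_nth[of "Suc p" J Z] enc_rev_nth[of i "Suc J"] LJ(1) by (auto simp: s_def[symmetric])
    qed (use enc_rev_nth[of i "Suc J"] in \<open>auto simp: s_def[symmetric]\<close>)
  qed simp
  have sp: "(let ((q,t), Xj) = enc_rev J Z ! (1 - 1) in
          {take (1 - 1) (enc_rev J Z) @ [((q,s), fst XY), ((s+1,t), snd XY)] @ drop 1 (enc_rev J Z) | XY.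
             XY \<in> two_factor Xj (pint \<beta> q s) (pint \<beta> (s+1) t)}) = enc_rev (Suc J) ` split_bwd J Z" for Z
  proof -
    have e: "1 - 1 = (0::nat)" "enc_rev J Z ! 0 = ((1, s + 1), transpose_mat (Z (Suc J)))"
      using enc_rev_nth[of 0 J Z] LJ by auto
    show ?thesis
      unfolding e Let_def prod.case ls split_bwd_def image_image Setcompr_eq_image s_def[symmetric] LJ(1) by simp
  qed
  have nil: "[1..<1] = ([] :: nat list)" by simp
  have "butterfly_iter \<beta> (Suc J) s (enc_rev J X)
      = Set.bind (enc_rev J ` sweep_all ortho_bwd J X) (\<lambda>st. (let ((q,t), Xj) = st ! (1 - 1) in
          {take (1 - 1) st @ [((q,s), fst XY), ((s+1,t), snd XY)] @ drop 1 st | XY.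
             XY \<in> two_factor Xj (pint \<beta> q s) (pint \<beta> (s+1) t)}))"
    unfolding butterfly_iter_def js UN_one nil seq_steps_Nil bind_one sw ..
  also have "\<dots> = enc_rev (Suc J) ` sweep_split ortho_bwd split_bwd J X"
    unfolding bind_image sp sweep_split_def by (auto simp: Set.bind_def)
  finally show ?thesis by (simp add: s_def)
qed

lemma butterfly_bwd:
  "butterfly A \<beta> (rev [1..<length \<beta>]) = (\<lambda>X. map (\<lambda>p. transpose_mat (X (length \<beta> - p))) [0..<length \<beta>]) `
     process ortho_bwd split_bwd (length \<beta> - 1) (\<lambda>_. transpose_mat A)"
proof -
  have s: "rev [1..<length \<beta>] ! (Suc J - 1) = length \<beta> - Suc J" if "J < length \<beta> - 1" for J
    using that by (simp add: rev_nth)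
  have "foldl (\<lambda>S J. Set.bind S (butterfly_iter \<beta> J (rev [1..<length \<beta>] ! (J - 1)))) {[((1, length \<beta>), A)]} [1..<length \<beta>]
      = foldl (\<lambda>S J. Set.bind S (butterfly_iter \<beta> (Suc J) (rev [1..<length \<beta>] ! (Suc J - 1)))) {[((1, length \<beta>), A)]} [0..<length \<beta> - 1]"
    by (subst (2) upt_Suc_shift) (simp only: foldl_map)
  also have "\<dots> = foldl (\<lambda>S J. Set.bind S (butterfly_iter \<beta> (Suc J) (rev [1..<length \<beta>] ! (Suc J - 1))))
      (enc_rev 0 ` {\<lambda>_. transpose_mat A}) [0..<length \<beta> - 1]"
    by (simp add: enc_rev_def)
  also have "\<dots> = enc_rev (length \<beta> - 1) ` process ortho_bwd split_bwd (length \<beta> - 1) (\<lambda>_. transpose_mat A)"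
    unfolding process_def
  proof (rule foldl_bind_image)
    fix J X assume J: "J < length \<beta> - 1"
    then have "Suc J < length \<beta>" by simp
    then show "butterfly_iter \<beta> (Suc J) (rev [1..<length \<beta>] ! (Suc J - 1)) (enc_rev J X)
        = enc_rev (Suc J) ` sweep_split ortho_bwd split_bwd J X"
      unfolding s[OF J] by (rule butterfly_iter_enc_rev)
  qed simp
  finally have "butterfly A \<beta> (rev [1..<length \<beta>])
      = (\<lambda>st. map snd st) ` enc_rev (length \<beta> - 1) ` process ortho_bwd split_bwd (length \<beta> - 1) (\<lambda>_. transpose_mat A)"
    unfolding butterfly_def by (rule arg_cong)
  moreover have "map snd (enc_rev (length \<beta> - 1) X) = map (\<lambda>p. transpose_mat (X (length \<beta> - p))) [0..<length \<beta>]" for X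
    using depth by (intro nth_equalityI) (auto simp: enc_rev_nth simp del: upt_Suc)
  ultimately show ?thesis by (simp add: image_image del: upt_Suc)
qed

text \<open>The list product grows from the left, whereas the transposed mirrored product has its
  newest factor on the left, so the two must be compared by moving one factor at a time.\<close>

lemma mat_list_prod_rev:
  assumes X: "\<And>i. 1 \<le> i \<Longrightarrow> i \<le> length \<beta> \<Longrightarrow> X i \<in> mir.Sg (i - 1) i"
  shows "mat_list_prod (map (\<lambda>p. transpose_mat (X (length \<beta> - p))) [0..<length \<beta>])
    = transpose_mat (mir.Pr X (length \<beta>))"
proof -
  let ?L = "length \<beta>" and ?M = "\<lambda>q. mat_list_prod (map (\<lambda>p. transpose_mat (X (length \<beta> - p))) [0..<q])"
  have Xc: "transpose_mat (X (?L - q)) \<in> carrier_mat (nn q) (nn (Suc q))" if "q < ?L" for q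
    using mir.Sg_carrier[OF X[of "?L - q"]] that by (auto simp: Suc_diff_Suc)
  have Pc: "transpose_mat (mir.Pr X l) \<in> carrier_mat (nn (?L - l)) (nn ?L)" if "l \<le> ?L" for l
    using mir.Sg_carrier[OF mir.Pr_Sg[of l X]] X that by auto
  \<comment> \<open>Loop invariant: the factors already multiplied, times the transpose of the
    remaining mirrored prefix, give the full product. At the end that prefix is the
    identity.\<close>
  have "?M (Suc q) \<in> carrier_mat (nn 0) (nn (Suc q)) \<and>
      ?M (Suc q) * transpose_mat (mir.Pr X (?L - Suc q)) = transpose_mat (mir.Pr X ?L)" if "Suc q \<le> ?L" for q
    using that
  proof (induction q)
    case 0
    have L: "?L = Suc (?L - 1)" and L0: "0 < ?L" using depth by auto
    have "mir.Pr X ?L = mir.Pr X (?L - 1) * X ?L" by (subst (1 3) L) simp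
    then have "transpose_mat (mir.Pr X ?L) = transpose_mat (X ?L) * transpose_mat (mir.Pr X (?L - 1))"
      using transpose_mult[of "mir.Pr X (?L - 1)" "nn ?L" "nn 1" "X ?L" "nn 0"] Pc[of "?L - 1"] Xc[OF L0] depth by simp
    then show ?case using Xc[OF L0] by (simp add: mat_list_prod_def)
  next
    case (Suc q)
    then have IH: "?M (Suc q) \<in> carrier_mat (nn 0) (nn (Suc q))"
      "?M (Suc q) * transpose_mat (mir.Pr X (?L - Suc q)) = transpose_mat (mir.Pr X ?L)" by auto
    have M: "?M (Suc (Suc q)) = ?M (Suc q) * transpose_mat (X (?L - Suc q))"
      using mat_list_prod_snoc[of "map (\<lambda>p. transpose_mat (X (?L - p))) [0..<Suc q]"] by simp
    have d: "?L - Suc q = Suc (?L - Suc (Suc q))" using Suc.prems by simp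
    have c1: "transpose_mat (X (?L - Suc q)) \<in> carrier_mat (nn (Suc q)) (nn (Suc (Suc q)))" using Xc[of "Suc q"] Suc.prems by simp
    have c2: "transpose_mat (mir.Pr X (?L - Suc (Suc q))) \<in> carrier_mat (nn (Suc (Suc q))) (nn ?L)"
      using Pc[of "?L - Suc (Suc q)"] Suc.prems by simp
    have "transpose_mat (mir.Pr X (?L - Suc q)) = transpose_mat (X (?L - Suc q)) * transpose_mat (mir.Pr X (?L - Suc (Suc q)))"
      using transpose_mult[of "mir.Pr X (?L - Suc (Suc q))" "nn ?L" "nn (Suc (Suc q))" "X (?L - Suc q)" "nn (Suc q)"] c1 c2
      unfolding d by simp
    then have "?M (Suc (Suc q)) * transpose_mat (mir.Pr X (?L - Suc (Suc q))) = transpose_mat (mir.Pr X ?L)"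
      unfolding M assoc_mult_mat[OF IH(1) c1 c2] using IH(2) by simp
    moreover have "?M (Suc (Suc q)) \<in> carrier_mat (nn 0) (nn (Suc (Suc q)))"
      unfolding M by (rule mult_carrier_mat[OF IH(1) c1])
    ultimately show ?case by blast
  qed
  moreover have L: "Suc (?L - 1) = ?L" using depth by simp
  ultimately have M: "?M ?L \<in> carrier_mat (nn 0) (nn ?L)"
    "?M ?L * transpose_mat (mir.Pr X (?L - ?L)) = transpose_mat (mir.Pr X ?L)" by (metis order_refl)+
  have "transpose_mat (mir.Pr X (?L - ?L)) = 1\<^sub>m (nn ?L)" by simp
  then show ?thesis using M(2) right_mult_one_mat[OF M(1)] by simp
qed

lemma butterfly_bound_bwd:
  assumes A: "A \<in> carrier_mat (nn 0) (nn (length \<beta>))"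
  shows "butterfly A \<beta> (rev [1..<length \<beta>]) \<noteq> {} \<and>
    (\<forall>Xs \<in> butterfly A \<beta> (rev [1..<length \<beta>]). length Xs = length \<beta> \<and>
       (\<forall>l. 1 \<le> l \<and> l \<le> length \<beta> \<longrightarrow> Xs ! (l-1) \<in> Sigma_pat (pat \<beta> l)) \<and>
       (frob (A - mat_list_prod Xs))\<^sup>2 \<le> (\<Sum>k = 1..<length \<beta>. (E_err \<beta> k A)\<^sup>2))"
proof -
  let ?L = "length \<beta>" and ?At = "transpose_mat A"
  have At: "?At \<in> carrier_mat (nn (?L - 0)) (nn (?L - ?L))" using A by simp
  have pr: "process ortho_bwd split_bwd (?L - 1) (\<lambda>_. ?At) \<noteq> {}"
    "\<And>X. X \<in> process ortho_bwd split_bwd (?L - 1) (\<lambda>_. ?At) \<Longrightarrow> mir.after_split ?At (?L - 1) X"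
    using mir.process_after_split[OF At ortho_bwd_ok split_bwd_ok depth] by auto
  have L: "Suc (?L - 1) = ?L" using depth by simp
  have "length (map (\<lambda>p. transpose_mat (X (?L - p))) [0..<?L]) = ?L \<and>
       (\<forall>l. 1 \<le> l \<and> l \<le> ?L \<longrightarrow> map (\<lambda>p. transpose_mat (X (?L - p))) [0..<?L] ! (l-1) \<in> Sigma_pat (pat \<beta> l)) \<and>
       (frob (A - mat_list_prod (map (\<lambda>p. transpose_mat (X (?L - p))) [0..<?L])))\<^sup>2 \<le> (\<Sum>k = 1..<?L. (E_err \<beta> k A)\<^sup>2)"
    if X: "mir.after_split ?At (?L - 1) X" for X
  proof -
    have Xl: "X l \<in> mir.Sg (l - 1) l" if "1 \<le> l" "l \<le> ?L" for l
      using X that L unfolding mir.after_split_def by (cases "l = ?L") auto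
    have "map (\<lambda>p. transpose_mat (X (?L - p))) [0..<?L] ! (l-1) \<in> Sigma_pat (pat \<beta> l)" if l: "1 \<le> l" "l \<le> ?L" for l
    proof -
      have e: "?L - (?L - (l - 1)) = l - 1" "?L - (?L - (l - 1) - 1) = l" using l by auto
      have "transpose_mat (X (?L - (l - 1))) \<in> Sg (l - 1) l"
        using Xl[of "?L - (l - 1)"] l unfolding mir_Sg e by simp
      moreover have "map (\<lambda>p. transpose_mat (X (?L - p))) [0..<?L] ! (l-1) = transpose_mat (X (?L - (l - 1)))"
        using l by (subst nth_map) auto
      ultimately show ?thesis unfolding Sigma_pat_single[OF l] by simp
    qed
    moreover have "(frob (A - mat_list_prod (map (\<lambda>p. transpose_mat (X (?L - p))) [0..<?L])))\<^sup>2
        \<le> (\<Sum>k = 1..<?L. (E_err \<beta> k A)\<^sup>2)"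
    proof -
      have Pc: "mir.Pr X ?L \<in> carrier_mat (nn (?L - 0)) (nn (?L - ?L))" using mir.Sg_carrier[OF mir.Pr_Sg[of ?L X]] Xl by auto
      have "transpose_mat (?At - mir.Pr X ?L) = A - transpose_mat (mir.Pr X ?L)"
        using transpose_minus[OF At Pc] by simp
      moreover have "mat_list_prod (map (\<lambda>p. transpose_mat (X (?L - p))) [0..<?L]) = transpose_mat (mir.Pr X ?L)"
        by (rule mat_list_prod_rev) (rule Xl)
      ultimately have "frob (A - mat_list_prod (map (\<lambda>p. transpose_mat (X (?L - p))) [0..<?L])) = frob (?At - mir.Pr X ?L)"
        using frob_transpose[of "?At - mir.Pr X ?L"] by simp
      also have "mir.Pr X ?L = mir.Pr X (?L - 1) * X (Suc (?L - 1))"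
        using mir.Pr.simps(2)[of X "?L - 1"] unfolding L .
      finally have "(frob (A - mat_list_prod (map (\<lambda>p. transpose_mat (X (?L - p))) [0..<?L])))\<^sup>2
          \<le> (\<Sum>k=1..?L - 1. (mir.Ecut ?At k)\<^sup>2)"
        using X unfolding mir.after_split_def by simp
      also have "\<dots> = (\<Sum>k=1..<?L. (E_err \<beta> (?L - k) A)\<^sup>2)"
        using depth by (intro sum.cong) (auto simp: mir_Ecut[OF A] Ecut_eq)
      also have "\<dots> = (\<Sum>k=1..<?L. (E_err \<beta> k A)\<^sup>2)"
        by (rule sum.reindex_bij_witness[of _ "\<lambda>k. ?L - k" "\<lambda>k. ?L - k"]) auto
      finally show ?thesis .
    qed
    moreover have "length (map (\<lambda>p. transpose_mat (X (?L - p))) [0..<?L]) = ?L" by simp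
    ultimately show ?thesis by blast
  qed
  then show ?thesis unfolding butterfly_bwd using pr by blast
qed

end

theorem theorem7p3:
  fixes \<beta> :: "pattern list" and A :: "complex mat" and \<sigma> :: "nat list"
  assumes "architecture \<beta>" and "chainable_arch \<beta>" and "\<not> redundant_arch \<beta>"
    and "length \<beta> \<ge> 2"
    and "A \<in> carrier_mat (nrows (pat \<beta> 1)) (ncols (pat \<beta> (length \<beta>)))"
    and "\<sigma> = [1..<length \<beta>] \<or> \<sigma> = rev [1..<length \<beta>]"
  shows "butterfly A \<beta> \<sigma> \<noteq> {} \<and>
    (\<forall>Xs \<in> butterfly A \<beta> \<sigma>. length Xs = length \<beta> \<and>
       (\<forall>l. 1 \<le> l \<and> l \<le> length \<beta> \<longrightarrow> Xs ! (l-1) \<in> Sigma_pat (pat \<beta> l)) \<and>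
       (frob (A - mat_list_prod Xs))\<^sup>2 \<le> (\<Sum>k = 1..<length \<beta>. (E_err \<beta> k A)\<^sup>2))"
proof -
  interpret arch \<beta> using assms(1-4) by unfold_locales
  have A: "A \<in> carrier_mat (nn 0) (nn (length \<beta>))"
    using assms(5) depth by (auto simp: nn_def)
  show ?thesis
    using assms(6)
  proof
    assume "\<sigma> = [1..<length \<beta>]"
    then show ?thesis using butterfly_bound_fwd[OF A] by blast
  next
    assume "\<sigma> = rev [1..<length \<beta>]"
    then show ?thesis using butterfly_bound_bwd[OF A] by blast
  qed
qed

end
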